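(* Let $\mathbb{W}=m_1P_1+\cdots+m_sP_s$ be a fat point scheme in $\mathbb{P}^n$ such that $m_i\ge 2$ for some $i\in\{1,\dots,s\}$, and let $1\le m\le n+1$. The Hilbert polynomial of $\Omega^m_{R_{\mathbb{W}}/K}$ is a constant polynomial which is bounded by $$\sum_{i=1}^s\binom{n+1}{m}\binom{m_i+n-2}{n}\le\mathrm{HP}_{\Omega^m_{R_{\mathbb{W}}/K}}(z)\le\sum_{i=1}^s\binom{n+1}{m}\binom{m_i+n-1}{n}.$$
   Context: $K$ is a field of characteristic zero, $S=K[X_0,\dots,X_n]$ ($n\ge1$) with the standard grading is the homogeneous coordinate ring of $\mathbb{P}^n$ over $K$. Given distinct $K$-rational points $P_1,\dots,P_s\in\mathbb{P}^n$ ($s\ge1$, coordinates chosen so that none lies on $X_0=0$) with homogeneous vanishing ideals $\wp_1,\dots,\wp_s\subseteq S$ and positive integers $m_1,\dots,m_s$, the fat point scheme $\mathbb{W}=m_1P_1+\cdots+m_sP_s$ is the $0$-dimensional subscheme of $\mathbb{P}^n$ with homogeneous vanishing ideal $I_{\mathbb{W}}=\wp_1^{m_1}\cap\cdots\cap\wp_s^{m_s}$; $R_{\mathbb{W}}=S/I_{\mathbb{W}}$. $\Omega^1_{R_{\mathbb{W}}/K}$ is the module of Kähler differentials of $R_{\mathbb{W}}/K$, graded with $\deg(dx_i)=1$ where $x_i$ is the image of $X_i$, and $\Omega^m_{R_{\mathbb{W}}/K}=\bigwedge^m_{R_{\mathbb{W}}}\Omega^1_{R_{\mathbb{W}}/K}$.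 $\mathrm{HP}_M$ denotes the Hilbert polynomial of a finitely generated graded module $M$. *)

theory Defs
  imports
    "HOL-Library.Poly_Mapping"
    "HOL-Algebra.Ideal_Product"
    "HOL-Algebra.QuotRing"
    "Jordan_Normal_Form.VS_Connect"
begin

text \<open>A polynomial maps exponent vectors to coefficients; the multiplication of the type
  \<open>(nat \<Rightarrow>\<^sub>0 nat) \<Rightarrow>\<^sub>0 'k\<close> is the convolution product.\<close>

type_synonym 'k mpoly = "(nat \<Rightarrow>\<^sub>0 nat) \<Rightarrow>\<^sub>0 'k"

definition mpoly_ring :: "nat \<Rightarrow> 'k::comm_ring_1 mpoly ring"
  where "mpoly_ring n =
    \<lparr>carrier = {f. \<forall>t\<in>Poly_Mapping.keys f. Poly_Mapping.keys t \<subseteq> {..n}},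
     mult = (*), one = 1, zero = 0, add = (+)\<rparr>"

definition mpoly_const :: "'k::comm_ring_1 \<Rightarrow> 'k mpoly"
  where "mpoly_const c = Poly_Mapping.single 0 c"

definition mpoly_var :: "nat \<Rightarrow> 'k::comm_ring_1 mpoly"
  where "mpoly_var i = Poly_Mapping.single (Poly_Mapping.single i 1) 1"

definition mpoly_eval :: "'k::comm_ring_1 mpoly \<Rightarrow> (nat \<Rightarrow> 'k) \<Rightarrow> 'k"
  where "mpoly_eval f a = (\<Sum>t\<in>Poly_Mapping.keys f. Poly_Mapping.lookup f t *
           (\<Prod>i\<in>Poly_Mapping.keys t. a i ^ Poly_Mapping.lookup t i))"

definition homogeneous_part :: "nat \<Rightarrow> nat \<Rightarrow> 'k::comm_ring_1 mpoly set"
  where "homogeneous_part n d = {f \<in> carrier (mpoly_ring n).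
           \<forall>t\<in>Poly_Mapping.keys f. (\<Sum>i\<in>Poly_Mapping.keys t. Poly_Mapping.lookup t i) = d}"

text \<open>A \<open>K\<close>-rational point of projective \<open>n\<close>-space is given by homogeneous coordinates
  \<open>p 0, \<dots>, p n\<close>, not all zero; values beyond \<open>n\<close> are irrelevant.\<close>

definition same_proj_point :: "nat \<Rightarrow> (nat \<Rightarrow> 'k::field) \<Rightarrow> (nat \<Rightarrow> 'k) \<Rightarrow> bool"
  where "same_proj_point n p q \<longleftrightarrow> (\<exists>c. c \<noteq> 0 \<and> (\<forall>i\<le>n. q i = c * p i))"

definition vanishing_ideal :: "nat \<Rightarrow> (nat \<Rightarrow> 'k::field) \<Rightarrow> 'k mpoly set"
  where "vanishing_ideal n p =
    Idl\<^bsub>mpoly_ring n\<^esub> {f. (\<exists>d. f \<in> homogeneous_part n d) \<and> mpoly_eval f p = 0}"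

definition fat_point_ideal ::
    "nat \<Rightarrow> nat \<Rightarrow> (nat \<Rightarrow> nat \<Rightarrow> 'k::field) \<Rightarrow> (nat \<Rightarrow> nat) \<Rightarrow> 'k mpoly set"
  where "fat_point_ideal n s P \<mu> =
    (\<Inter>i\<in>{1..s}. vanishing_ideal n (P i) [^]\<^bsub>ideals_set (mpoly_ring n)\<^esub> \<mu> i)"

abbreviation coord_ring :: "nat \<Rightarrow> 'k::field mpoly set \<Rightarrow> 'k mpoly set ring"
  where "coord_ring n I \<equiv> mpoly_ring n Quot I"

definition coord_class :: "nat \<Rightarrow> 'k::field mpoly set \<Rightarrow> 'k mpoly \<Rightarrow> 'k mpoly set"
  where "coord_class n I f = I +>\<^bsub>mpoly_ring n\<^esub> f"

definition coord_const :: "nat \<Rightarrow> 'k::field mpoly set \<Rightarrow> 'k \<Rightarrow> 'k mpoly set"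
  where "coord_const n I c = coord_class n I (mpoly_const c)"

definition coord_part :: "nat \<Rightarrow> 'k::field mpoly set \<Rightarrow> nat \<Rightarrow> 'k mpoly set set"
  where "coord_part n I d = coord_class n I ` homogeneous_part n d"

text \<open>The \<^const>\<open>mult\<close> and \<^const>\<open>one\<close> fields of a module record carry no meaning.\<close>

definition free_module :: "('r, 'q) ring_scheme \<Rightarrow> 'x set \<Rightarrow> ('r, 'x \<Rightarrow> 'r) module"
  where "free_module R X =
    \<lparr>carrier = {f. (\<forall>x. f x \<in> carrier R) \<and> (\<forall>x. x \<notin> X \<longrightarrow> f x = \<zero>\<^bsub>R\<^esub>) \<and>
                  finite {x. f x \<noteq> \<zero>\<^bsub>R\<^esub>}},
     mult = (\<lambda>_ _ _. \<zero>\<^bsub>R\<^esub>), one = (\<lambda>_. \<zero>\<^bsub>R\<^esub>), zero = (\<lambda>_. \<zero>\<^bsub>R\<^esub>),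
     add = (\<lambda>f g x. f x \<oplus>\<^bsub>R\<^esub> g x), smult = (\<lambda>r f x. r \<otimes>\<^bsub>R\<^esub> f x)\<rparr>"

definition free_gen :: "('r, 'q) ring_scheme \<Rightarrow> 'x \<Rightarrow> 'x \<Rightarrow> 'r"
  where "free_gen R x = (\<lambda>y. if y = x then \<one>\<^bsub>R\<^esub> else \<zero>\<^bsub>R\<^esub>)"

definition quotient_module :: "('r, 'm, 'q) module_scheme \<Rightarrow> 'm set \<Rightarrow> ('r, 'm set) module"
  where "quotient_module M N =
    \<lparr>carrier = a_rcosets\<^bsub>M\<^esub> N, mult = (\<lambda>_ _. N), one = N, zero = N, add = set_add M,
     smult = (\<lambda>r A. \<Union>a\<in>A. N +>\<^bsub>M\<^esub> (r \<odot>\<^bsub>M\<^esub> a))\<rparr>"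

definition rel_submodule ::
    "('r, 'q) ring_scheme \<Rightarrow> 'x set \<Rightarrow> ('x \<Rightarrow> 'r) set \<Rightarrow> ('x \<Rightarrow> 'r) set"
  where "rel_submodule R X Rel = LinearCombinations.module.span R (free_module R X) Rel"

definition presented_module ::
    "('r, 'q) ring_scheme \<Rightarrow> 'x set \<Rightarrow> ('x \<Rightarrow> 'r) set \<Rightarrow> ('r, ('x \<Rightarrow> 'r) set) module"
  where "presented_module R X Rel = quotient_module (free_module R X) (rel_submodule R X Rel)"

definition presented_gen ::
    "('r, 'q) ring_scheme \<Rightarrow> 'x set \<Rightarrow> ('x \<Rightarrow> 'r) set \<Rightarrow> 'x \<Rightarrow> ('x \<Rightarrow> 'r) set"
  where "presented_gen R X Rel x = rel_submodule R X Rel +>\<^bsub>free_module R X\<^esub> free_gen R x"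

text \<open>\<open>C\<close> is the image of the base ring in the algebra \<open>R\<close>. The module of Kaehler
  differentials is generated by symbols \<open>da\<close> for all \<open>a \<in> R\<close>, subject to additivity,
  the Leibniz rule, and \<open>dc = 0\<close> for \<open>c \<in> C\<close>.\<close>

definition kaehler_rels :: "'r set \<Rightarrow> ('r, 'q) ring_scheme \<Rightarrow> ('r \<Rightarrow> 'r) set"
  where "kaehler_rels C R = (let F = free_module R (carrier R); \<delta> = free_gen R in
      {\<delta> (a \<oplus>\<^bsub>R\<^esub> b) \<ominus>\<^bsub>F\<^esub> (\<delta> a \<oplus>\<^bsub>F\<^esub> \<delta> b) | a b. a \<in> carrier R \<and> b \<in> carrier R}
    \<union> {\<delta> (a \<otimes>\<^bsub>R\<^esub> b) \<ominus>\<^bsub>F\<^esub> (a \<odot>\<^bsub>F\<^esub> \<delta> b \<oplus>\<^bsub>F\<^esub> b \<odot>\<^bsub>F\<^esub> \<delta> a) | a b. a \<in> carrier R \<and> b \<in> carrier R}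
    \<union> \<delta> ` C)"

definition kaehler :: "'r set \<Rightarrow> ('r, 'q) ring_scheme \<Rightarrow> ('r, ('r \<Rightarrow> 'r) set) module"
  where "kaehler C R = presented_module R (carrier R) (kaehler_rels C R)"

definition univ_deriv :: "'r set \<Rightarrow> ('r, 'q) ring_scheme \<Rightarrow> 'r \<Rightarrow> ('r \<Rightarrow> 'r) set"
  where "univ_deriv C R = presented_gen R (carrier R) (kaehler_rels C R)"

text \<open>The \<open>m\<close>-th exterior power is generated by symbols \<open>w\<^sub>1 \<and> \<dots> \<and> w\<^sub>m\<close>, represented by the
  lists \<open>[w\<^sub>1, \<dots>, w\<^sub>m]\<close>, subject to multilinearity and to vanishing on lists with a repeated
  entry.\<close>

definition ext_lists :: "nat \<Rightarrow> ('r, 'm, 'q) module_scheme \<Rightarrow> 'm list set"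
  where "ext_lists m M = {ws. length ws = m \<and> set ws \<subseteq> carrier M}"

definition ext_rels ::
    "nat \<Rightarrow> ('r, 'p) ring_scheme \<Rightarrow> ('r, 'm, 'q) module_scheme \<Rightarrow> ('m list \<Rightarrow> 'r) set"
  where "ext_rels m R M = (let F = free_module R (ext_lists m M); \<delta> = free_gen R in
      {\<delta> (ws[i := v \<oplus>\<^bsub>M\<^esub> w]) \<ominus>\<^bsub>F\<^esub> (\<delta> (ws[i := v]) \<oplus>\<^bsub>F\<^esub> \<delta> (ws[i := w])) | ws i v w.
         ws \<in> ext_lists m M \<and> i < m \<and> v \<in> carrier M \<and> w \<in> carrier M}
    \<union> {\<delta> (ws[i := r \<odot>\<^bsub>M\<^esub> v]) \<ominus>\<^bsub>F\<^esub> r \<odot>\<^bsub>F\<^esub> \<delta> (ws[i := v]) | ws i r v.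
         ws \<in> ext_lists m M \<and> i < m \<and> r \<in> carrier R \<and> v \<in> carrier M}
    \<union> {\<delta> ws | ws. ws \<in> ext_lists m M \<and> \<not> distinct ws})"

definition ext_power ::
    "nat \<Rightarrow> ('r, 'p) ring_scheme \<Rightarrow> ('r, 'm, 'q) module_scheme \<Rightarrow> ('r, ('m list \<Rightarrow> 'r) set) module"
  where "ext_power m R M = presented_module R (ext_lists m M) (ext_rels m R M)"

definition wedge ::
    "nat \<Rightarrow> ('r, 'p) ring_scheme \<Rightarrow> ('r, 'm, 'q) module_scheme \<Rightarrow> 'm list \<Rightarrow> ('m list \<Rightarrow> 'r) set"
  where "wedge m R M = presented_gen R (ext_lists m M) (ext_rels m R M)"

definition restrict_scalars :: "('k \<Rightarrow> 'r) \<Rightarrow> ('r, 'm, 'q) module_scheme \<Rightarrow> ('k, 'm) module"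
  where "restrict_scalars \<phi> M =
    \<lparr>carrier = carrier M, mult = mult M, one = one M, zero = zero M, add = add M,
     smult = (\<lambda>c v. \<phi> c \<odot>\<^bsub>M\<^esub> v)\<rparr>"

definition span_over ::
    "('k::field \<Rightarrow> 'r) \<Rightarrow> ('r, 'm, 'q) module_scheme \<Rightarrow> 'm set \<Rightarrow> 'm set"
  where "span_over \<phi> M A = LinearCombinations.module.span class_ring (restrict_scalars \<phi> M) A"

definition dim_over ::
    "('k::field \<Rightarrow> 'r) \<Rightarrow> ('r, 'm, 'q) module_scheme \<Rightarrow> 'm set \<Rightarrow> nat"
  where "dim_over \<phi> M V = vectorspace.dim class_ring (restrict_scalars \<phi> M \<lparr>carrier := V\<rparr>)"

definition is_hilbert_polynomial :: "(nat \<Rightarrow> nat) \<Rightarrow> rat poly \<Rightarrow> bool"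
  where "is_hilbert_polynomial H p \<longleftrightarrow> (\<exists>z0. \<forall>z\<ge>z0. of_nat (H z) = poly p (of_nat z))"

definition hilbert_polynomial :: "(nat \<Rightarrow> nat) \<Rightarrow> rat poly"
  where "hilbert_polynomial H = (THE p. is_hilbert_polynomial H p)"

lemma is_hilbert_polynomial_unique:
  assumes "is_hilbert_polynomial H p" and "is_hilbert_polynomial H q"
  shows "p = q"
proof -
  obtain a where a: "\<forall>z\<ge>a. of_nat (H z) = poly p (of_nat z)"
    using assms(1) by (auto simp: is_hilbert_polynomial_def)
  obtain b where b: "\<forall>z\<ge>b. of_nat (H z) = poly q (of_nat z)"
    using assms(2) by (auto simp: is_hilbert_polynomial_def)
  have "of_nat ` {max a b..} \<subseteq> {x. poly (p - q) x = 0}"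
    using a b by (auto simp flip: a b)
  moreover have "infinite (of_nat ` {max a b..} :: rat set)"
    by (subst finite_image_iff) (auto simp: inj_on_def infinite_Ici)
  ultimately have "p - q = 0"
    by (metis finite_subset poly_roots_finite)
  then show ?thesis by simp
qed

lemma hilbert_polynomial_eq: "is_hilbert_polynomial H p \<Longrightarrow> hilbert_polynomial H = p"
  unfolding hilbert_polynomial_def using is_hilbert_polynomial_unique by blast

definition Omega1 :: "nat \<Rightarrow> 'k::field mpoly set \<Rightarrow>
    ('k mpoly set, ('k mpoly set \<Rightarrow> 'k mpoly set) set) module"
  where "Omega1 n I = kaehler (range (coord_const n I)) (coord_ring n I)"

definition Omega :: "nat \<Rightarrow> nat \<Rightarrow> 'k::field mpoly set \<Rightarrow>
    ('k mpoly set, (('k mpoly set \<Rightarrow> 'k mpoly set) set list \<Rightarrow> 'k mpoly set) set) module"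
  where "Omega m n I = ext_power m (coord_ring n I) (Omega1 n I)"

definition dX :: "nat \<Rightarrow> 'k::field mpoly set \<Rightarrow> nat \<Rightarrow> ('k mpoly set \<Rightarrow> 'k mpoly set) set"
  where "dX n I i = univ_deriv (range (coord_const n I)) (coord_ring n I) (coord_class n I (mpoly_var i))"

text \<open>The grading with \<open>deg (dx\<^sub>i) = 1\<close>, and the one it induces on the exterior power.\<close>

definition Omega1_part ::
    "nat \<Rightarrow> 'k::field mpoly set \<Rightarrow> nat \<Rightarrow> ('k mpoly set \<Rightarrow> 'k mpoly set) set set"
  where "Omega1_part n I z = span_over (coord_const n I) (Omega1 n I)
    {r \<odot>\<^bsub>Omega1 n I\<^esub> dX n I i | r d i. r \<in> coord_part n I d \<and> i \<le> n \<and> d + 1 = z}"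

definition Omega_part :: "nat \<Rightarrow> nat \<Rightarrow> 'k::field mpoly set \<Rightarrow> nat \<Rightarrow>
    (('k mpoly set \<Rightarrow> 'k mpoly set) set list \<Rightarrow> 'k mpoly set) set set"
  where "Omega_part m n I z = span_over (coord_const n I) (Omega m n I)
    {r \<odot>\<^bsub>Omega m n I\<^esub> wedge m (coord_ring n I) (Omega1 n I) ws | r d ws ds.
       r \<in> coord_part n I d \<and> length ws = m \<and>
       list_all2 (\<lambda>w e. w \<in> Omega1_part n I e) ws ds \<and> d + sum_list ds = z}"

definition HF_Omega :: "nat \<Rightarrow> nat \<Rightarrow> 'k::field mpoly set \<Rightarrow> nat \<Rightarrow> nat"
  where "HF_Omega m n I z = dim_over (coord_const n I) (Omega m n I) (Omega_part m n I z)"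

definition HP_Omega :: "nat \<Rightarrow> nat \<Rightarrow> 'k::field mpoly set \<Rightarrow> rat poly"
  where "HP_Omega m n I = hilbert_polynomial (HF_Omega m n I)"

end

theory Submission
  imports Defs
begin

text \<open>
  Put \<open>X\<^sub>0 = 1\<close> and expand a form at each point \<open>P\<^sub>i\<close>. A form lies in \<open>\<wp>\<^sub>i\<close> to the power \<open>\<mu> i\<close>
  iff its expansion at \<open>P\<^sub>i\<close> has no terms of degree below \<open>\<mu> i\<close>, and in large degree the truncated
  expansions at the distinct points can be prescribed independently. Hence the homogeneous
  pieces of \<open>R\<close> of large degree are spanned by \<open>\<Sum>i. (\<mu> i + n - 1) choose n\<close> elements and are mapped
  onto one another by \<open>x\<^sub>0\<close>. The piece of degree \<open>d + m\<close> of \<open>\<Omega>\<close> is spanned by the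
  products of the piece of degree \<open>d\<close> of \<open>R\<close> with the \<open>(n + 1) choose m\<close> forms
  \<open>dx\<^sub>J\<close>; this gives the upper bound, and surjectivity of \<open>x\<^sub>0\<close> makes the Hilbert function
  eventually decreasing, hence eventually constant.

  For the lower bound, partial derivatives send the ideal of \<open>\<Sum>i. \<mu> i P\<^sub>i\<close> into the
  ideal of \<open>\<Sum>i. (\<mu> i - 1) P\<^sub>i\<close>. Modulo the latter ideal, every partial derivative therefore
  induces a linear form on the differentials, and the minors of these linear forms read off the
  coefficient of each \<open>dx\<^sub>J\<close>. Combined with interpolation for the smaller scheme, this
  yields linearly independent elements in every large degree.
\<close>

section \<open>Polynomials as linear combinations of monomials\<close>

text \<open>The number \<open>(\<mu> i + n - 1) choose n\<close> counts monomials of degree below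
  \<open>\<mu> i\<close> in the \<open>n\<close> affine coordinates at \<open>P i\<close>. The lower
  bound has \<open>\<mu> i - 1\<close> in its place because a derivative costs one order of
  vanishing: derivatives of elements of \<open>W\<close> are only known to vanish to order
  \<open>\<mu> i - 1\<close>, so a linear form on the differentials built from a derivative has
  values only modulo the larger ideal \<open>V\<close>. What survives of the coefficient of a
  \<open>dxJ J\<close> is its jets of order below \<open>\<mu> i - 1\<close>. Each graded piece is
  handled purely as a span inside a module given by generators and relations. A finite spanning
  family bounds its dimension from above; linear functionals on the whole module that are dual to
  some of its vectors bound it from below. One family serves both purposes: the classes of forms
  dual to the \<open>\<mu>\<close>-jets, multiplied by the \<open>dxJ J\<close>. It is also dual
  with respect to the smaller jets, since these are among the \<open>\<mu>\<close>-jets.\<close>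

lemma poly_mapping_sum_single:
  fixes f :: "'a \<Rightarrow>\<^sub>0 'b::comm_monoid_add"
  shows "(\<Sum>t\<in>Poly_Mapping.keys f. Poly_Mapping.single t (Poly_Mapping.lookup f t)) = f"
  by (rule poly_mapping_eqI) (auto simp: lookup_sum lookup_single when_def in_keys_iff)

text \<open>Additive identities reduce to single terms. The term case remembers that
  \<open>t\<close> occurs in the original \<open>f\<close>, so hypotheses about all monomials of
  \<open>f\<close>, such as homogeneity, remain usable there.\<close>

lemma poly_mapping_sum_induct [case_names zero single add]:
  fixes f :: "'a \<Rightarrow>\<^sub>0 'b::comm_monoid_add"
  assumes "P 0" and "\<And>t c. t \<in> Poly_Mapping.keys f \<Longrightarrow> c = Poly_Mapping.lookup f t \<Longrightarrow> P (Poly_Mapping.single t c)"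
    and "\<And>g h. P g \<Longrightarrow> P h \<Longrightarrow> P (g + h)"
  shows "P f"
proof -
  have "P (\<Sum>t\<in>T. Poly_Mapping.single t (Poly_Mapping.lookup f t))"
    if "finite T" "T \<subseteq> Poly_Mapping.keys f" for T
    using that by (induction T rule: finite_induct) (auto simp: assms)
  from this[of "Poly_Mapping.keys f"] show ?thesis
    by (simp add: poly_mapping_sum_single)
qed

lemma keys_addE:
  assumes "t \<in> Poly_Mapping.keys (f + g)"
  obtains "t \<in> Poly_Mapping.keys f" | "t \<in> Poly_Mapping.keys g"
  using assms Poly_Mapping.keys_add[of f g] by blast

section \<open>Linear extension from monomials\<close>

definition lin_ext :: "('k::comm_ring_1 \<Rightarrow> 'b) \<Rightarrow> (('i \<Rightarrow>\<^sub>0 nat) \<Rightarrow> 'b) \<Rightarrow> (('i \<Rightarrow>\<^sub>0 nat) \<Rightarrow>\<^sub>0 'k) \<Rightarrow> 'b::comm_ring_1"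
  where "lin_ext c \<phi> f = (\<Sum>t\<in>Poly_Mapping.keys f. c (Poly_Mapping.lookup f t) * \<phi> t)"

text \<open>With the embedding of constants, \<open>lin_ext\<close> yields \<open>shift\<close>,
  \<open>pderiv_var\<close> and \<open>homogenize\<close>; with the identity it yields evaluation.
  The locale collects what these have in common.\<close>

locale coefficient_map =
  fixes c :: "'k::comm_ring_1 \<Rightarrow> 'b::comm_ring_1"
  assumes map_zero: "c 0 = 0" and map_one: "c 1 = 1"
    and map_add: "c (x + y) = c x + c y" and map_mult: "c (x * y) = c x * c y"
begin

lemma lin_ext_superset:
  assumes "finite A" and "Poly_Mapping.keys f \<subseteq> A"
  shows "lin_ext c \<phi> f = (\<Sum>t\<in>A. c (Poly_Mapping.lookup f t) * \<phi> t)"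
  unfolding lin_ext_def using assms by (intro sum.mono_neutral_left) (auto simp: in_keys_iff map_zero)

lemma lin_ext_zero [simp]: "lin_ext c \<phi> 0 = 0"
  by (simp add: lin_ext_def)

lemma lin_ext_single [simp]: "lin_ext c \<phi> (Poly_Mapping.single t a) = c a * \<phi> t"
  by (simp add: lin_ext_def map_zero)

lemma lin_ext_one [simp]: "lin_ext c \<phi> 1 = \<phi> 0"
  using lin_ext_single[of \<phi> 0 1] by (simp add: map_one)

lemma lin_ext_add: "lin_ext c \<phi> (f + g) = lin_ext c \<phi> f + lin_ext c \<phi> g"
proof -
  let ?A = "Poly_Mapping.keys f \<union> Poly_Mapping.keys g"
  have "lin_ext c \<phi> (f + g) = (\<Sum>t\<in>?A. c (Poly_Mapping.lookup (f + g) t) * \<phi> t)"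
    by (rule lin_ext_superset) (auto dest: subsetD[OF Poly_Mapping.keys_add])
  also have "\<dots> = (\<Sum>t\<in>?A. c (Poly_Mapping.lookup f t) * \<phi> t) + (\<Sum>t\<in>?A. c (Poly_Mapping.lookup g t) * \<phi> t)"
    by (simp add: lookup_add map_add algebra_simps sum.distrib)
  finally show ?thesis by (simp add: lin_ext_superset[of ?A])
qed

lemma lin_ext_minus: "lin_ext c \<phi> (f - g) = lin_ext c \<phi> f - lin_ext c \<phi> g"
  using lin_ext_add[of \<phi> "f - g" g] by simp

lemma lin_ext_sum: "lin_ext c \<phi> (sum F A) = (\<Sum>a\<in>A. lin_ext c \<phi> (F a))"
  by (induction A rule: infinite_finite_induct) (auto simp: lin_ext_add)

lemma lin_ext_mult:
  assumes "\<And>s t. \<phi> (s + t) = \<phi> s * \<phi> t"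
  shows "lin_ext c \<phi> (f * g) = lin_ext c \<phi> f * lin_ext c \<phi> g"
proof (induction f rule: poly_mapping_sum_induct)
  case (single t a)
  show ?case
  proof (induction g rule: poly_mapping_sum_induct)
    case (single s b)
    show ?case by (simp add: mult_single assms map_mult)
  next
    case (add g h)
    then show ?case by (simp add: distrib_left lin_ext_add)
  qed simp
next
  case (add f h)
  then show ?case by (simp add: distrib_right lin_ext_add)
qed simp

end

lemma mpoly_const_simps [simp]: "mpoly_const 0 = 0" "mpoly_const 1 = 1"
  by (simp_all add: mpoly_const_def)

lemma mpoly_const_add: "mpoly_const (x + y) = mpoly_const x + mpoly_const y"
  by (simp add: mpoly_const_def single_add)

lemma mpoly_const_minus: "mpoly_const (x - y) = mpoly_const x - mpoly_const y"
  by (simp add: mpoly_const_def single_diff)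

lemma mpoly_const_mult: "mpoly_const (x * y) = mpoly_const x * mpoly_const y"
  by (simp add: mpoly_const_def mult_single)

interpretation const_map: coefficient_map "mpoly_const :: 'k::comm_ring_1 \<Rightarrow> 'k mpoly"
  by unfold_locales (auto simp: mpoly_const_add mpoly_const_mult)

lemma coefficient_map_id: "coefficient_map (\<lambda>x. x)"
  by unfold_locales auto

lemma lookup_const_mult [simp]:
  "Poly_Mapping.lookup (mpoly_const c * f) t = c * Poly_Mapping.lookup f t"
proof (induction f rule: poly_mapping_sum_induct)
  case (single t' a)
  show ?case by (simp add: mpoly_const_def mult_single lookup_single when_def)
next
  case (add g h)
  then show ?case by (simp add: distrib_left lookup_add)
qed simp

section \<open>Monomials in commuting elements and their total degree\<close>

definition monom_power :: "('i \<Rightarrow> 'b::comm_ring_1) \<Rightarrow> ('i \<Rightarrow>\<^sub>0 nat) \<Rightarrow> 'b"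
  where "monom_power h t = (\<Prod>i\<in>Poly_Mapping.keys t. h i ^ Poly_Mapping.lookup t i)"

lemma monom_power_superset:
  "finite A \<Longrightarrow> Poly_Mapping.keys t \<subseteq> A \<Longrightarrow> monom_power h t = (\<Prod>i\<in>A. h i ^ Poly_Mapping.lookup t i)"
  unfolding monom_power_def by (intro prod.mono_neutral_left) (auto simp: in_keys_iff)

lemma monom_power_zero [simp]: "monom_power h 0 = 1"
  by (simp add: monom_power_def)

lemma monom_power_single [simp]: "monom_power h (Poly_Mapping.single i k) = h i ^ k"
  by (simp add: monom_power_def)

lemma keys_add_nat: "Poly_Mapping.keys (s + t :: 'i \<Rightarrow>\<^sub>0 nat) = Poly_Mapping.keys s \<union> Poly_Mapping.keys t"
  by (auto simp: in_keys_iff lookup_add)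

lemma monom_power_add: "monom_power h (s + t) = monom_power h s * monom_power h t"
proof -
  let ?A = "Poly_Mapping.keys s \<union> Poly_Mapping.keys t"
  show ?thesis
    by (simp add: monom_power_superset[of ?A] keys_add_nat lookup_add power_add prod.distrib)
qed

definition monom_deg :: "('i \<Rightarrow>\<^sub>0 nat) \<Rightarrow> nat"
  where "monom_deg t = (\<Sum>i\<in>Poly_Mapping.keys t. Poly_Mapping.lookup t i)"

lemma monom_deg_superset:
  "finite A \<Longrightarrow> Poly_Mapping.keys t \<subseteq> A \<Longrightarrow> monom_deg t = (\<Sum>i\<in>A. Poly_Mapping.lookup t i)"
  unfolding monom_deg_def by (intro sum.mono_neutral_left) (auto simp: in_keys_iff)

lemma monom_deg_zero [simp]: "monom_deg 0 = 0"
  by (simp add: monom_deg_def)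

lemma monom_deg_single [simp]: "monom_deg (Poly_Mapping.single i k) = k"
  by (simp add: monom_deg_def)

lemma monom_deg_add [simp]: "monom_deg (s + t) = monom_deg s + monom_deg t"
proof -
  let ?A = "Poly_Mapping.keys s \<union> Poly_Mapping.keys t"
  show ?thesis
    by (simp add: monom_deg_superset[of ?A] keys_add_nat lookup_add sum.distrib)
qed

text \<open>Monomials are built one variable at a time, by induction on total degree. Every variable
  used lies in the support of the target \<open>t\<close>, which keeps side conditions such as
  \<open>i \<le> n\<close> available.\<close>

lemma monom_induct [case_names zero var]:
  assumes "P 0" and "\<And>i s. i \<in> Poly_Mapping.keys t \<Longrightarrow> Poly_Mapping.keys s \<subseteq> Poly_Mapping.keys t \<Longrightarrow> P s
    \<Longrightarrow> P (Poly_Mapping.single i 1 + s)"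
  shows "P (t :: 'i \<Rightarrow>\<^sub>0 nat)"
proof -
  have "P s" if "Poly_Mapping.keys s \<subseteq> Poly_Mapping.keys t" for s :: "'i \<Rightarrow>\<^sub>0 nat"
    using that
  proof (induction "monom_deg s" arbitrary: s rule: less_induct)
    case less
    show ?case
    proof (cases "s = 0")
      case False
      then obtain i where i: "i \<in> Poly_Mapping.keys s"
        by (metis keys_eq_empty ex_in_conv)
      define u where "u = s - Poly_Mapping.single i 1"
      have s: "s = Poly_Mapping.single i 1 + u"
        using i by (intro poly_mapping_eqI)
          (auto simp: u_def lookup_add lookup_minus lookup_single when_def in_keys_iff)
      have "monom_deg u < monom_deg s" and "Poly_Mapping.keys u \<subseteq> Poly_Mapping.keys t"
        using less.prems by (auto simp: s keys_add_nat)
      then have "P u" using less.hyps by blast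
      then show ?thesis
        using assms(2)[of i u] i less.prems \<open>Poly_Mapping.keys u \<subseteq> _\<close> s by auto
    qed (simp add: assms)
  qed
  then show ?thesis by blast
qed

section \<open>Homogeneous polynomials\<close>

lemma carrier_mpoly_ring: "carrier (mpoly_ring n) = {f. \<forall>t\<in>Poly_Mapping.keys f. Poly_Mapping.keys t \<subseteq> {..n}}"
  by (simp add: mpoly_ring_def)

lemma mpoly_ring_simps [simp]:
  "mult (mpoly_ring n) = (*)" "one (mpoly_ring n) = 1" "zero (mpoly_ring n) = 0" "add (mpoly_ring n) = (+)"
  by (simp_all add: mpoly_ring_def)

lemma mpoly_carrier_simps [simp]:
  "0 \<in> carrier (mpoly_ring n)" "1 \<in> carrier (mpoly_ring n)" "mpoly_const c \<in> carrier (mpoly_ring n)"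
  by (auto simp: carrier_mpoly_ring mpoly_const_def)

lemma mpoly_var_carrier [simp]: "i \<le> n \<Longrightarrow> mpoly_var i \<in> carrier (mpoly_ring n)"
  by (auto simp: carrier_mpoly_ring mpoly_var_def)

lemma mpoly_carrier_add [simp]:
  "f \<in> carrier (mpoly_ring n) \<Longrightarrow> g \<in> carrier (mpoly_ring n) \<Longrightarrow> f + g \<in> carrier (mpoly_ring n)"
  by (auto simp: carrier_mpoly_ring elim!: keys_addE)

lemma mpoly_carrier_uminus [simp]:
  "f \<in> carrier (mpoly_ring n) \<Longrightarrow> - f \<in> carrier (mpoly_ring n)"
  by (auto simp: carrier_mpoly_ring in_keys_iff)

lemma mpoly_carrier_minus [simp]:
  "f \<in> carrier (mpoly_ring n) \<Longrightarrow> g \<in> carrier (mpoly_ring n) \<Longrightarrow> f - g \<in> carrier (mpoly_ring n)"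
  using mpoly_carrier_add[of f n "- g"] by simp

lemma mpoly_carrier_mult [simp]:
  "f \<in> carrier (mpoly_ring n) \<Longrightarrow> g \<in> carrier (mpoly_ring n) \<Longrightarrow> f * g \<in> carrier (mpoly_ring n)"
  unfolding carrier_mpoly_ring using keys_mult[of f g] by (fastforce simp: keys_add_nat)

lemma mpoly_cring: "cring (mpoly_ring n :: 'k::comm_ring_1 mpoly ring)"
proof (rule cringI)
  show "abelian_group (mpoly_ring n :: 'k mpoly ring)"
  proof (rule abelian_groupI)
    fix x :: "'k mpoly" assume "x \<in> carrier (mpoly_ring n)"
    then show "\<exists>y\<in>carrier (mpoly_ring n). y \<oplus>\<^bsub>mpoly_ring n\<^esub> x = \<zero>\<^bsub>mpoly_ring n\<^esub>"
      by (intro bexI[of _ "- x"]) auto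
  qed (auto simp: algebra_simps)
  show "Group.comm_monoid (mpoly_ring n :: 'k mpoly ring)"
    by (rule comm_monoidI) (auto simp: algebra_simps)
qed (auto simp: algebra_simps)

lemma mpoly_ring_a_inv [simp]: "f \<in> carrier (mpoly_ring n) \<Longrightarrow> \<ominus>\<^bsub>mpoly_ring n\<^esub> f = - f"
proof -
  interpret cring "mpoly_ring n" by (rule mpoly_cring)
  assume "f \<in> carrier (mpoly_ring n)"
  then show ?thesis using minus_equality[of "- f" f] by simp
qed

lemma mpoly_idealI:
  assumes "V \<subseteq> carrier (mpoly_ring n)" and "0 \<in> V" and "\<And>f g. f \<in> V \<Longrightarrow> g \<in> V \<Longrightarrow> f + g \<in> V"
    and mult: "\<And>f g. f \<in> carrier (mpoly_ring n) \<Longrightarrow> g \<in> V \<Longrightarrow> f * g \<in> V"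
  shows "ideal (V :: 'k::comm_ring_1 mpoly set) (mpoly_ring n)"
proof -
  interpret cring "mpoly_ring n :: 'k mpoly ring" by (rule mpoly_cring)
  have uminus: "- f \<in> V" if "f \<in> V" for f
    using mult[of "- 1" f] that by simp
  have "subgroup V (add_monoid (mpoly_ring n))"
  proof (rule add.subgroupI)
    show "\<ominus>\<^bsub>mpoly_ring n\<^esub> f \<in> V" if "f \<in> V" for f
      using that assms(1) uminus mpoly_ring_a_inv[of f n] by auto
  qed (use assms in auto)
  then show ?thesis
    by (rule idealI[OF ring_axioms]) (use mult in \<open>simp, metis mpoly_ring_simps(1) mult.commute\<close>)
qed

lemma homogeneous_part_iff:
  "f \<in> homogeneous_part n d \<longleftrightarrow> f \<in> carrier (mpoly_ring n) \<and> (\<forall>t\<in>Poly_Mapping.keys f. monom_deg t = d)"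
  by (simp add: homogeneous_part_def monom_deg_def)

lemma homogeneous_carrier: "f \<in> homogeneous_part n d \<Longrightarrow> f \<in> carrier (mpoly_ring n)"
  by (simp add: homogeneous_part_iff)

lemma homogeneous_zero [simp]: "0 \<in> homogeneous_part n d"
  by (simp add: homogeneous_part_iff)

lemma homogeneous_add: "f \<in> homogeneous_part n d \<Longrightarrow> g \<in> homogeneous_part n d \<Longrightarrow> f + g \<in> homogeneous_part n d"
  by (auto simp: homogeneous_part_iff elim!: keys_addE)

lemma homogeneous_mult:
  "f \<in> homogeneous_part n d \<Longrightarrow> g \<in> homogeneous_part n e \<Longrightarrow> f * g \<in> homogeneous_part n (d + e)"
  unfolding homogeneous_part_iff using keys_mult[of f g] by fastforce

lemma homogeneous_const [simp]: "mpoly_const c \<in> homogeneous_part n 0"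
  by (auto simp: homogeneous_part_iff mpoly_const_def carrier_mpoly_ring)

lemma homogeneous_one [simp]: "1 \<in> homogeneous_part n 0"
  by (auto simp: homogeneous_part_iff)

lemma homogeneous_var [simp]: "i \<le> n \<Longrightarrow> mpoly_var i \<in> homogeneous_part n (Suc 0)"
  by (auto simp: homogeneous_part_iff) (auto simp: mpoly_var_def)

lemma homogeneous_const_mult: "f \<in> homogeneous_part n d \<Longrightarrow> mpoly_const c * f \<in> homogeneous_part n d"
  using homogeneous_mult[of "mpoly_const c" n 0 f d] by simp

lemma homogeneous_uminus: "f \<in> homogeneous_part n d \<Longrightarrow> - f \<in> homogeneous_part n d"
  using homogeneous_const_mult[of f n d "-1"] 
  by (auto simp: homogeneous_part_iff)

lemma homogeneous_minus: "f \<in> homogeneous_part n d \<Longrightarrow> g \<in> homogeneous_part n d \<Longrightarrow> f - g \<in> homogeneous_part n d"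
  using homogeneous_add[of f n d "- g"] homogeneous_uminus[of g n d] by simp

lemma homogeneous_sum:
  "(\<And>a. a \<in> A \<Longrightarrow> F a \<in> homogeneous_part n d) \<Longrightarrow> sum F A \<in> homogeneous_part n d"
  by (induction A rule: infinite_finite_induct) (auto simp: homogeneous_add)

lemma homogeneous_power: "f \<in> homogeneous_part n d \<Longrightarrow> f ^ k \<in> homogeneous_part n (d * k)"
  by (induction k) (auto intro: homogeneous_mult[THEN subst[where P = "\<lambda>e. _ \<in> homogeneous_part n e", rotated]])

lemma homogeneous_prod:
  "(\<And>a. a \<in> A \<Longrightarrow> F a \<in> homogeneous_part n (e a)) \<Longrightarrow> prod F A \<in> homogeneous_part n (sum e A)"
  by (induction A rule: infinite_finite_induct) (auto simp: homogeneous_mult)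

lemma homogeneous_monom_power:
  assumes "\<And>i. i \<in> Poly_Mapping.keys t \<Longrightarrow> h i \<in> homogeneous_part n 1"
  shows "monom_power h t \<in> homogeneous_part n (monom_deg t)"
  unfolding monom_power_def monom_deg_def
  by (rule homogeneous_prod) (use homogeneous_power[of _ n 1] assms in auto)

section \<open>Vanishing order at a point\<close>

text \<open>The \<open>e\<close>-th power of the ideal generated by all variables, described by
  coefficients. Applied after \<open>shift\<close> it measures vanishing order at a point.\<close>

definition order_ge :: "nat \<Rightarrow> 'k::comm_ring_1 mpoly set"
  where "order_ge e = {f. \<forall>t. monom_deg t < e \<longrightarrow> Poly_Mapping.lookup f t = 0}"

lemma order_ge_zero [simp]: "0 \<in> order_ge e"
  by (simp add: order_ge_def)

lemma order_ge_0 [simp]: "f \<in> order_ge 0"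
  by (simp add: order_ge_def)

lemma order_ge_add: "f \<in> order_ge e \<Longrightarrow> g \<in> order_ge e \<Longrightarrow> f + g \<in> order_ge e"
  by (simp add: order_ge_def lookup_add)

lemma order_ge_uminus: "f \<in> order_ge e \<Longrightarrow> - f \<in> order_ge e"
  by (simp add: order_ge_def)

lemma order_ge_mono: "f \<in> order_ge e \<Longrightarrow> d \<le> e \<Longrightarrow> f \<in> order_ge d"
  by (auto simp: order_ge_def)

lemma order_ge_mult:
  assumes "f \<in> order_ge a" and "g \<in> order_ge b" shows "f * g \<in> order_ge (a + b)"
proof -
  have "Poly_Mapping.lookup (f * g) t = 0" if "monom_deg t < a + b" for t
  proof (rule ccontr)
    assume "\<not> ?thesis"
    then obtain u v where "t = u + v" "Poly_Mapping.lookup f u \<noteq> 0" "Poly_Mapping.lookup g v \<noteq> 0"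
      using keys_mult[of f g] by (auto simp: in_keys_iff subset_iff)
    moreover from this have "a \<le> monom_deg u" "b \<le> monom_deg v"
      using assms by (auto simp: order_ge_def not_less[symmetric])
    ultimately show False using that by simp
  qed
  then show ?thesis by (simp add: order_ge_def)
qed

lemma order_ge_mult_right: "f \<in> order_ge a \<Longrightarrow> f * g \<in> order_ge a"
  using order_ge_mult[of f a g 0] by simp

lemma order_ge_mult_left: "g \<in> order_ge a \<Longrightarrow> f * g \<in> order_ge a"
  using order_ge_mult_right[of g a f] by (simp add: mult.commute)

lemma order_ge_power: "f \<in> order_ge 1 \<Longrightarrow> f ^ k \<in> order_ge k"
  by (induction k) (use order_ge_mult[of f 1] in auto)

lemma order_ge_1_iff: "f \<in> order_ge 1 \<longleftrightarrow> Poly_Mapping.lookup f 0 = 0"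
proof -
  have "monom_deg t = 0 \<longleftrightarrow> t = 0" for t :: "nat \<Rightarrow>\<^sub>0 nat"
    by (auto simp: monom_deg_def in_keys_iff poly_mapping_eq_iff fun_eq_iff)
  then show ?thesis by (auto simp: order_ge_def)
qed

lemma lookup_mult_0: "Poly_Mapping.lookup (f * g) (0::nat \<Rightarrow>\<^sub>0 nat) = Poly_Mapping.lookup f 0 * Poly_Mapping.lookup (g::'k::comm_ring_1 mpoly) 0"
proof -
  have split0: "s + t = 0 \<longleftrightarrow> s = 0 \<and> t = 0" for s t :: "nat \<Rightarrow>\<^sub>0 nat"
    by (auto simp: poly_mapping_eq_iff fun_eq_iff lookup_add)
  show ?thesis
  proof (induction f rule: poly_mapping_sum_induct)
    case (single t a)
    show ?case
      by (induction g rule: poly_mapping_sum_induct)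
        (simp_all add: distrib_left lookup_add mult_single lookup_single when_def split0)
  qed (simp_all add: distrib_right lookup_add)
qed

lemma keys_const_mult: "Poly_Mapping.keys (mpoly_const c * f) \<subseteq> Poly_Mapping.keys f"
  by (auto simp: in_keys_iff)

text \<open>The expansion around the point \<open>(1 : q 1 : \<dots> : q n)\<close> in the affine chart \<open>X\<^sub>0 = 1\<close>.\<close>

definition shift :: "(nat \<Rightarrow> 'k::comm_ring_1) \<Rightarrow> 'k mpoly \<Rightarrow> 'k mpoly"
  where "shift q = lin_ext mpoly_const (monom_power (\<lambda>i. if i = 0 then 1 else mpoly_var i + mpoly_const (q i)))"

lemma shift_zero [simp]: "shift q 0 = 0" and shift_add: "shift q (f + g) = shift q f + shift q g"
  and shift_minus: "shift q (f - g) = shift q f - shift q g"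
  and shift_mult: "shift q (f * g) = shift q f * shift q g"
  by (simp_all add: shift_def const_map.lin_ext_add const_map.lin_ext_minus const_map.lin_ext_mult monom_power_add)

lemma shift_const [simp]: "shift q (mpoly_const c) = mpoly_const c"
  unfolding shift_def by (subst (1) mpoly_const_def) simp

lemma shift_one [simp]: "shift q 1 = 1"
  using shift_const[of q 1] by simp

lemma shift_var: "shift q (mpoly_var i) = (if i = 0 then 1 else mpoly_var i + mpoly_const (q i))"
  unfolding shift_def by (subst (1) mpoly_var_def) simp

lemma shift_sum: "shift q (sum F A) = (\<Sum>a\<in>A. shift q (F a))"
  by (simp add: shift_def const_map.lin_ext_sum)

lemma shift_power: "shift q (f ^ k) = shift q f ^ k"
  by (induction k) (auto simp: shift_mult)

lemma shift_prod: "shift q (prod F A) = (\<Prod>a\<in>A. shift q (F a))"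
  by (induction A rule: infinite_finite_induct) (auto simp: shift_mult)

definition vanish_order :: "(nat \<Rightarrow> 'k::comm_ring_1) \<Rightarrow> nat \<Rightarrow> 'k mpoly set"
  where "vanish_order q e = {f. shift q f \<in> order_ge e}"

text \<open>Subtraction of exponents is truncated, but where the variable does not occur the
  coefficient \<open>of_nat 0\<close> removes the term.\<close>

definition pderiv_var :: "nat \<Rightarrow> 'k::comm_ring_1 mpoly \<Rightarrow> 'k mpoly"
  where "pderiv_var j = lin_ext mpoly_const (\<lambda>t. Poly_Mapping.single (t - Poly_Mapping.single j 1) (of_nat (Poly_Mapping.lookup t j)))"

lemma pderiv_var_zero [simp]: "pderiv_var j 0 = 0"
  and pderiv_var_add: "pderiv_var j (f + g) = pderiv_var j f + pderiv_var j g"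
  and pderiv_var_minus: "pderiv_var j (f - g) = pderiv_var j f - pderiv_var j g"
  by (simp_all add: pderiv_var_def const_map.lin_ext_add const_map.lin_ext_minus)

lemma pderiv_var_const [simp]: "pderiv_var j (mpoly_const c) = 0"
  unfolding pderiv_var_def by (subst (1) mpoly_const_def) simp

lemma pderiv_var_var: "pderiv_var j (mpoly_var i) = (if i = j then 1 else 0)"
  unfolding pderiv_var_def by (subst (1) mpoly_var_def) (auto simp: lookup_single)

lemma pderiv_var_mult: "pderiv_var j (f * g) = f * pderiv_var j g + g * pderiv_var j f"
proof (induction f rule: poly_mapping_sum_induct)
  case (single s a)
  show ?case
  proof (induction g rule: poly_mapping_sum_induct)
    case (single t b)
    let ?e = "Poly_Mapping.single j 1 :: nat \<Rightarrow>\<^sub>0 nat"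
    \<comment> \<open>Truncated subtraction can be moved into one factor only if that factor
      contains the variable; otherwise the corresponding summand of the product rule is
      zero.\<close>
    have 1: "Poly_Mapping.lookup t j \<noteq> 0 \<Longrightarrow> s + t - ?e = s + (t - ?e)"
      and 2: "Poly_Mapping.lookup s j \<noteq> 0 \<Longrightarrow> s + t - ?e = t + (s - ?e)"
      by (rule poly_mapping_eqI; auto simp: lookup_add lookup_minus lookup_single when_def)+
    show ?case
      using 1 2
      by (cases "Poly_Mapping.lookup s j = 0"; cases "Poly_Mapping.lookup t j = 0")
        (simp_all add: pderiv_var_def mult_single lookup_add mpoly_const_def single_add algebra_simps)
  qed (simp_all add: distrib_left distrib_right pderiv_var_add)
qed (simp_all add: distrib_left distrib_right pderiv_var_add)

text \<open>The inverse of \<open>shift q\<close> on forms of degree \<open>d\<close>: an affine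
  coordinate becomes \<open>X_k - q_k X_0\<close>, and a power of \<open>X_0\<close> restores the
  degree. It has this meaning only on polynomials of degree at most \<open>d\<close>, because
  \<open>d - monom_deg t\<close> is truncated.\<close>

definition homogenize :: "(nat \<Rightarrow> 'k::comm_ring_1) \<Rightarrow> nat \<Rightarrow> 'k mpoly \<Rightarrow> 'k mpoly"
  where "homogenize q d = lin_ext mpoly_const
    (\<lambda>t. mpoly_var 0 ^ (d - monom_deg t) * monom_power (\<lambda>i. mpoly_var i - mpoly_const (q i) * mpoly_var 0) t)"

lemma homogenize_add: "homogenize q d (f + g) = homogenize q d f + homogenize q d g"
  by (simp add: homogenize_def const_map.lin_ext_add)

lemma homogenize_const_mult: "homogenize q d (mpoly_const c * f) = mpoly_const c * homogenize q d f"
proof (induction f rule: poly_mapping_sum_induct)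
  case (single t a)
  show ?case
    unfolding homogenize_def by (subst (1) mpoly_const_def) (simp add: mult_single mpoly_const_mult mult.assoc)
qed (simp_all add: homogenize_def distrib_left const_map.lin_ext_add)

text \<open>The degree bound ensures that the padding power of \<open>X_0\<close> really grows by
  one; above degree \<open>d\<close> both paddings would be trivial.\<close>

lemma homogenize_Suc:
  assumes "\<And>t. t \<in> Poly_Mapping.keys f \<Longrightarrow> monom_deg t \<le> d"
  shows "homogenize q (Suc d) f = mpoly_var 0 * homogenize q d f"
  unfolding homogenize_def lin_ext_def sum_distrib_left
  by (rule sum.cong) (use assms in \<open>auto simp: Suc_diff_le algebra_simps\<close>)

lemma homogenize_var_mult:
  "homogenize q (Suc d) (mpoly_var i * f) = (mpoly_var i - mpoly_const (q i) * mpoly_var 0) * homogenize q d f"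
proof (induction f rule: poly_mapping_sum_induct)
  case (single t a)
  show ?case
    unfolding homogenize_def
    by (subst (1) mpoly_var_def) (simp add: mult_single monom_power_add algebra_simps)
qed (simp_all add: homogenize_def distrib_left const_map.lin_ext_add)

text \<open>Both claims pass to sums, scalar multiples and products with a variable, so they spread
  from the constant 1 to all forms. They are proved jointly because the padding by
  \<open>X_0\<close> uses the degree bound. Consequently a form can be rebuilt from its expansion at
  any one point.\<close>

lemma homogenize_shift:
  assumes "f \<in> homogeneous_part n d"
  shows "homogenize q d (shift q f) = f"
    and "t \<in> Poly_Mapping.keys (shift q f) \<Longrightarrow> Poly_Mapping.keys t \<subseteq> {1..n} \<and> monom_deg t \<le> d"
proof -
  define Q where "Q e g \<longleftrightarrow> homogenize q e (shift q g) = g \<and>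
    (\<forall>t\<in>Poly_Mapping.keys (shift q g). Poly_Mapping.keys t \<subseteq> {1..n} \<and> monom_deg t \<le> e)"
    for e and g :: "'a mpoly"
  have Qadd: "Q e (g + h)" if "Q e g" "Q e h" for e g h
    using that unfolding Q_def shift_add by (auto simp: homogenize_add elim!: keys_addE)
  have const: "Q e (mpoly_const c * g)" if "Q e g" for e c g
    using that keys_const_mult[of c "shift q g"]
    unfolding Q_def shift_mult shift_const homogenize_const_mult by auto
  have Qvar: "Q (Suc e) (mpoly_var i * g)" if "Q e g" "i \<le> n" for e i g
  proof (cases "i = 0")
    case True
    have g: "homogenize q e (shift q g) = g"
      and keys: "\<forall>t\<in>Poly_Mapping.keys (shift q g). Poly_Mapping.keys t \<subseteq> {1..n} \<and> monom_deg t \<le> e"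
      using that(1) unfolding Q_def by blast+
    \<comment> \<open>\<open>X_0\<close> is sent to 1, so the expansion stays the same and only the
      padding grows.\<close>
    have "homogenize q (Suc e) (shift q g) = mpoly_var 0 * g"
      using homogenize_Suc[of "shift q g" e q] keys g by simp
    moreover have "shift q (mpoly_var i * g) = shift q g"
      using True by (simp add: shift_mult shift_var)
    ultimately show ?thesis unfolding Q_def
      using keys True by (simp add: le_SucI)
  next
    case False
    let ?g = "shift q g"
    have *: "shift q (mpoly_var i * g) = mpoly_var i * ?g + mpoly_const (q i) * ?g"
      using False by (simp add: shift_mult shift_var distrib_right)
    have g: "homogenize q e ?g = g" "homogenize q (Suc e) ?g = mpoly_var 0 * g"
      using that(1) homogenize_Suc[of ?g e q] by (simp_all add: Q_def)
    \<comment> \<open>The padding of the summand with constant \<open>q i\<close> cancels the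
      correction \<open>q_i X_0\<close> in the linear factor.\<close>
    have "homogenize q (Suc e) (shift q (mpoly_var i * g)) = mpoly_var i * g"
      unfolding * homogenize_add homogenize_const_mult homogenize_var_mult g
      by (simp add: left_diff_distrib mult.assoc)
    moreover have "Poly_Mapping.keys t \<subseteq> {1..n} \<and> monom_deg t \<le> Suc e"
      if t: "t \<in> Poly_Mapping.keys (mpoly_var i * ?g + mpoly_const (q i) * ?g)" for t
    proof -
      consider "t \<in> Poly_Mapping.keys (mpoly_var i * ?g)" | "t \<in> Poly_Mapping.keys ?g"
        using t keys_const_mult[of "q i" ?g] by (blast elim: keys_addE)
      then show ?thesis
      proof cases
        case 1
        then obtain u where u: "u \<in> Poly_Mapping.keys ?g" "t = Poly_Mapping.single i 1 + u"
          using keys_mult[of "mpoly_var i" ?g] by (auto simp: mpoly_var_def)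
        moreover have "i \<in> {1..n}" using False \<open>i \<le> n\<close> by simp
        ultimately show ?thesis using \<open>Q e g\<close> unfolding Q_def keys_add_nat u(2) by simp
      next
        case 2
        then show ?thesis using \<open>Q e g\<close> by (auto simp: Q_def)
      qed
    qed
    ultimately show ?thesis unfolding Q_def * by blast
  qed
  have monom: "Q (monom_deg t) (Poly_Mapping.single t 1)" if "Poly_Mapping.keys t \<subseteq> {..n}" for t
    using that
  proof (induction t rule: monom_induct)
    case zero
    then show ?case by (simp add: Q_def homogenize_def)
  next
    case (var i s)
    then have "i \<le> n" "Q (monom_deg s) (Poly_Mapping.single s 1)" by (auto simp: keys_add_nat)
    then have "Q (Suc (monom_deg s)) (mpoly_var i * Poly_Mapping.single s 1)"
      by (rule Qvar[rotated])
    then show ?case by (simp add: mpoly_var_def mult_single)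
  qed
  have "Q d f"
  proof (induction f rule: poly_mapping_sum_induct)
    case (single t a)
    then have "Poly_Mapping.keys t \<subseteq> {..n}" "monom_deg t = d"
      using assms by (auto simp: homogeneous_part_iff carrier_mpoly_ring)
    then have "Q d (mpoly_const a * Poly_Mapping.single t 1)"
      using monom const by blast
    then show ?case by (simp add: mpoly_const_def mult_single)
  next
    case zero
    show ?case by (simp add: Q_def homogenize_def)
  next
    case (add g h)
    then show ?case by (rule Qadd)
  qed
  then show "homogenize q d (shift q f) = f"
    and "t \<in> Poly_Mapping.keys (shift q f) \<Longrightarrow> Poly_Mapping.keys t \<subseteq> {1..n} \<and> monom_deg t \<le> d"
    by (auto simp: Q_def)
qed

section \<open>Powers of the ideal of a point\<close>

definition affine_coords :: "(nat \<Rightarrow> 'k::field) \<Rightarrow> nat \<Rightarrow> 'k"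
  where "affine_coords p i = p i / p 0"

lemma mpoly_eval_eq: "mpoly_eval f a = lin_ext (\<lambda>x. x) (monom_power a) f"
  by (simp add: mpoly_eval_def lin_ext_def monom_power_def)

lemma vanishing_ideal_ideal: "ideal (vanishing_ideal n p) (mpoly_ring n)"
proof -
  interpret cring "mpoly_ring n" by (rule mpoly_cring)
  show ?thesis unfolding vanishing_ideal_def
    by (rule genideal_ideal) (auto simp: homogeneous_part_iff)
qed

lemma linear_form_in_vanishing_ideal:
  fixes p :: "nat \<Rightarrow> 'k::field"
  assumes "p 0 \<noteq> 0" and "i \<le> n"
  shows "mpoly_var i - mpoly_const (affine_coords p i) * mpoly_var 0 \<in> vanishing_ideal n p" (is "?l \<in> _")
proof -
  interpret cring "mpoly_ring n" by (rule mpoly_cring)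
  interpret coefficient_map "\<lambda>x::'k. x" by (rule coefficient_map_id)
  have "?l \<in> homogeneous_part n 1"
    using assms by (intro homogeneous_minus homogeneous_const_mult) auto
  moreover have "mpoly_eval ?l p = 0"
    unfolding mpoly_eval_eq lin_ext_minus
    using assms by (simp add: mpoly_var_def mpoly_const_def mult_single affine_coords_def)
  ultimately show ?thesis unfolding vanishing_ideal_def
    by (intro subsetD[OF genideal_self]) (auto simp: homogeneous_part_iff)
qed

text \<open>The constant term is the value at the affine representative of \<open>p\<close>;
  homogeneity collects all divisions by \<open>p 0\<close> into one factor. This translates
  vanishing at a projective point into order at least 1.\<close>

lemma shift_constant_term:
  fixes p :: "nat \<Rightarrow> 'k::field"
  assumes "p 0 \<noteq> 0" and f: "f \<in> homogeneous_part n d"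
  shows "Poly_Mapping.lookup (shift (affine_coords p) f) 0 = mpoly_eval f p / p 0 ^ d"
proof -
  have power: "Poly_Mapping.lookup (g ^ k) 0 = Poly_Mapping.lookup g 0 ^ k" for g :: "'k mpoly" and k
    by (induction k) (auto simp: lookup_mult_0)
  have prod: "Poly_Mapping.lookup (prod G A) 0 = (\<Prod>a\<in>A. Poly_Mapping.lookup (G a) 0)"
    for G :: "nat \<Rightarrow> 'k mpoly" and A
    by (induction A rule: infinite_finite_induct) (auto simp: lookup_mult_0)
  have 0: "Poly_Mapping.lookup (if i = 0 then 1 else mpoly_var i + mpoly_const (affine_coords p i)) 0
      = p i / p 0" for i
  proof -
    have "Poly_Mapping.single i (1::nat) \<noteq> 0"
      by (metis lookup_single_eq lookup_zero one_neq_zero)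
    then show ?thesis
      using assms by (simp add: lookup_add mpoly_var_def mpoly_const_def lookup_single_not_eq affine_coords_def)
  qed
  have "Poly_Mapping.lookup (shift (affine_coords p) f) 0
      = (\<Sum>t\<in>Poly_Mapping.keys f. Poly_Mapping.lookup f t * (\<Prod>i\<in>Poly_Mapping.keys t. (p i / p 0) ^ Poly_Mapping.lookup t i))"
    by (simp only: shift_def lin_ext_def lookup_sum lookup_const_mult monom_power_def prod power 0)
  also have "\<dots> = (\<Sum>t\<in>Poly_Mapping.keys f. (Poly_Mapping.lookup f t * (\<Prod>i\<in>Poly_Mapping.keys t. p i ^ Poly_Mapping.lookup t i)) / p 0 ^ d)"
  proof (rule sum.cong[OF refl])
    fix t assume "t \<in> Poly_Mapping.keys f"
    then have "d = (\<Sum>i\<in>Poly_Mapping.keys t. Poly_Mapping.lookup t i)"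
      using f by (simp add: homogeneous_part_iff monom_deg_def)
    then show "Poly_Mapping.lookup f t * (\<Prod>i\<in>Poly_Mapping.keys t. (p i / p 0) ^ Poly_Mapping.lookup t i)
      = Poly_Mapping.lookup f t * (\<Prod>i\<in>Poly_Mapping.keys t. p i ^ Poly_Mapping.lookup t i) / p 0 ^ d"
      by (simp add: power_divide prod_dividef power_sum)
  qed
  finally show ?thesis by (simp add: mpoly_eval_def sum_divide_distrib)
qed

text \<open>The polynomials of order at least 1 at the point form an ideal, so only the homogeneous
  generators have to be examined.\<close>

lemma vanishing_ideal_vanish_order:
  fixes p :: "nat \<Rightarrow> 'k::field"
  assumes "p 0 \<noteq> 0"
  shows "vanishing_ideal n p \<subseteq> vanish_order (affine_coords p) 1"
proof -
  interpret cring "mpoly_ring n" by (rule mpoly_cring)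
  let ?V = "carrier (mpoly_ring n) \<inter> vanish_order (affine_coords p) 1"
  have "ideal ?V (mpoly_ring n)"
    by (rule mpoly_idealI)
      (auto simp: vanish_order_def shift_add shift_mult order_ge_add order_ge_mult_left)
  moreover have "{f. (\<exists>d. f \<in> homogeneous_part n d) \<and> mpoly_eval f p = 0} \<subseteq> ?V"
    using assms by (auto simp: homogeneous_carrier vanish_order_def order_ge_1_iff shift_constant_term
      simp del: One_nat_def)
  ultimately show ?thesis
    unfolding vanishing_ideal_def using genideal_minimal by blast
qed

lemma ideals_set_simps [simp]: "one (ideals_set R) = carrier R" "mult (ideals_set R) = ideal_prod R"
  by (simp_all add: ideals_set_def)

lemma (in cring) ideal_power_ideal: "ideal I R \<Longrightarrow> ideal (I [^]\<^bsub>ideals_set R\<^esub> (k::nat)) R"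
  by (induction k) (auto simp: oneideal ideal_prod_is_ideal)

text \<open>Orders add up under products. In the product rule one summand keeps the full order of
  \<open>f\<close>, and in the other the factor \<open>g\<close> makes up for the order lost by
  \<open>pderiv_var j f\<close>; the total loss stays one.\<close>

lemma ideal_power_vanish_order:
  fixes p :: "nat \<Rightarrow> 'k::field"
  assumes "p 0 \<noteq> 0" and "f \<in> vanishing_ideal n p [^]\<^bsub>ideals_set (mpoly_ring n)\<^esub> k"
  shows "f \<in> vanish_order (affine_coords p) k"
    and "pderiv_var j f \<in> vanish_order (affine_coords p) (k - 1)"
proof -
  let ?q = "affine_coords p"
  have V1: "g \<in> vanish_order ?q 1" if "g \<in> vanishing_ideal n p" for g
    using vanishing_ideal_vanish_order[of p n, OF assms(1)] that by blast
  have "f \<in> vanish_order ?q k \<and> pderiv_var j f \<in> vanish_order ?q (k - 1)"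
    using assms(2)
  proof (induction k arbitrary: f)
    case (Suc k)
    from Suc.prems[simplified] show ?case
    proof (induction f rule: ideal_prod.induct)
      case (prod f g)
      from Suc.IH[OF prod(1)] have f: "shift ?q f \<in> order_ge k" "shift ?q (pderiv_var j f) \<in> order_ge (k - 1)"
        by (auto simp: vanish_order_def)
      have g: "shift ?q g \<in> order_ge 1" using V1[OF prod(2)] by (simp add: vanish_order_def)
      \<comment> \<open>For \<open>k = 0\<close> there is nothing to prove; otherwise
        \<open>1 + (k - 1) = k\<close>.\<close>
      have "shift ?q g * shift ?q (pderiv_var j f) \<in> order_ge k"
        using order_ge_mult[OF g f(2)] by (cases k) auto
      then show ?case
        using order_ge_mult[OF f(1) g] f(1)
        by (simp add: vanish_order_def shift_mult shift_add pderiv_var_mult order_ge_add order_ge_mult_right)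
    next
      case (sum f g)
      then show ?case
        by (simp add: vanish_order_def shift_add pderiv_var_add order_ge_add)
    qed
  qed (auto simp: vanish_order_def)
  then show "f \<in> vanish_order ?q k" and "pderiv_var j f \<in> vanish_order ?q (k - 1)" by auto
qed

lemma monom_power_in_ideal_power:
  assumes I: "ideal I (mpoly_ring n)" and "\<And>i. i \<in> Poly_Mapping.keys t \<Longrightarrow> h i \<in> I"
  shows "monom_power h t \<in> I [^]\<^bsub>ideals_set (mpoly_ring n)\<^esub> monom_deg t"
  using assms(2)
proof (induction t rule: monom_induct)
  case (var i s)
  then show ?case
    using ideal_prod.prod[of "monom_power h s" "I [^]\<^bsub>ideals_set (mpoly_ring n)\<^esub> monom_deg s" "h i" I "mpoly_ring n"]
    by (simp add: monom_power_add keys_add_nat mult.commute)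
qed auto

lemma ideal_power_mono:
  assumes I: "ideal I (mpoly_ring n)" and "j \<le> k"
  shows "I [^]\<^bsub>ideals_set (mpoly_ring n)\<^esub> k \<subseteq> I [^]\<^bsub>ideals_set (mpoly_ring n)\<^esub> (j::nat)"
proof -
  interpret cring "mpoly_ring n" by (rule mpoly_cring)
  show ?thesis using assms(2)
    by (induction k rule: dec_induct)
      (auto dest!: subsetD[OF ideal_prod_inter[OF ideal_power_ideal[OF I] I]])
qed

lemma linear_forms_in_ideal_power:
  fixes p :: "nat \<Rightarrow> 'k::field"
  assumes p: "p 0 \<noteq> 0" and t: "Poly_Mapping.keys t \<subseteq> {..n}" and k: "k \<le> monom_deg t"
  shows "monom_power (\<lambda>i. mpoly_var i - mpoly_const (affine_coords p i) * mpoly_var 0) t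
    \<in> vanishing_ideal n p [^]\<^bsub>ideals_set (mpoly_ring n)\<^esub> k"
proof -
  let ?Y = "\<lambda>i. mpoly_var i - mpoly_const (affine_coords p i) * mpoly_var 0"
  have "?Y i \<in> vanishing_ideal n p" if "i \<in> Poly_Mapping.keys t" for i
    using linear_form_in_vanishing_ideal[of p i n] p t that by blast
  then have "monom_power ?Y t \<in> vanishing_ideal n p [^]\<^bsub>ideals_set (mpoly_ring n)\<^esub> monom_deg t"
    by (rule monom_power_in_ideal_power[of "vanishing_ideal n p" n t ?Y, OF vanishing_ideal_ideal])
  then show ?thesis
    using ideal_power_mono[of "vanishing_ideal n p" n k "monom_deg t", OF vanishing_ideal_ideal k] by (rule rev_subsetD)
qed

text \<open>A form is recovered by homogenizing its expansion, and each monomial that survives,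
  having degree at least \<open>k\<close>, becomes a product of at least \<open>k\<close> linear
  forms vanishing at the point.\<close>

lemma vanish_order_in_ideal_power:
  fixes p :: "nat \<Rightarrow> 'k::field"
  assumes p: "p 0 \<noteq> 0" and f: "f \<in> homogeneous_part n d"
    and van: "f \<in> vanish_order (affine_coords p) k"
  shows "f \<in> vanishing_ideal n p [^]\<^bsub>ideals_set (mpoly_ring n)\<^esub> k"
proof -
  let ?q = "affine_coords p"
  define J where "J = vanishing_ideal n p [^]\<^bsub>ideals_set (mpoly_ring n)\<^esub> k"
  define Y where "Y i = mpoly_var i - mpoly_const (?q i) * mpoly_var 0" for i
  interpret J: ideal J "mpoly_ring n"
    unfolding J_def by (rule cring.ideal_power_ideal[OF mpoly_cring vanishing_ideal_ideal])
  have 1: "mpoly_const (Poly_Mapping.lookup (shift ?q f) t) * (mpoly_var 0 ^ (d - monom_deg t) * monom_power Y t) \<in> J"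
    if t: "t \<in> Poly_Mapping.keys (shift ?q f)" for t
  proof -
    have "k \<le> monom_deg t"
      using van t by (simp add: vanish_order_def order_ge_def in_keys_iff) (metis not_less)
    moreover have "Poly_Mapping.keys t \<subseteq> {..n}" using homogenize_shift(2)[OF f t] by auto
    ultimately have "monom_power Y t \<in> J"
      using linear_forms_in_ideal_power[of p t n k] p by (simp add: J_def Y_def[abs_def])
    moreover have "mpoly_const c * mpoly_var 0 ^ e \<in> carrier (mpoly_ring n)" for c :: 'k and e
      using homogeneous_carrier[OF homogeneous_const_mult[OF homogeneous_power[OF homogeneous_var[of 0 n]]]] by simp
    ultimately show ?thesis
      using J.I_l_closed[of "monom_power Y t"] by (simp only: mpoly_ring_simps mult.assoc[symmetric])
  qed
  have 2: "(\<Sum>a\<in>A. F a) \<in> J" if "\<And>a. a \<in> A \<Longrightarrow> F a \<in> J" for F and A :: "(nat \<Rightarrow>\<^sub>0 nat) set"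
    using that additive_subgroup.a_closed[OF J.additive_subgroup_axioms] additive_subgroup.zero_closed[OF J.additive_subgroup_axioms]
    by (induction A rule: infinite_finite_induct) auto
  have "homogenize ?q d (shift ?q f) \<in> J"
    unfolding homogenize_def lin_ext_def Y_def[symmetric] by (intro 2 1)
  then show ?thesis by (simp add: homogenize_shift(1)[OF f] J_def)
qed

section \<open>Interpolation at distinct points\<close>

text \<open>Variable 0 is left out because \<open>shift\<close> sets it to 1; these exponents index
  truncated expansions at a point.\<close>

definition exponents :: "nat \<Rightarrow> nat \<Rightarrow> (nat \<Rightarrow>\<^sub>0 nat) set"
  where "exponents n e = {t. Poly_Mapping.keys t \<subseteq> {1..n} \<and> monom_deg t < e}"

text \<open>Stars and bars: the last list entry is the slack \<open>e - monom_deg t\<close>, which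
  turns the inequality \<open>monom_deg t \<le> e\<close> into an equation with \<open>n + 1\<close>
  summands.\<close>

lemma exponents_bij:
  "bij_betw (\<lambda>t. map (Poly_Mapping.lookup t) [1..<Suc n] @ [e - monom_deg t])
     (exponents n (Suc e)) {xs. length xs = Suc n \<and> sum_list xs = e}" (is "bij_betw ?f _ _")
proof -
  have sum_map: "sum_list (map (Poly_Mapping.lookup t) [1..<Suc n]) = monom_deg t" if "Poly_Mapping.keys t \<subseteq> {1..n}" for t :: "nat \<Rightarrow>\<^sub>0 nat"
  proof -
    have "monom_deg t = (\<Sum>i\<in>{1..<Suc n}. Poly_Mapping.lookup t i)"
      using that by (intro monom_deg_superset) auto
    then show ?thesis by (simp only: interv_sum_list_conv_sum_set_nat set_upt)
  qed
  \<comment> \<open>The inverse reads the first \<open>n\<close> entries as exponents of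
    \<open>X_1, ..., X_n\<close> and drops the slack.\<close>
  define g where "g xs = Abs_poly_mapping (\<lambda>i. if i \<in> {1..n} then xs ! (i - 1) else (0::nat))" for xs
  have look: "Poly_Mapping.lookup (g xs) i = (if i \<in> {1..n} then xs ! (i - 1) else 0)" for xs i
    unfolding g_def by (subst lookup_Abs_poly_mapping) auto
  have keys: "Poly_Mapping.keys (g xs) \<subseteq> {1..n}" for xs
    by (auto simp: in_keys_iff look split: if_splits)
  have map_g: "map (Poly_Mapping.lookup (g xs)) [1..<Suc n] = butlast xs" if "length xs = Suc n" for xs
    using that by (intro nth_equalityI) (auto simp: look nth_butlast simp del: upt_Suc)
  have deg: "monom_deg (g xs) + last xs = sum_list xs" if "length xs = Suc n" for xs
  proof -
    have "sum_list xs = sum_list (butlast xs) + last xs"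
      using that by (subst append_butlast_last_id[symmetric]) (auto simp del: append_butlast_last_id)
    then show ?thesis using sum_map[OF keys, of xs] map_g[OF that] by simp
  qed
  show ?thesis
  proof (rule bij_betwI[where g = g])
    show "?f \<in> exponents n (Suc e) \<rightarrow> {xs. length xs = Suc n \<and> sum_list xs = e}"
      using sum_map by (auto simp: exponents_def simp del: upt_Suc)
    show "g \<in> {xs. length xs = Suc n \<and> sum_list xs = e} \<rightarrow> exponents n (Suc e)"
      using deg keys by (fastforce simp: exponents_def)
    show "g (?f t) = t" if "t \<in> exponents n (Suc e)" for t
      using that by (intro poly_mapping_eqI) (auto simp: look nth_append exponents_def in_keys_iff subset_iff simp del: upt_Suc)
    show "?f (g xs) = xs" if "xs \<in> {xs. length xs = Suc n \<and> sum_list xs = e}" for xs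
    proof -
      have "e - monom_deg (g xs) = last xs" using deg[of xs] that by auto
      moreover have "butlast xs @ [last xs] = xs" using that by (intro append_butlast_last_id) auto
      ultimately show ?thesis using map_g[of xs] that by simp
    qed
  qed
qed

text \<open>For \<open>e = 0\<close> the set is empty, and \<open>(n - 1) choose n\<close> vanishes
  because \<open>n \<ge> 1\<close>. For \<open>e = k + 1\<close> counting lists gives
  \<open>(k + n) choose k\<close>, which symmetry turns into the stated form.\<close>

lemma finite_exponents [simp]: "finite (exponents n e)"
  and card_exponents: "n \<ge> 1 \<Longrightarrow> card (exponents n e) = (e + n - 1) choose n"
proof -
  have 0: "exponents n 0 = {}" by (auto simp: exponents_def)
  have lists: "{xs. length xs = Suc n \<and> sum_list xs = k} \<subseteq> {xs. set xs \<subseteq> {..k} \<and> length xs = Suc n}" for k :: nat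
    by (auto intro: member_le_sum_list)
  have "finite {xs. length xs = Suc n \<and> sum_list xs = (k::nat)}" for k
    by (rule finite_subset[OF lists finite_lists_length_eq]) simp
  then show "finite (exponents n e)"
    using bij_betw_finite[OF exponents_bij] by (cases e) (auto simp: 0)
  assume "n \<ge> 1"
  show "card (exponents n e) = (e + n - 1) choose n"
  proof (cases e)
    case (Suc k)
    have "card (exponents n e) = (k + Suc n - 1) choose k"
      using bij_betw_same_card[OF exponents_bij] card_length_sum_list[of "Suc n" k] by (simp add: Suc)
    then show ?thesis using binomial_symmetric[of k "k + n"] by (simp add: Suc)
  qed (use \<open>n \<ge> 1\<close> in \<open>simp add: 0 binomial_eq_0\<close>)
qed

section \<open>Forms with prescribed truncated expansions\<close>

lemma monom_power_var: "monom_power mpoly_var t = (Poly_Mapping.single t 1 :: 'k::comm_ring_1 mpoly)"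
proof (induction t rule: monom_induct)
  case (var i s)
  then show ?case by (simp add: monom_power_add mult_single) (simp add: mpoly_var_def mult_single)
qed simp

lemma shift_monom_power: "shift q (monom_power h t) = monom_power (\<lambda>i. shift q (h i)) t"
  by (simp add: monom_power_def shift_prod shift_power)

lemma monom_power_cong:
  "(\<And>i. i \<in> Poly_Mapping.keys t \<Longrightarrow> g i = h i) \<Longrightarrow> monom_power g t = monom_power h t"
  by (simp add: monom_power_def)

lemma one_plus_order_ge_mult:
  assumes "f - 1 \<in> order_ge M" and "g - 1 \<in> order_ge M" shows "f * g - 1 \<in> order_ge M"
proof -
  have "f * g - 1 = f * (g - 1) + (f - 1)" by (simp add: right_diff_distrib)
  then show ?thesis using assms by (metis order_ge_add order_ge_mult_left)
qed

lemma one_plus_order_ge_power: "f - 1 \<in> order_ge M \<Longrightarrow> f ^ k - 1 \<in> order_ge M"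
  by (induction k) (auto intro: one_plus_order_ge_mult)

lemma separating_linear_form:
  fixes q q' :: "nat \<Rightarrow> 'k::field"
  assumes "k \<in> {1..n}" and "q k \<noteq> q' k"
  obtains l where "l \<in> homogeneous_part n 1" and "shift q' l \<in> order_ge 1" and "Poly_Mapping.lookup (shift q l) 0 = 1"
proof
  \<comment> \<open>The linear form \<open>X_k - q'_k X_0\<close> vanishes at \<open>q'\<close> and
    has value \<open>q k - q' k\<close> at \<open>q\<close>; the scalar normalizes this value to
    1.\<close>
  let ?l = "mpoly_const (1 / (q k - q' k)) * (mpoly_var k - mpoly_const (q' k) * mpoly_var 0)"
  show "?l \<in> homogeneous_part n 1"
    unfolding One_nat_def
    by (intro homogeneous_const_mult homogeneous_minus homogeneous_var) (use assms in auto)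
  have nz: "Poly_Mapping.single k (1::nat) \<noteq> 0"
    by (metis lookup_single_eq lookup_zero one_neq_zero)
  have *: "shift r ?l = mpoly_const (1 / (q k - q' k)) * (mpoly_var k + mpoly_const (r k - q' k))" for r
    using assms by (simp add: shift_mult shift_minus shift_var mpoly_const_minus)
  show "shift q' ?l \<in> order_ge 1" "Poly_Mapping.lookup (shift q ?l) 0 = 1"
    unfolding order_ge_1_iff *
    unfolding lookup_const_mult lookup_add
    using assms(2) nz by (simp_all add: mpoly_var_def mpoly_const_def lookup_single_not_eq)
qed

text \<open>The expression \<open>1 - (1 - h) ^ M\<close> is congruent to 1 to order
  \<open>M\<close> where \<open>h\<close> has value 1, and to 0 to order \<open>M\<close> where
  \<open>h\<close> vanishes to order \<open>M\<close>. \<open>E\<close> is its homogeneous version,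
  with a product of powers of separating linear forms as \<open>h\<close>.\<close>

lemma separating_form:
  fixes q :: "nat \<Rightarrow> nat \<Rightarrow> 'k::field"
  assumes "finite I" and "i \<in> I"
    and distinct: "\<And>j. j \<in> I \<Longrightarrow> j \<noteq> i \<Longrightarrow> \<exists>k\<in>{1..n}. q i k \<noteq> q j k"
  shows "\<exists>E\<in>homogeneous_part n ((card I - 1) * M * M). shift (q i) E - 1 \<in> order_ge M \<and>
    (\<forall>j\<in>I. j \<noteq> i \<longrightarrow> shift (q j) E \<in> order_ge M)"
proof -
  have "\<exists>l. l \<in> homogeneous_part n 1 \<and> shift (q j) l \<in> order_ge 1 \<and> Poly_Mapping.lookup (shift (q i) l) 0 = 1"
    if j: "j \<in> I - {i}" for j
  proof -
    from distinct[of j] j obtain k where k: "k \<in> {1..n}" "q i k \<noteq> q j k" by blast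
    show ?thesis by (rule separating_linear_form[of k n "q i" "q j"]) (use k in auto)
  qed
  then obtain l where l: "\<And>j. j \<in> I - {i} \<Longrightarrow> l j \<in> homogeneous_part n 1"
    "\<And>j. j \<in> I - {i} \<Longrightarrow> shift (q j) (l j) \<in> order_ge 1"
    "\<And>j. j \<in> I - {i} \<Longrightarrow> Poly_Mapping.lookup (shift (q i) (l j)) 0 = 1"
    by metis
  \<comment> \<open>The degree of \<open>H\<close>, which has a factor of degree \<open>M\<close>
    for each of the other points.\<close>
  define e where "e = (card I - 1) * M"
  define H where "H = (\<Prod>j\<in>I - {i}. l j ^ M)"
  define E where "E = mpoly_var 0 ^ (e * M) - (mpoly_var 0 ^ e - H) ^ M"
  have "H \<in> homogeneous_part n (\<Sum>j\<in>I - {i}. 1 * M)"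
    unfolding H_def by (intro homogeneous_prod homogeneous_power l)
  then have H: "H \<in> homogeneous_part n e"
    using assms by (simp add: e_def)
  have X0: "mpoly_var 0 ^ k \<in> homogeneous_part n k" for k
    using homogeneous_power[OF homogeneous_var[of 0 n], of k] by simp
  have "E \<in> homogeneous_part n (e * M)"
    unfolding E_def by (intro homogeneous_minus homogeneous_power H X0)
  moreover have E: "shift r E = 1 - (1 - shift r H) ^ M" for r
    by (simp add: E_def shift_minus shift_power shift_var)
  have "shift (q i) E - 1 \<in> order_ge M"
  proof -
    have "Poly_Mapping.lookup (shift (q i) (prod l A)) 0 = 1" if "A \<subseteq> I - {i}" for A
      using that by (induction A rule: infinite_finite_induct) (auto simp: shift_mult lookup_mult_0 l(3))
    then have "Poly_Mapping.lookup (shift (q i) (\<Prod>j\<in>I - {i}. l j)) 0 = 1" by blast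
    moreover have "Poly_Mapping.lookup (f ^ k) 0 = 1" if "Poly_Mapping.lookup f 0 = 1" for f :: "'k mpoly" and k
      using that by (induction k) (auto simp: lookup_mult_0)
    moreover have "H = (\<Prod>j\<in>I - {i}. l j) ^ M"
      by (simp add: H_def prod_power_distrib)
    ultimately have "1 - shift (q i) H \<in> order_ge 1"
      unfolding order_ge_1_iff by (simp add: lookup_minus shift_power)
    then have "- ((1 - shift (q i) H) ^ M) \<in> order_ge M"
      by (intro order_ge_uminus order_ge_power)
    then show ?thesis by (simp add: E)
  qed
  moreover have "shift (q j) E \<in> order_ge M" if "j \<in> I" "j \<noteq> i" for j
  proof -
    have "H = l j ^ M * (\<Prod>j\<in>I - {i} - {j}. l j ^ M)"
      unfolding H_def using assms that by (intro prod.remove) auto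
    moreover have "shift (q j) (l j ^ M) \<in> order_ge M"
      unfolding shift_power using l(2) that by (intro order_ge_power) auto
    ultimately have "shift (q j) H \<in> order_ge M"
      by (simp only: shift_mult order_ge_mult_right)
    then have "(1 - shift (q j) H) ^ M - 1 \<in> order_ge M"
      by (intro one_plus_order_ge_power) (simp add: order_ge_uminus)
    then have "- ((1 - shift (q j) H) ^ M - 1) \<in> order_ge M" by (rule order_ge_uminus)
    then show ?thesis by (simp add: E)
  qed
  ultimately show ?thesis by (auto simp: e_def intro!: bexI[of _ E])
qed

text \<open>Near point \<open>i\<close> the separating form acts as 1 up to order \<open>M\<close>,
  so multiplying it by the homogenized monomial \<open>t\<close> produces exactly this monomial in
  the truncated expansion; at the other points the product vanishes to order \<open>M\<close>. One
  order \<open>M\<close> is used for all points.\<close>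

lemma interpolation:
  fixes q :: "nat \<Rightarrow> nat \<Rightarrow> 'k::field"
  assumes "finite I"
    and distinct: "\<And>i j. i \<in> I \<Longrightarrow> j \<in> I \<Longrightarrow> i \<noteq> j \<Longrightarrow> \<exists>k\<in>{1..n}. q i k \<noteq> q j k"
  shows "\<exists>D. \<forall>d\<ge>D. \<exists>F. (\<forall>i\<in>I. \<forall>t\<in>exponents n M. F i t \<in> homogeneous_part n d) \<and>
    (\<forall>i\<in>I. \<forall>t\<in>exponents n M. \<forall>j\<in>I. \<forall>u. monom_deg u < M \<longrightarrow>
      Poly_Mapping.lookup (shift (q j) (F i t)) u = (if i = j \<and> t = u then 1 else 0))"
proof -
  define e where "e = (card I - 1) * M * M"
  have "\<forall>i. \<exists>E. i \<in> I \<longrightarrow> E \<in> homogeneous_part n e \<and> shift (q i) E - 1 \<in> order_ge M \<and>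
    (\<forall>j\<in>I. j \<noteq> i \<longrightarrow> shift (q j) E \<in> order_ge M)"
    using separating_form[OF assms(1), of _ n q M] distinct unfolding e_def by blast
  then obtain E where E: "\<And>i. i \<in> I \<Longrightarrow> E i \<in> homogeneous_part n e"
    "\<And>i. i \<in> I \<Longrightarrow> shift (q i) (E i) - 1 \<in> order_ge M"
    "\<And>i j. i \<in> I \<Longrightarrow> j \<in> I \<Longrightarrow> j \<noteq> i \<Longrightarrow> shift (q j) (E i) \<in> order_ge M"
    by metis
  have "\<exists>F. (\<forall>i\<in>I. \<forall>t\<in>exponents n M. F i t \<in> homogeneous_part n d) \<and>
    (\<forall>i\<in>I. \<forall>t\<in>exponents n M. \<forall>j\<in>I. \<forall>u. monom_deg u < M \<longrightarrow>
      Poly_Mapping.lookup (shift (q j) (F i t)) u = (if i = j \<and> t = u then 1 else 0))"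
    if d: "d \<ge> e + M" for d
  proof -
    define Y where "Y i k = mpoly_var k - mpoly_const (q i k) * mpoly_var 0" for i k
    \<comment> \<open>The power of \<open>X_0\<close> adjusts the degree to \<open>d\<close> without
      changing any expansion; \<open>d \<ge> e + M\<close> makes its exponent a genuine
      difference.\<close>
    define F where "F i t = E i * monom_power (Y i) t * mpoly_var 0 ^ (d - e - monom_deg t)" for i t
    have "F i t \<in> homogeneous_part n d" if "i \<in> I" and t: "t \<in> exponents n M" for i t
    proof -
      have "monom_power (Y i) t \<in> homogeneous_part n (monom_deg t)"
      proof (rule homogeneous_monom_power)
        fix k assume "k \<in> Poly_Mapping.keys t"
        then have "k \<le> n" using t by (auto simp: exponents_def)
        then show "Y i k \<in> homogeneous_part n 1"
          unfolding Y_def One_nat_def by (intro homogeneous_const_mult homogeneous_minus homogeneous_var) auto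
      qed
      then have "F i t \<in> homogeneous_part n (e + monom_deg t + 1 * (d - e - monom_deg t))"
        unfolding F_def using E(1)[OF that(1)]
        by (intro homogeneous_mult homogeneous_power) auto
      moreover have "e + monom_deg t + 1 * (d - e - monom_deg t) = d"
        using t d by (auto simp: exponents_def)
      ultimately show ?thesis by simp
    qed
    moreover have "Poly_Mapping.lookup (shift (q j) (F i t)) u = (if i = j \<and> t = u then 1 else 0)"
      if i: "i \<in> I" and t: "t \<in> exponents n M" and j: "j \<in> I" and u: "monom_deg u < M" for i j t u
    proof (cases "i = j")
      case True
      have keys0: "0 \<notin> Poly_Mapping.keys t" using t by (auto simp: exponents_def)
      have "monom_power (\<lambda>k. shift (q i) (Y i k)) t = monom_power mpoly_var t"
      proof (rule monom_power_cong)
        fix k assume "k \<in> Poly_Mapping.keys t"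
        then have "k \<noteq> 0" using keys0 by metis
        then show "shift (q i) (Y i k) = mpoly_var k"
          by (simp add: Y_def shift_minus shift_mult shift_var)
      qed
      then have "shift (q i) (F i t) = shift (q i) (E i) * Poly_Mapping.single t 1"
        by (simp add: F_def shift_mult shift_power shift_var shift_monom_power monom_power_var)
      also have "\<dots> = Poly_Mapping.single t 1 + (shift (q i) (E i) - 1) * Poly_Mapping.single t 1"
        by (simp add: left_diff_distrib)
      finally have "shift (q i) (F i t) = \<dots>" .
      moreover have "Poly_Mapping.lookup ((shift (q i) (E i) - 1) * Poly_Mapping.single t 1) u = 0"
        using order_ge_mult_right[OF E(2)[OF i]] u by (auto simp: order_ge_def)
      ultimately show ?thesis using True by (simp add: lookup_add lookup_single when_def)
    next
      case False
      then have "shift (q j) (F i t) \<in> order_ge M"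
        unfolding F_def shift_mult using E(3)[OF i j] by (intro order_ge_mult_right) auto
      then show ?thesis using u False by (auto simp: order_ge_def)
    qed
    ultimately show ?thesis by blast
  qed
  then show ?thesis by blast
qed

section \<open>Fat point schemes and their jets\<close>

locale fat_points =
  fixes n s :: nat and P :: "nat \<Rightarrow> nat \<Rightarrow> 'k::field" and \<mu> :: "nat \<Rightarrow> nat"
  assumes points: "\<And>i. i \<in> {1..s} \<Longrightarrow> P i 0 \<noteq> 0"
    and distinct: "\<And>i j. i \<in> {1..s} \<Longrightarrow> j \<in> {1..s} \<Longrightarrow> i \<noteq> j \<Longrightarrow> \<not> same_proj_point n (P i) (P j)"
    and s_pos: "s \<ge> 1"
begin

abbreviation "W \<equiv> fat_point_ideal n s P \<mu>"

abbreviation "loc \<equiv> \<lambda>i. affine_coords (P i)"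

lemma ideal_W: "ideal W (mpoly_ring n)"
proof -
  interpret cring "mpoly_ring n :: 'k mpoly ring" by (rule mpoly_cring)
  show ?thesis
    unfolding fat_point_ideal_def
    by (rule i_Intersect[of "(\<lambda>i. vanishing_ideal n (P i) [^]\<^bsub>ideals_set (mpoly_ring n)\<^esub> \<mu> i) ` {1..s}"])
      (use s_pos in \<open>auto intro: ideal_power_ideal[OF vanishing_ideal_ideal]\<close>)
qed

lemma W_vanish_order:
  assumes "f \<in> W" and "i \<in> {1..s}"
  shows "f \<in> vanish_order (loc i) (\<mu> i)" and "pderiv_var j f \<in> vanish_order (loc i) (\<mu> i - 1)"
  using ideal_power_vanish_order[of "P i" f n "\<mu> i", OF points[OF assms(2)]] assms
  by (auto simp: fat_point_ideal_def)

text \<open>Membership in each power of a point ideal is decided by vanishing order, and the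
  expansion of a form involves only \<open>X_1, ..., X_n\<close>; hence finitely many coefficients
  suffice as a test.\<close>

lemma homogeneous_in_W:
  assumes f: "f \<in> homogeneous_part n d"
    and 0: "\<And>i t. i \<in> {1..s} \<Longrightarrow> t \<in> exponents n (\<mu> i) \<Longrightarrow> Poly_Mapping.lookup (shift (loc i) f) t = 0"
  shows "f \<in> W"
proof -
  have "f \<in> vanishing_ideal n (P i) [^]\<^bsub>ideals_set (mpoly_ring n)\<^esub> \<mu> i" if i: "i \<in> {1..s}" for i
  proof (rule vanish_order_in_ideal_power[of "P i" f n d, OF points[OF i] f])
    have "Poly_Mapping.lookup (shift (loc i) f) t = 0" if "monom_deg t < \<mu> i" for t
    proof (cases "t \<in> Poly_Mapping.keys (shift (loc i) f)")
      case True
      then have "t \<in> exponents n (\<mu> i)"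
        using homogenize_shift(2)[OF f] that by (auto simp: exponents_def)
      then show ?thesis using 0 i by blast
    qed (simp add: in_keys_iff)
    then show "f \<in> vanish_order (loc i) (\<mu> i)"
      by (simp add: vanish_order_def order_ge_def)
  qed
  then show ?thesis by (auto simp: fat_point_ideal_def)
qed

text \<open>Equal affine coordinates would make the two points proportional, with factor
  \<open>P j 0 / P i 0\<close>.\<close>

lemma loc_distinct:
  assumes "i \<in> {1..s}" "j \<in> {1..s}" "i \<noteq> j" shows "\<exists>k\<in>{1..n}. loc i k \<noteq> loc j k"
proof (rule ccontr)
  assume *: "\<not> ?thesis"
  have "P j k = P j 0 / P i 0 * P i k" if "k \<le> n" for k
  proof (cases "k = 0")
    case False
    then have "loc i k = loc j k" using * that by auto
    then show ?thesis using points assms by (simp add: affine_coords_def field_simps)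
  qed (use points assms in simp)
  moreover have "P j 0 / P i 0 \<noteq> 0" using points assms by simp
  ultimately have "same_proj_point n (P i) (P j)"
    unfolding same_proj_point_def by blast
  then show False using distinct assms by blast
qed

text \<open>The multiplicities are a parameter because the two bounds use \<open>\<mu>\<close> and
  \<open>\<mu>\<close> lowered by one.\<close>

definition jet_index :: "(nat \<Rightarrow> nat) \<Rightarrow> (nat \<times> (nat \<Rightarrow>\<^sub>0 nat)) set"
  where "jet_index \<nu> = (SIGMA i:{1..s}. exponents n (\<nu> i))"

lemma finite_jet_index [simp]: "finite (jet_index \<nu>)"
  by (simp add: jet_index_def)

lemma card_jet_index: "n \<ge> 1 \<Longrightarrow> card (jet_index \<nu>) = (\<Sum>i=1..s. (\<nu> i + n - 1) choose n)"
  by (simp add: jet_index_def card_SigmaI card_exponents)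

definition jet :: "'k mpoly \<Rightarrow> nat \<times> (nat \<Rightarrow>\<^sub>0 nat) \<Rightarrow> 'k"
  where "jet f = (\<lambda>(i, t). Poly_Mapping.lookup (shift (loc i) f) t)"

text \<open>Jets are linear over the constants, and since \<open>shift\<close> sends
  \<open>X_0\<close> to 1 they do not see multiplication by \<open>X_0\<close>. The latter is the
  source of the surjectivity of \<open>x_0\<close> in large degree.\<close>

lemma jet_add: "jet (f + g) x = jet f x + jet g x"
  and jet_minus: "jet (f - g) x = jet f x - jet g x"
  and jet_const_mult: "jet (mpoly_const c * f) x = c * jet f x"
  and jet_var0_mult: "jet (mpoly_var 0 * f) x = jet f x"
  by (simp_all add: jet_def shift_add shift_minus shift_mult shift_var lookup_add lookup_minus split: prod.split)

lemma jet_sum: "jet (sum F A) x = (\<Sum>a\<in>A. jet (F a) x)"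
  by (simp add: jet_def shift_sum lookup_sum split: prod.split)

lemma jet_interpolation:
  "\<exists>D. \<forall>d\<ge>D. \<exists>F. (\<forall>x\<in>jet_index \<mu>. F x \<in> homogeneous_part n d) \<and>
    (\<forall>x\<in>jet_index \<mu>. \<forall>y\<in>jet_index \<mu>. jet (F x) y = (if x = y then 1 else 0))"
proof -
  \<comment> \<open>Any common bound for the multiplicities would do; the sum is one.\<close>
  define M where "M = (\<Sum>i=1..s. \<mu> i)"
  have M: "\<mu> i \<le> M" if "i \<in> {1..s}" for i
    using that unfolding M_def by (rule member_le_sum) auto
  obtain D where D: "\<And>d. d \<ge> D \<Longrightarrow> \<exists>F. (\<forall>i\<in>{1..s}. \<forall>t\<in>exponents n M. F i t \<in> homogeneous_part n d) \<and>
    (\<forall>i\<in>{1..s}. \<forall>t\<in>exponents n M. \<forall>j\<in>{1..s}. \<forall>u. monom_deg u < M \<longrightarrow>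
      Poly_Mapping.lookup (shift (loc j) (F i t)) u = (if i = j \<and> t = u then 1 else 0))"
    using interpolation[of "{1..s}" n "loc" M, OF _ loc_distinct] by blast
  have index: "i \<in> {1..s}" "t \<in> exponents n M" "monom_deg t < M" if "(i, t) \<in> jet_index \<mu>" for i t
    using that M[of i] by (simp_all add: jet_index_def exponents_def)
  have "\<exists>F. (\<forall>x\<in>jet_index \<mu>. F x \<in> homogeneous_part n d) \<and>
    (\<forall>x\<in>jet_index \<mu>. \<forall>y\<in>jet_index \<mu>. jet (F x) y = (if x = y then 1 else 0))" if d: "d \<ge> D" for d
  proof -
    obtain F where F: "\<forall>i\<in>{1..s}. \<forall>t\<in>exponents n M. F i t \<in> homogeneous_part n d"
      "\<forall>i\<in>{1..s}. \<forall>t\<in>exponents n M. \<forall>j\<in>{1..s}. \<forall>u. monom_deg u < M \<longrightarrow>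
      Poly_Mapping.lookup (shift (loc j) (F i t)) u = (if i = j \<and> t = u then 1 else 0)"
      using D[OF d] by blast
    have "jet (case_prod F (i, t)) (j, u) = (if (i, t) = (j, u) then 1 else 0)"
      if "(i, t) \<in> jet_index \<mu>" "(j, u) \<in> jet_index \<mu>" for i t j u
      using F(2) index[OF that(1)] index[OF that(2)] by (simp add: jet_def)
    moreover have "case_prod F (i, t) \<in> homogeneous_part n d" if "(i, t) \<in> jet_index \<mu>" for i t
      using F(1) index[OF that] by simp
    ultimately have "(\<forall>x\<in>jet_index \<mu>. case_prod F x \<in> homogeneous_part n d) \<and>
      (\<forall>x\<in>jet_index \<mu>. \<forall>y\<in>jet_index \<mu>. jet (case_prod F x) y = (if x = y then 1 else 0))"
      by (metis surj_pair)
    then show ?thesis by blast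
  qed
  then show ?thesis by blast
qed

text \<open>Subtracting the interpolating combination removes every \<open>\<mu>\<close>-jet, and a
  form without such jets lies in \<open>W\<close>. In degree \<open>d + 1\<close> the same
  combination times \<open>X_0\<close> has the required jets, so modulo \<open>W\<close> every form
  of degree \<open>d + 1\<close> is a multiple of \<open>X_0\<close>.\<close>

lemma jet_expansion:
  assumes F: "\<And>x. x \<in> jet_index \<mu> \<Longrightarrow> F x \<in> homogeneous_part n d"
    and dual: "\<And>x y. x \<in> jet_index \<mu> \<Longrightarrow> y \<in> jet_index \<mu> \<Longrightarrow> jet (F x) y = (if x = y then 1 else 0)"
  shows "f \<in> homogeneous_part n d \<Longrightarrow>
      f - (\<Sum>x\<in>jet_index \<mu>. mpoly_const (jet f x) * F x) \<in> W"
    and "f \<in> homogeneous_part n (Suc d) \<Longrightarrow>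
      f - mpoly_var 0 * (\<Sum>x\<in>jet_index \<mu>. mpoly_const (jet f x) * F x) \<in> W"
proof -
  let ?S = "\<lambda>f. \<Sum>x\<in>jet_index \<mu>. mpoly_const (jet f x) * F x"
  have S: "?S f \<in> homogeneous_part n d" for f
    by (rule homogeneous_sum, rule homogeneous_const_mult, rule F)
  have jet_S: "jet (?S f) y = jet f y" if y: "y \<in> jet_index \<mu>" for f y
  proof -
    have "jet (?S f) y = (\<Sum>x\<in>jet_index \<mu>. jet f x * (if x = y then 1 else 0))"
      unfolding jet_sum jet_const_mult using dual y by (intro sum.cong) auto
    also have "\<dots> = (\<Sum>x\<in>jet_index \<mu>. if x = y then jet f x else 0)"
      by (intro sum.cong) auto
    finally show ?thesis using y by simp
  qed
  have in_W: "g \<in> W" if g: "g \<in> homogeneous_part n e" and "\<And>y. y \<in> jet_index \<mu> \<Longrightarrow> jet g y = 0" for g e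
  proof (rule homogeneous_in_W[OF g])
    show "Poly_Mapping.lookup (shift (loc i) g) t = 0" if "i \<in> {1..s}" "t \<in> exponents n (\<mu> i)" for i t
      using \<open>\<And>y. y \<in> jet_index \<mu> \<Longrightarrow> jet g y = 0\<close>[of "(i, t)"] that by (auto simp: jet_index_def jet_def)
  qed
  show "f - ?S f \<in> W" if "f \<in> homogeneous_part n d"
    by (rule in_W[OF homogeneous_minus[OF that S]]) (simp add: jet_minus jet_S)
  show "f - mpoly_var 0 * ?S f \<in> W" if "f \<in> homogeneous_part n (Suc d)"
  proof (rule in_W[OF homogeneous_minus[OF that]])
    show "mpoly_var 0 * ?S f \<in> homogeneous_part n (Suc d)"
      using homogeneous_mult[OF homogeneous_var[of 0 n] S] by simp
  qed (simp add: jet_minus jet_S jet_var0_mult)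
qed

end

section \<open>Quotient modules and presented modules\<close>

lemma (in Module.module) submodule_minus_closed:
  assumes "submodule R N M" and "x \<in> N" shows "\<ominus>\<^bsub>M\<^esub> x \<in> N"
proof -
  interpret N: submodule R N M by (rule assms)
  have "\<ominus>\<^bsub>M\<^esub> x = (\<ominus> \<one>) \<odot>\<^bsub>M\<^esub> x"
    using assms(2) N.subset by (subst smult_l_minus) auto
  then show ?thesis using assms(2) by simp
qed

lemma (in Module.module) submodule_abelian_subgroup:
  assumes "submodule R N M" shows "abelian_subgroup N M"
proof -
  interpret N: submodule R N M by (rule assms)
  have "subgroup N (add_monoid M)"
  proof (rule M.add.subgroupI)
    show "\<ominus>\<^bsub>M\<^esub> x \<in> N" if "x \<in> N" for x
      using that assms by (rule submodule_minus_closed[rotated])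
  qed (use N.subset N.zero_closed in \<open>blast+\<close>)
  then show ?thesis
    by (intro abelian_subgroupI3 additive_subgroup.intro M.abelian_group_axioms)
qed

context
  fixes R :: "('r, 'q) ring_scheme" (structure) and M :: "('r, 'm, 'p) module_scheme" and N
  assumes module: "Module.module R M" and sub: "submodule R N M"
begin

interpretation M: Module.module R M by (rule module)
interpretation N: abelian_subgroup N M by (rule M.submodule_abelian_subgroup[OF sub])

lemma quotient_module_carrier: "A \<in> carrier (quotient_module M N) \<longleftrightarrow> (\<exists>x\<in>carrier M. A = N +>\<^bsub>M\<^esub> x)"
  by (auto simp: quotient_module_def A_RCOSETS_def')

lemma quotient_module_add:
  "x \<in> carrier M \<Longrightarrow> y \<in> carrier M \<Longrightarrow>
    (N +>\<^bsub>M\<^esub> x) \<oplus>\<^bsub>quotient_module M N\<^esub> (N +>\<^bsub>M\<^esub> y) = N +>\<^bsub>M\<^esub> (x \<oplus>\<^bsub>M\<^esub> y)"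
  by (simp add: quotient_module_def N.a_rcos_sum)

lemma quotient_module_zero: "\<zero>\<^bsub>quotient_module M N\<^esub> = N +>\<^bsub>M\<^esub> \<zero>\<^bsub>M\<^esub>"
  using N.a_subset by (simp add: quotient_module_def)

lemma quotient_coset_eqI:
  assumes "x \<in> carrier M" "y \<in> carrier M" "x \<ominus>\<^bsub>M\<^esub> y \<in> N" shows "N +>\<^bsub>M\<^esub> x = N +>\<^bsub>M\<^esub> y"
proof -
  have "x \<in> N +>\<^bsub>M\<^esub> y"
    using assms by (intro N.a_rcos_module_rev) (auto simp: a_minus_def)
  then show ?thesis using N.a_repr_independence'[of x y] assms by simp
qed

lemma quotient_coset_diff:
  "x \<in> carrier M \<Longrightarrow> y \<in> N +>\<^bsub>M\<^esub> x \<Longrightarrow> y \<in> carrier M \<and> y \<ominus>\<^bsub>M\<^esub> x \<in> N"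
  using N.a_rcos_module_imp N.a_elemrcos_carrier by (simp add: a_minus_def)

lemma quotient_coset_self: "x \<in> carrier M \<Longrightarrow> x \<in> N +>\<^bsub>M\<^esub> x"
  by (rule N.a_rcos_self)

text \<open>The union in the definition runs over cosets that all coincide, because \<open>N\<close>
  absorbs scalar multiples of differences.\<close>

lemma quotient_module_smult:
  assumes r: "r \<in> carrier R" and x: "x \<in> carrier M"
  shows "r \<odot>\<^bsub>quotient_module M N\<^esub> (N +>\<^bsub>M\<^esub> x) = N +>\<^bsub>M\<^esub> (r \<odot>\<^bsub>M\<^esub> x)"
proof -
  have "N +>\<^bsub>M\<^esub> (r \<odot>\<^bsub>M\<^esub> a) = N +>\<^bsub>M\<^esub> (r \<odot>\<^bsub>M\<^esub> x)" if "a \<in> N +>\<^bsub>M\<^esub> x" for a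
  proof (rule quotient_coset_eqI)
    have a: "a \<in> carrier M" "a \<ominus>\<^bsub>M\<^esub> x \<in> N" using quotient_coset_diff[OF x that] by auto
    then show "r \<odot>\<^bsub>M\<^esub> a \<in> carrier M" using r by simp
    have "r \<odot>\<^bsub>M\<^esub> a \<ominus>\<^bsub>M\<^esub> r \<odot>\<^bsub>M\<^esub> x = r \<odot>\<^bsub>M\<^esub> (a \<ominus>\<^bsub>M\<^esub> x)"
      using r x a by (simp add: a_minus_def M.smult_r_distr M.smult_r_minus)
    also have "\<dots> \<in> N" using sub a(2) r by (simp add: submodule.smult_closed)
    finally show "r \<odot>\<^bsub>M\<^esub> a \<ominus>\<^bsub>M\<^esub> r \<odot>\<^bsub>M\<^esub> x \<in> N" .
  qed (use r x in simp)
  moreover have "x \<in> N +>\<^bsub>M\<^esub> x" using x by (rule quotient_coset_self)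
  ultimately have "(\<Union>a\<in>N +>\<^bsub>M\<^esub> x. N +>\<^bsub>M\<^esub> (r \<odot>\<^bsub>M\<^esub> a)) = N +>\<^bsub>M\<^esub> (r \<odot>\<^bsub>M\<^esub> x)" by blast
  then show ?thesis by (simp add: quotient_module_def)
qed

lemma quotient_coset_carrier: "x \<in> carrier M \<Longrightarrow> N +>\<^bsub>M\<^esub> x \<in> carrier (quotient_module M N)"
  by (auto simp: quotient_module_carrier)

lemma quotient_module_module: "Module.module R (quotient_module M N)"
proof -
  let ?Q = "quotient_module M N"
  note q = quotient_coset_carrier quotient_module_add quotient_module_zero quotient_module_smult
  have rep: "\<exists>x. x \<in> carrier M \<and> v = N +>\<^bsub>M\<^esub> x" if "v \<in> carrier ?Q" for v
    using that by (auto simp: quotient_module_carrier)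
  note simps = q M.M.r_neg M.smult_l_distr M.smult_r_distr M.smult_assoc1
  show ?thesis
  proof (rule module_criteria; (intro allI impI ballI)?)
    show "cring R" by (rule M.is_cring)
    show "\<zero>\<^bsub>?Q\<^esub> \<in> carrier ?Q" by (simp add: q)
    fix v assume v: "v \<in> carrier ?Q"
    then obtain x where x: "x \<in> carrier M" "v = N +>\<^bsub>M\<^esub> x" using rep by blast
    show "\<exists>w\<in>carrier ?Q. v \<oplus>\<^bsub>?Q\<^esub> w = \<zero>\<^bsub>?Q\<^esub>"
      by (rule bexI[of _ "N +>\<^bsub>M\<^esub> (\<ominus>\<^bsub>M\<^esub> x)"]) (use x in \<open>simp_all add: simps\<close>)
    show "v \<oplus>\<^bsub>?Q\<^esub> \<zero>\<^bsub>?Q\<^esub> = v" "\<one> \<odot>\<^bsub>?Q\<^esub> v = v" using x by (simp_all add: simps)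
  next
    fix v w assume "v \<in> carrier ?Q \<and> w \<in> carrier ?Q"
    then obtain x y where "x \<in> carrier M" "v = N +>\<^bsub>M\<^esub> x" "y \<in> carrier M" "w = N +>\<^bsub>M\<^esub> y" using rep by blast
    then show "v \<oplus>\<^bsub>?Q\<^esub> w \<in> carrier ?Q" "v \<oplus>\<^bsub>?Q\<^esub> w = w \<oplus>\<^bsub>?Q\<^esub> v" by (simp_all add: simps M.M.a_comm)
  next
    fix c v assume "c \<in> carrier R \<and> v \<in> carrier ?Q"
    then obtain x where "c \<in> carrier R" "x \<in> carrier M" "v = N +>\<^bsub>M\<^esub> x" using rep by blast
    then show "c \<odot>\<^bsub>?Q\<^esub> v \<in> carrier ?Q" by (simp add: simps)
  next
    fix v w u assume "v \<in> carrier ?Q \<and> w \<in> carrier ?Q \<and> u \<in> carrier ?Q"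
    then obtain x y z where "x \<in> carrier M" "v = N +>\<^bsub>M\<^esub> x" "y \<in> carrier M" "w = N +>\<^bsub>M\<^esub> y"
      "z \<in> carrier M" "u = N +>\<^bsub>M\<^esub> z" using rep[of v] rep[of w] rep[of u] by auto
    then show "v \<oplus>\<^bsub>?Q\<^esub> w \<oplus>\<^bsub>?Q\<^esub> u = v \<oplus>\<^bsub>?Q\<^esub> (w \<oplus>\<^bsub>?Q\<^esub> u)" by (simp add: simps M.M.a_assoc)
  next
    fix a b v assume "a \<in> carrier R \<and> b \<in> carrier R \<and> v \<in> carrier ?Q"
    then obtain x where "a \<in> carrier R" "b \<in> carrier R" "x \<in> carrier M" "v = N +>\<^bsub>M\<^esub> x" using rep by blast
    then show "(a \<otimes> b) \<odot>\<^bsub>?Q\<^esub> v = a \<odot>\<^bsub>?Q\<^esub> (b \<odot>\<^bsub>?Q\<^esub> v)"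
      and "(a \<oplus> b) \<odot>\<^bsub>?Q\<^esub> v = a \<odot>\<^bsub>?Q\<^esub> v \<oplus>\<^bsub>?Q\<^esub> b \<odot>\<^bsub>?Q\<^esub> v" by (simp_all add: simps)
  next
    fix a v w assume "a \<in> carrier R \<and> v \<in> carrier ?Q \<and> w \<in> carrier ?Q"
    then obtain x y where "a \<in> carrier R" "x \<in> carrier M" "v = N +>\<^bsub>M\<^esub> x" "y \<in> carrier M" "w = N +>\<^bsub>M\<^esub> y"
      using rep by blast
    then show "a \<odot>\<^bsub>?Q\<^esub> (v \<oplus>\<^bsub>?Q\<^esub> w) = a \<odot>\<^bsub>?Q\<^esub> v \<oplus>\<^bsub>?Q\<^esub> a \<odot>\<^bsub>?Q\<^esub> w"
      by (simp add: simps)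
  qed
qed

end

section \<open>Free modules and modules given by generators and relations\<close>

lemma free_module_simps [simp]:
  "\<zero>\<^bsub>free_module R X\<^esub> = (\<lambda>_. \<zero>\<^bsub>R\<^esub>)" "f \<oplus>\<^bsub>free_module R X\<^esub> g = (\<lambda>x. f x \<oplus>\<^bsub>R\<^esub> g x)"
  "r \<odot>\<^bsub>free_module R X\<^esub> f = (\<lambda>x. r \<otimes>\<^bsub>R\<^esub> f x)"
  by (simp_all add: free_module_def)

lemma free_module_carrier:
  "f \<in> carrier (free_module R X) \<longleftrightarrow> (\<forall>x. f x \<in> carrier R) \<and> (\<forall>x. x \<notin> X \<longrightarrow> f x = \<zero>\<^bsub>R\<^esub>) \<and>
    finite {x. f x \<noteq> \<zero>\<^bsub>R\<^esub>}"
  by (simp add: free_module_def)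

context cring
begin

lemma free_module_add_closed:
  assumes "f \<in> carrier (free_module R X)" "g \<in> carrier (free_module R X)"
  shows "(\<lambda>x. f x \<oplus> g x) \<in> carrier (free_module R X)"
proof -
  have "{x. f x \<oplus> g x \<noteq> \<zero>} \<subseteq> {x. f x \<noteq> \<zero>} \<union> {x. g x \<noteq> \<zero>}" by auto
  then have "finite {x. f x \<oplus> g x \<noteq> \<zero>}"
    using assms by (auto simp: free_module_carrier intro: finite_subset)
  then show ?thesis using assms by (simp add: free_module_carrier)
qed

lemma free_module_smult_closed:
  assumes "r \<in> carrier R" "f \<in> carrier (free_module R X)"
  shows "(\<lambda>x. r \<otimes> f x) \<in> carrier (free_module R X)"
proof -
  have "{x. r \<otimes> f x \<noteq> \<zero>} \<subseteq> {x. f x \<noteq> \<zero>}" using assms by auto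
  then have "finite {x. r \<otimes> f x \<noteq> \<zero>}"
    using assms by (auto simp: free_module_carrier intro: finite_subset)
  then show ?thesis using assms by (simp add: free_module_carrier)
qed

lemma free_module_module: "Module.module R (free_module R X)"
proof (rule module_criteria; (intro allI impI ballI)?)
  fix f assume f: "f \<in> carrier (free_module R X)"
  have "(\<lambda>x. \<ominus> \<one> \<otimes> f x) \<in> carrier (free_module R X)"
    using f by (intro free_module_smult_closed) auto
  then show "\<exists>g\<in>carrier (free_module R X). f \<oplus>\<^bsub>free_module R X\<^esub> g = \<zero>\<^bsub>free_module R X\<^esub>"
    using f by (intro bexI[of _ "\<lambda>x. \<ominus> \<one> \<otimes> f x"]) (auto simp: free_module_carrier l_minus r_neg)
next
  show "\<zero>\<^bsub>free_module R X\<^esub> \<in> carrier (free_module R X)" by (simp add: free_module_carrier)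
qed (auto simp: is_cring free_module_add_closed free_module_smult_closed,
     auto simp: free_module_carrier a_ac m_assoc l_distr r_distr)

lemma free_gen_closed: "x \<in> X \<Longrightarrow> free_gen R x \<in> carrier (free_module R X)"
  by (auto simp: free_gen_def free_module_carrier intro: finite_subset[of _ "{x}"])

text \<open>Writing the negative as multiplication by \<open>\<ominus> \<one>\<close> lets
  \<open>lin_val\<close> treat differences through sums and scalar multiples alone.\<close>

lemma free_module_minus:
  assumes "f \<in> carrier (free_module R X)" "g \<in> carrier (free_module R X)"
  shows "f \<ominus>\<^bsub>free_module R X\<^esub> g = (\<lambda>x. f x \<oplus> \<ominus> \<one> \<otimes> g x)"
proof -
  interpret F: Module.module R "free_module R X" by (rule free_module_module)
  have "\<ominus>\<^bsub>free_module R X\<^esub> g = (\<ominus> \<one>) \<odot>\<^bsub>free_module R X\<^esub> g"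
    using assms F.smult_l_minus[of \<one> g] F.smult_one[of g] by simp
  then show ?thesis by (simp add: a_minus_def)
qed

end

lemma presented_span_submodule:
  assumes "cring R" and "Rel \<subseteq> carrier (free_module R X)"
  shows "submodule R (rel_submodule R X Rel) (free_module R X)"
proof -
  interpret cring R by (rule assms)
  interpret F: Module.module R "free_module R X" by (rule free_module_module)
  show ?thesis unfolding rel_submodule_def by (rule F.span_is_submodule[OF assms(2)])
qed

lemma presented_rel_mem:
  assumes "cring R" and "Rel \<subseteq> carrier (free_module R X)" and "f \<in> Rel"
  shows "f \<in> rel_submodule R X Rel"
proof -
  interpret cring R by (rule assms)
  interpret F: Module.module R "free_module R X" by (rule free_module_module)
  show ?thesis unfolding rel_submodule_def using F.in_own_span[OF assms(2)] assms(3) by blast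
qed

lemma presented_module_module:
  assumes "cring R" and "Rel \<subseteq> carrier (free_module R X)"
  shows "Module.module R (presented_module R X Rel)"
  unfolding presented_module_def
  by (rule quotient_module_module[OF cring.free_module_module[OF assms(1)] presented_span_submodule[OF assms]])

lemma presented_gen_closed:
  assumes "cring R" and "Rel \<subseteq> carrier (free_module R X)" and "x \<in> X"
  shows "presented_gen R X Rel x \<in> carrier (presented_module R X Rel)"
  unfolding presented_module_def presented_gen_def
  by (rule quotient_coset_carrier[OF cring.free_module_module[OF assms(1)] presented_span_submodule[OF assms(1,2)]
    cring.free_gen_closed[OF assms(1,3)]])

text \<open>Maps out of a presented module take values in a type-class ring modulo an ideal \<open>V\<close>, rather
  than in a quotient ring, so that the library determinant applies.\<close>

locale ideal_congruence =
  fixes V :: "'b::comm_ring_1 set"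
  assumes V_zero: "0 \<in> V" and V_add: "f \<in> V \<Longrightarrow> g \<in> V \<Longrightarrow> f + g \<in> V" and V_mult: "g \<in> V \<Longrightarrow> f * g \<in> V"
begin

definition cong_mod :: "'b \<Rightarrow> 'b \<Rightarrow> bool"  (infix "\<approx>" 50)
  where "f \<approx> g \<longleftrightarrow> f - g \<in> V"

lemma V_uminus: "f \<in> V \<Longrightarrow> - f \<in> V"
  using V_mult[of f "- 1"] by simp

lemma cong_refl [simp]: "f \<approx> f"
  by (simp add: cong_mod_def V_zero)

lemma cong_sym: "f \<approx> g \<Longrightarrow> g \<approx> f"
  using V_uminus[of "f - g"] by (simp add: cong_mod_def)

lemma cong_trans [trans]: "f \<approx> g \<Longrightarrow> g \<approx> h \<Longrightarrow> f \<approx> h"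
  using V_add[of "f - g" "g - h"] by (simp add: cong_mod_def)

lemma cong_add: "f \<approx> g \<Longrightarrow> f' \<approx> g' \<Longrightarrow> f + f' \<approx> g + g'"
  using V_add[of "f - g" "f' - g'"] by (simp add: cong_mod_def algebra_simps)

lemma cong_mult: "f \<approx> g \<Longrightarrow> f' \<approx> g' \<Longrightarrow> f * f' \<approx> g * g'"
  using V_add[OF V_mult[of "f - g" f'] V_mult[of "f' - g'" g]] by (simp add: cong_mod_def algebra_simps)

lemma cong_diff: "f \<approx> g \<Longrightarrow> f' \<approx> g' \<Longrightarrow> f - f' \<approx> g - g'"
  using V_add[of "f - g" "- (f' - g')"] V_uminus[of "f' - g'"] by (simp add: cong_mod_def algebra_simps)

lemma cong_sum: "(\<And>a. a \<in> A \<Longrightarrow> F a \<approx> G a) \<Longrightarrow> sum F A \<approx> sum G A"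
  by (induction A rule: infinite_finite_induct) (auto intro: cong_add)

lemma cong_prod: "(\<And>a. a \<in> A \<Longrightarrow> F a \<approx> G a) \<Longrightarrow> prod F A \<approx> prod G A"
  by (induction A rule: infinite_finite_induct) (auto intro: cong_mult)

lemma cong_zero_iff: "f \<approx> 0 \<longleftrightarrow> f \<in> V"
  by (simp add: cong_mod_def)

lemma cong_det:
  assumes "A \<in> carrier_mat k k" "B \<in> carrier_mat k k"
    and "\<And>i j. i < k \<Longrightarrow> j < k \<Longrightarrow> A $$ (i, j) \<approx> B $$ (i, j)"
  shows "det A \<approx> det B"
  unfolding det_def'[OF assms(1)] det_def'[OF assms(2)]
proof (intro cong_sum cong_mult cong_refl cong_prod)
  fix p i assume "p \<in> {p. p permutes {0..<k}}" "i \<in> {0..<k}"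
  then show "A $$ (i, p i) \<approx> B $$ (i, p i)"
    using permutes_in_image[of p "{0..<k}" i] by (intro assms(3)) auto
qed

end

text \<open>This models a ring homomorphism from \<open>R\<close> to the quotient of
  \<open>'b\<close> by \<open>V\<close>: \<open>rep\<close> picks values in \<open>'b\<close>
  itself, and the laws hold up to \<open>\<approx>\<close>.\<close>

locale ring_rep = cring R + ideal_congruence V
  for R :: "('r, 'q) ring_scheme" (structure) and V :: "'b::comm_ring_1 set" +
  fixes rep :: "'r \<Rightarrow> 'b"
  assumes rep_add: "a \<in> carrier R \<Longrightarrow> b \<in> carrier R \<Longrightarrow> rep (a \<oplus> b) \<approx> rep a + rep b"
    and rep_mult: "a \<in> carrier R \<Longrightarrow> b \<in> carrier R \<Longrightarrow> rep (a \<otimes> b) \<approx> rep a * rep b"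
    and rep_one: "rep \<one> \<approx> 1"
begin

lemma rep_zero: "rep \<zero> \<approx> 0"
proof -
  have "rep \<zero> \<approx> rep \<zero> + rep \<zero>" using rep_add[of \<zero> \<zero>] by simp
  then have "rep \<zero> - (rep \<zero> + rep \<zero>) \<in> V" by (simp add: cong_mod_def)
  then show ?thesis using V_uminus by (fastforce simp: cong_zero_iff)
qed

lemma rep_uminus_one: "rep (\<ominus> \<one>) \<approx> - 1"
proof -
  have "rep (\<ominus> \<one>) + rep \<one> \<approx> rep \<zero>" using rep_add[of "\<ominus> \<one>" \<one>] by (auto simp: l_neg intro: cong_sym)
  then have "rep (\<ominus> \<one>) + rep \<one> - rep \<one> \<approx> 0 - 1"
    by (intro cong_diff rep_one) (rule cong_trans[OF _ rep_zero])
  then show ?thesis by simp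
qed

definition lin_val :: "('x \<Rightarrow> 'b) \<Rightarrow> ('x \<Rightarrow> 'r) \<Rightarrow> 'b"
  where "lin_val \<theta> g = (\<Sum>x | g x \<noteq> \<zero>. rep (g x) * \<theta> x)"

text \<open>Of \<open>rep \<zero>\<close> only \<open>rep \<zero> \<approx> 0\<close> is known, so
  indices with zero coefficient may change the sum by an element of \<open>V\<close>. Sums over
  different supports are compared through this.\<close>

lemma lin_val_superset:
  assumes "finite A" "{x. g x \<noteq> \<zero>} \<subseteq> A" shows "lin_val \<theta> g \<approx> (\<Sum>x\<in>A. rep (g x) * \<theta> x)"
proof -
  have "lin_val \<theta> g = (\<Sum>x\<in>A. if g x \<noteq> \<zero> then rep (g x) * \<theta> x else 0)"
    unfolding lin_val_def using assms by (intro sum.mono_neutral_cong_left) auto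
  also have "\<dots> \<approx> (\<Sum>x\<in>A. rep (g x) * \<theta> x)"
    using cong_mult[OF cong_sym[OF rep_zero] cong_refl] by (intro cong_sum) auto
  finally show ?thesis .
qed

lemma lin_val_add:
  assumes "f \<in> carrier (free_module R X)" "g \<in> carrier (free_module R X)"
  shows "lin_val \<theta> (\<lambda>x. f x \<oplus> g x) \<approx> lin_val \<theta> f + lin_val \<theta> g"
proof -
  let ?A = "{x. f x \<noteq> \<zero>} \<union> {x. g x \<noteq> \<zero>}"
  have fin: "finite ?A" using assms by (simp add: free_module_carrier)
  have "lin_val \<theta> (\<lambda>x. f x \<oplus> g x) \<approx> (\<Sum>x\<in>?A. rep (f x \<oplus> g x) * \<theta> x)"
    using fin by (rule lin_val_superset) auto
  also have "\<dots> \<approx> (\<Sum>x\<in>?A. (rep (f x) + rep (g x)) * \<theta> x)"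
    using assms by (intro cong_sum cong_mult rep_add cong_refl) (auto simp: free_module_carrier)
  also have "\<dots> = (\<Sum>x\<in>?A. rep (f x) * \<theta> x) + (\<Sum>x\<in>?A. rep (g x) * \<theta> x)"
    by (simp add: distrib_right sum.distrib)
  also have "\<dots> \<approx> lin_val \<theta> f + lin_val \<theta> g"
    using fin by (intro cong_add cong_sym[OF lin_val_superset]) auto
  finally show ?thesis .
qed

lemma lin_val_smult:
  assumes "r \<in> carrier R" "f \<in> carrier (free_module R X)"
  shows "lin_val \<theta> (\<lambda>x. r \<otimes> f x) \<approx> rep r * lin_val \<theta> f"
proof -
  let ?A = "{x. f x \<noteq> \<zero>}"
  have fin: "finite ?A" using assms by (simp add: free_module_carrier)
  have "lin_val \<theta> (\<lambda>x. r \<otimes> f x) \<approx> (\<Sum>x\<in>?A. rep (r \<otimes> f x) * \<theta> x)"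
    using fin by (rule lin_val_superset) (use assms in auto)
  also have "\<dots> \<approx> (\<Sum>x\<in>?A. (rep r * rep (f x)) * \<theta> x)"
    using assms by (intro cong_sum cong_mult rep_mult cong_refl) (auto simp: free_module_carrier)
  also have "\<dots> = rep r * lin_val \<theta> f"
    by (simp add: lin_val_def sum_distrib_left mult.assoc)
  finally show ?thesis .
qed

lemma lin_val_minus:
  assumes "f \<in> carrier (free_module R X)" "g \<in> carrier (free_module R X)"
  shows "lin_val \<theta> (f \<ominus>\<^bsub>free_module R X\<^esub> g) \<approx> lin_val \<theta> f - lin_val \<theta> g"
proof -
  have "lin_val \<theta> (f \<ominus>\<^bsub>free_module R X\<^esub> g) \<approx> lin_val \<theta> f + lin_val \<theta> (\<lambda>x. \<ominus> \<one> \<otimes> g x)"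
    unfolding free_module_minus[OF assms]
    by (rule lin_val_add[OF assms(1) free_module_smult_closed[OF _ assms(2)]]) simp
  also have "\<dots> \<approx> lin_val \<theta> f + rep (\<ominus> \<one>) * lin_val \<theta> g"
    by (intro cong_add cong_refl lin_val_smult[OF _ assms(2)]) simp
  also have "\<dots> \<approx> lin_val \<theta> f + - 1 * lin_val \<theta> g"
    by (intro cong_add cong_refl cong_mult rep_uminus_one)
  finally show ?thesis by simp
qed

lemma lin_val_gen: "lin_val \<theta> (free_gen R x) \<approx> \<theta> x"
proof -
  have "lin_val \<theta> (free_gen R x) \<approx> (\<Sum>y\<in>{x}. rep (free_gen R x y) * \<theta> y)"
    by (rule lin_val_superset) (auto simp: free_gen_def)
  also have "\<dots> \<approx> 1 * \<theta> x" using cong_mult[OF rep_one cong_refl, of "\<theta> x"] by (simp add: free_gen_def)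
  finally show ?thesis by simp
qed

text \<open>The universal property of a presentation, with target \<open>'b\<close> modulo
  \<open>V\<close>. Combinations whose value lies in \<open>V\<close> form a submodule that contains
  the relations and hence their span; so all representatives of a coset have congruent
  values.\<close>

lemma presented_module_lift:
  assumes Rel: "Rel \<subseteq> carrier (free_module R X)" and kills: "\<And>g. g \<in> Rel \<Longrightarrow> lin_val \<theta> g \<approx> 0"
  obtains val where "\<And>x. x \<in> X \<Longrightarrow> val (presented_gen R X Rel x) \<approx> \<theta> x"
    and "\<And>A B. A \<in> carrier (presented_module R X Rel) \<Longrightarrow> B \<in> carrier (presented_module R X Rel) \<Longrightarrow>
      val (A \<oplus>\<^bsub>presented_module R X Rel\<^esub> B) \<approx> val A + val B"
    and "\<And>r A. r \<in> carrier R \<Longrightarrow> A \<in> carrier (presented_module R X Rel) \<Longrightarrow>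
      val (r \<odot>\<^bsub>presented_module R X Rel\<^esub> A) \<approx> rep r * val A"
proof -
  let ?F = "free_module R X" and ?N = "rel_submodule R X Rel"
  interpret F: Module.module R ?F by (rule free_module_module)
  note sub = presented_span_submodule[OF is_cring Rel]
  note q = F.module_axioms sub
  let ?K = "{g \<in> carrier ?F. lin_val \<theta> g \<approx> 0}"
  have "submodule R ?K ?F"
  proof
    show "\<zero>\<^bsub>?F\<^esub> \<in> ?K" by (simp add: lin_val_def free_module_carrier)
    show "f \<oplus>\<^bsub>?F\<^esub> g \<in> ?K" if "f \<in> ?K" "g \<in> ?K" for f g
    proof -
      have "lin_val \<theta> (\<lambda>x. f x \<oplus> g x) \<approx> lin_val \<theta> f + lin_val \<theta> g"
        using that by (intro lin_val_add[of _ X]) auto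
      also have "\<dots> \<approx> 0 + 0" using that by (intro cong_add) auto
      finally show ?thesis using that by (simp add: free_module_add_closed)
    qed
    show "r \<odot>\<^bsub>?F\<^esub> g \<in> ?K" if "r \<in> carrier R" "g \<in> ?K" for r g
    proof -
      have "lin_val \<theta> (\<lambda>x. r \<otimes> g x) \<approx> rep r * lin_val \<theta> g"
        using that by (intro lin_val_smult[of _ _ X]) auto
      also have "\<dots> \<approx> rep r * 0" using that by (intro cong_mult) auto
      finally show ?thesis using that by (simp add: free_module_smult_closed)
    qed
  qed (auto intro: free_module_module)
  moreover have "Rel \<subseteq> ?K" using Rel kills by auto
  ultimately have N: "lin_val \<theta> g \<approx> 0" if "g \<in> ?N" for g
    using F.span_is_subset[of Rel ?K] that unfolding rel_submodule_def by blast
  \<comment> \<open>An arbitrary element of the coset is evaluated, which is why additivity and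
    scalar compatibility appear as congruences.\<close>
  define val where "val A = lin_val \<theta> (SOME g. g \<in> A)" for A
  have val: "val (?N +>\<^bsub>?F\<^esub> g) \<approx> lin_val \<theta> g" if g: "g \<in> carrier ?F" for g
  proof -
    have "(SOME h. h \<in> ?N +>\<^bsub>?F\<^esub> g) \<in> ?N +>\<^bsub>?F\<^esub> g"
      using quotient_coset_self[OF q g] by (simp add: some_in_eq) blast
    then have h: "(SOME h. h \<in> ?N +>\<^bsub>?F\<^esub> g) \<in> carrier ?F"
      "(SOME h. h \<in> ?N +>\<^bsub>?F\<^esub> g) \<ominus>\<^bsub>?F\<^esub> g \<in> ?N"
      using quotient_coset_diff[OF q g] by blast+
    have "val (?N +>\<^bsub>?F\<^esub> g) - lin_val \<theta> g \<approx> lin_val \<theta> ((SOME h. h \<in> ?N +>\<^bsub>?F\<^esub> g) \<ominus>\<^bsub>?F\<^esub> g)"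
      unfolding val_def by (intro cong_sym[OF lin_val_minus] h g)
    also have "\<dots> \<approx> 0" using N h by blast
    finally show ?thesis by (simp add: cong_mod_def)
  qed
  have rep_ex: "\<exists>g\<in>carrier ?F. A = ?N +>\<^bsub>?F\<^esub> g" if "A \<in> carrier (presented_module R X Rel)" for A
    using that quotient_module_carrier[OF q] by (simp add: presented_module_def)
  show thesis
  proof (rule that[of val])
    fix x assume "x \<in> X"
    then have "val (presented_gen R X Rel x) \<approx> lin_val \<theta> (free_gen R x)"
      unfolding presented_gen_def by (intro val free_gen_closed)
    also have "\<dots> \<approx> \<theta> x" by (rule lin_val_gen)
    finally show "val (presented_gen R X Rel x) \<approx> \<theta> x" .
  next
    fix A B assume "A \<in> carrier (presented_module R X Rel)" "B \<in> carrier (presented_module R X Rel)"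
    then obtain f g where fg: "f \<in> carrier ?F" "A = ?N +>\<^bsub>?F\<^esub> f" "g \<in> carrier ?F" "B = ?N +>\<^bsub>?F\<^esub> g"
      using rep_ex by meson
    have "A \<oplus>\<^bsub>presented_module R X Rel\<^esub> B = ?N +>\<^bsub>?F\<^esub> (f \<oplus>\<^bsub>?F\<^esub> g)"
      unfolding fg presented_module_def by (rule quotient_module_add[OF q fg(1,3)])
    then have "val (A \<oplus>\<^bsub>presented_module R X Rel\<^esub> B) \<approx> lin_val \<theta> (\<lambda>x. f x \<oplus> g x)"
      using val[OF free_module_add_closed[OF fg(1,3)]] by simp
    also have "\<dots> \<approx> lin_val \<theta> f + lin_val \<theta> g" by (rule lin_val_add[OF fg(1,3)])
    also have "\<dots> \<approx> val A + val B" unfolding fg by (intro cong_add cong_sym[OF val] fg)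
    finally show "val (A \<oplus>\<^bsub>presented_module R X Rel\<^esub> B) \<approx> val A + val B" .
  next
    fix r A assume r: "r \<in> carrier R" and "A \<in> carrier (presented_module R X Rel)"
    then obtain f where f: "f \<in> carrier ?F" "A = ?N +>\<^bsub>?F\<^esub> f"
      using rep_ex by meson
    have "r \<odot>\<^bsub>presented_module R X Rel\<^esub> A = ?N +>\<^bsub>?F\<^esub> (r \<odot>\<^bsub>?F\<^esub> f)"
      unfolding f presented_module_def by (rule quotient_module_smult[OF q r f(1)])
    then have "val (r \<odot>\<^bsub>presented_module R X Rel\<^esub> A) \<approx> lin_val \<theta> (\<lambda>x. r \<otimes> f x)"
      using val[OF free_module_smult_closed[OF r f(1)]] by simp
    also have "\<dots> \<approx> rep r * lin_val \<theta> f" by (rule lin_val_smult[OF r f(1)])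
    also have "\<dots> \<approx> rep r * val A" unfolding f by (intro cong_mult cong_refl cong_sym[OF val] f)
    finally show "val (r \<odot>\<^bsub>presented_module R X Rel\<^esub> A) \<approx> rep r * val A" .
  qed
qed

end

section \<open>Dimensions after restriction of scalars\<close>

lemma restrict_scalars_simps [simp]:
  "carrier (restrict_scalars \<phi> M) = carrier M" "\<zero>\<^bsub>restrict_scalars \<phi> M\<^esub> = \<zero>\<^bsub>M\<^esub>"
  "v \<oplus>\<^bsub>restrict_scalars \<phi> M\<^esub> w = v \<oplus>\<^bsub>M\<^esub> w" "c \<odot>\<^bsub>restrict_scalars \<phi> M\<^esub> v = \<phi> c \<odot>\<^bsub>M\<^esub> v"
  by (simp_all add: restrict_scalars_def)

locale scalar_restriction = Module.module R M for R :: "('r, 'q) ring_scheme" (structure) and M :: "('r, 'm, 'p) module_scheme" +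
  fixes \<phi> :: "'k::field \<Rightarrow> 'r"
  assumes scalar_closed [simp]: "\<phi> c \<in> carrier R" and scalar_add: "\<phi> (c + d) = \<phi> c \<oplus> \<phi> d"
    and scalar_mult: "\<phi> (c * d) = \<phi> c \<otimes> \<phi> d" and scalar_one: "\<phi> 1 = \<one>"
begin

abbreviation "MK \<equiv> restrict_scalars \<phi> M"

lemma restrict_module: "Module.module class_ring MK"
proof (rule module_criteria; (intro allI impI ballI)?)
  show "cring (class_ring :: 'k ring)"
    using class_field[where 'a = 'k] by (simp add: field_def domain_def)
  show "\<exists>w\<in>carrier MK. v \<oplus>\<^bsub>MK\<^esub> w = \<zero>\<^bsub>MK\<^esub>" if "v \<in> carrier MK" for v
    using that by (intro bexI[of _ "\<ominus>\<^bsub>M\<^esub> v"]) (auto simp: M.r_neg)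
qed (auto simp: M.a_ac scalar_add scalar_mult scalar_one smult_assoc1 smult_l_distr smult_r_distr)

lemma restrict_vectorspace: "vectorspace class_ring MK"
  using restrict_module class_field by (simp add: vectorspace_def)

sublocale K: vectorspace class_ring MK
  by (rule restrict_vectorspace)

lemma span_over_eq: "span_over \<phi> M A = K.span A"
  by (simp add: span_over_def)

lemma span_over_submodule: "A \<subseteq> carrier M \<Longrightarrow> submodule class_ring (span_over \<phi> M A) MK"
  unfolding span_over_eq by (rule K.span_is_submodule) simp

lemma span_over_superset: "A \<subseteq> carrier M \<Longrightarrow> x \<in> A \<Longrightarrow> x \<in> span_over \<phi> M A"
  unfolding span_over_eq using K.in_own_span[of A] by auto

lemma span_over_closed: "A \<subseteq> carrier M \<Longrightarrow> x \<in> span_over \<phi> M A \<Longrightarrow> x \<in> carrier M"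
  using submodule.subset[OF span_over_submodule] by auto

lemma span_over_zero: "A \<subseteq> carrier M \<Longrightarrow> \<zero>\<^bsub>M\<^esub> \<in> span_over \<phi> M A"
  using submodule.zero_closed[OF span_over_submodule] by simp

lemma span_over_add:
  "A \<subseteq> carrier M \<Longrightarrow> x \<in> span_over \<phi> M A \<Longrightarrow> y \<in> span_over \<phi> M A \<Longrightarrow> x \<oplus>\<^bsub>M\<^esub> y \<in> span_over \<phi> M A"
  using submodule.m_closed[OF span_over_submodule, of A x y] by simp

lemma span_over_smult:
  "A \<subseteq> carrier M \<Longrightarrow> x \<in> span_over \<phi> M A \<Longrightarrow> \<phi> c \<odot>\<^bsub>M\<^esub> x \<in> span_over \<phi> M A"
  using submodule.smult_closed[OF span_over_submodule, of A c x] by simp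

lemma scalar_zero: "\<phi> 0 = \<zero>"
  using scalar_add[of 0 0] R.add.r_cancel_one'[of "\<phi> 0" "\<phi> 0"] by simp

lemma span_over_uminus:
  assumes "A \<subseteq> carrier M" and "x \<in> span_over \<phi> M A" shows "\<ominus>\<^bsub>M\<^esub> x \<in> span_over \<phi> M A"
proof -
  have x: "x \<in> carrier M" using assms by (rule span_over_closed)
  have "\<phi> (- 1) \<oplus> \<one> = \<zero>"
    using scalar_add[of "- 1" 1] by (simp add: scalar_one scalar_zero)
  then have "\<phi> (- 1) \<odot>\<^bsub>M\<^esub> x \<oplus>\<^bsub>M\<^esub> x = \<zero>\<^bsub>M\<^esub>"
    using x smult_l_distr[of "\<phi> (- 1)" \<one> x] by simp
  then have "\<ominus>\<^bsub>M\<^esub> x = \<phi> (- 1) \<odot>\<^bsub>M\<^esub> x"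
    using x by (intro M.minus_equality) auto
  then show ?thesis using span_over_smult[OF assms] by simp
qed

text \<open>Serves as induction over a span, with \<open>T\<close> the set of vectors having the
  property in question.\<close>

lemma span_over_minimal:
  assumes "A \<subseteq> T" "T \<subseteq> carrier M" "\<zero>\<^bsub>M\<^esub> \<in> T" "\<And>x y. x \<in> T \<Longrightarrow> y \<in> T \<Longrightarrow> x \<oplus>\<^bsub>M\<^esub> y \<in> T"
    "\<And>c x. x \<in> T \<Longrightarrow> \<phi> c \<odot>\<^bsub>M\<^esub> x \<in> T"
  shows "span_over \<phi> M A \<subseteq> T"
proof -
  have "submodule class_ring T MK"
    using assms by unfold_locales auto
  then show ?thesis unfolding span_over_eq by (rule K.span_is_subset[OF assms(1)])
qed

lemma span_over_subset: "A \<subseteq> span_over \<phi> M B \<Longrightarrow> B \<subseteq> carrier M \<Longrightarrow> span_over \<phi> M A \<subseteq> span_over \<phi> M B"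
  by (rule span_over_minimal)
    (auto intro: span_over_zero span_over_add span_over_smult dest: span_over_closed)

context
  fixes A assumes A: "A \<subseteq> carrier M" and fin: "finite A"
begin

interpretation S: vectorspace class_ring "MK\<lparr>carrier := span_over \<phi> M A\<rparr>"
  by (rule K.subspace_is_vs) (simp add: subspace_def K.vectorspace_axioms span_over_submodule[OF A])

text \<open>Dimensions are taken in the span as a space of its own, whereas spans are formed inside
  all of \<open>MK\<close>; this reconciles the two.\<close>

lemma span_restrict: "B \<subseteq> span_over \<phi> M A \<Longrightarrow> S.span B = span_over \<phi> M B"
  using K.span_li_not_depend(1)[OF _ span_over_submodule[OF A]] by (simp add: span_over_eq)

lemma span_generates: "S.gen_set A"
  using span_restrict[of A] span_over_superset[OF A] by auto

lemma span_over_fin_dim: "S.fin_dim"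
  unfolding S.fin_dim_def using fin span_generates span_over_superset[OF A]
  by (intro exI[of _ A]) auto

lemma dim_over_span_le: "dim_over \<phi> M (span_over \<phi> M A) \<le> card A"
  unfolding dim_over_def
  by (rule S.gen_ge_dim[OF fin _ span_generates]) (use span_over_superset[OF A] in auto)

lemma dim_over_basis:
  obtains B where "finite B" "B \<subseteq> span_over \<phi> M A" "card B = dim_over \<phi> M (span_over \<phi> M A)"
    "span_over \<phi> M B = span_over \<phi> M A"
proof -
  obtain B where B: "finite B" "S.basis B" using S.finite_basis_exists[OF span_over_fin_dim] by blast
  have sub: "B \<subseteq> span_over \<phi> M A" using B by (simp add: S.basis_def)
  show ?thesis
  proof (rule that[of B])
    show "card B = dim_over \<phi> M (span_over \<phi> M A)"
      unfolding dim_over_def by (rule S.dim_basis[symmetric]) (use B in auto)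
    show "span_over \<phi> M B = span_over \<phi> M A"
      using span_restrict[OF sub] B by (simp add: S.basis_def)
  qed (use B sub in auto)
qed

text \<open>Dual functionals recover each coefficient of a linear combination of the
  \<open>x i\<close>, which forces independence. They are assumed linear on all of \<open>M\<close>
  because they will come from maps defined on the whole module.\<close>

lemma dim_over_ge:
  fixes x :: "'i \<Rightarrow> 'm" and \<Lambda> :: "'i \<Rightarrow> 'm \<Rightarrow> 'k"
  assumes fin_I: "finite I" and x: "\<And>i. i \<in> I \<Longrightarrow> x i \<in> span_over \<phi> M A"
    and add: "\<And>i v w. i \<in> I \<Longrightarrow> v \<in> carrier M \<Longrightarrow> w \<in> carrier M \<Longrightarrow> \<Lambda> i (v \<oplus>\<^bsub>M\<^esub> w) = \<Lambda> i v + \<Lambda> i w"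
    and smult: "\<And>i c v. i \<in> I \<Longrightarrow> v \<in> carrier M \<Longrightarrow> \<Lambda> i (\<phi> c \<odot>\<^bsub>M\<^esub> v) = c * \<Lambda> i v"
    and dual: "\<And>i j. i \<in> I \<Longrightarrow> j \<in> I \<Longrightarrow> \<Lambda> i (x j) = (if i = j then 1 else 0)"
  shows "card I \<le> dim_over \<phi> M (span_over \<phi> M A)"
proof -
  \<comment> \<open>Independence concerns the set of vectors; injectivity keeps its size equal to
    that of \<open>I\<close>.\<close>
  have inj: "inj_on x I"
  proof (rule inj_onI, rule ccontr)
    fix i j assume ij: "i \<in> I" "j \<in> I" "x i = x j" "i \<noteq> j"
    then show False using dual[of i i] dual[of i j] by simp
  qed
  have xM: "x ` I \<subseteq> carrier M" using x span_over_closed[OF A] by auto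
  have "K.lin_indpt (x ` I)"
  proof (rule K.finite_lin_indpt2; (intro ballI)?)
    fix a v assume "K.lincomb a (x ` I) = \<zero>\<^bsub>MK\<^esub>" "v \<in> x ` I"
    then obtain i where i: "i \<in> I" "v = x i" by auto
    have zero: "\<Lambda> i \<zero>\<^bsub>M\<^esub> = 0" using smult[OF i(1) M.zero_closed, of 0] by (simp add: smult_r_null)
    have "\<Lambda> i (K.lincomb a S) = (\<Sum>w\<in>S. a w * \<Lambda> i w)" if "finite S" "S \<subseteq> carrier M" for S
      using that
    proof (induction S rule: finite_induct)
      case empty
      then show ?case by (simp add: K.lincomb_def zero)
    next
      case (insert w S)
      have "K.lincomb a (insert w S) = a w \<odot>\<^bsub>MK\<^esub> w \<oplus>\<^bsub>MK\<^esub> K.lincomb a S"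
        unfolding K.lincomb_def using insert by (intro K.M.finsum_insert) auto
      moreover have "K.lincomb a S \<in> carrier M"
        using K.lincomb_closed[of S a] insert by auto
      ultimately show ?case
        using insert add[OF i(1)] smult[OF i(1)] by simp
    qed
    from this[of "x ` I"] have "\<Lambda> i (K.lincomb a (x ` I)) = (\<Sum>j\<in>I. a (x j) * \<Lambda> i (x j))"
      using fin_I xM inj by (simp add: sum.reindex)
    also have "\<dots> = (\<Sum>j\<in>I. if j = i then a (x j) else 0)"
      using dual[OF i(1)] by (intro sum.cong) auto
    finally have "\<Lambda> i (K.lincomb a (x ` I)) = a v" using fin_I i by simp
    then show "a v = \<zero>\<^bsub>class_ring\<^esub>" using \<open>K.lincomb a (x ` I) = _\<close> zero by simp
  qed (use fin_I xM in auto)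
  then have "S.lin_indpt (x ` I)"
    using K.span_li_not_depend(2)[OF _ span_over_submodule[OF A], of "x ` I"] x by auto
  then have "card (x ` I) \<le> S.dim"
    using x by (intro S.li_le_dim(2)[OF span_over_fin_dim]) auto
  then show ?thesis using inj by (simp add: card_image dim_over_def)
qed

end

end

section \<open>Exterior powers\<close>

locale exterior = Module.module R M for R :: "('r, 'q) ring_scheme" (structure) and M :: "('r, 'm, 'p) module_scheme" +
  fixes m :: nat
begin

abbreviation "E \<equiv> ext_power m R M"
abbreviation "L \<equiv> ext_lists m M"
abbreviation "FL \<equiv> free_module R L"

interpretation F: Module.module R FL by (rule free_module_module)

lemma ext_lists_update: "ws \<in> L \<Longrightarrow> v \<in> carrier M \<Longrightarrow> ws[i := v] \<in> L"
  using set_update_subset_insert[of ws i v] by (auto simp: ext_lists_def)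

lemma ext_rels_carrier: "ext_rels m R M \<subseteq> carrier FL"
  unfolding ext_rels_def Let_def
  by (auto simp del: free_module_simps intro!: F.M.minus_closed F.M.a_closed F.smult_closed free_gen_closed ext_lists_update
      M.a_closed smult_closed)

lemma ext_power_module: "Module.module R E"
  unfolding ext_power_def by (rule presented_module_module[OF is_cring ext_rels_carrier])

sublocale E: Module.module R E
  by (rule ext_power_module)

lemma wedge_closed: "ws \<in> L \<Longrightarrow> wedge m R M ws \<in> carrier E"
  unfolding wedge_def ext_power_def by (rule presented_gen_closed[OF is_cring ext_rels_carrier])

context
begin

private abbreviation "N \<equiv> rel_submodule R L (ext_rels m R M)"

private lemmas q = F.module_axioms presented_span_submodule[OF is_cring ext_rels_carrier]

private lemma wedge_eq: "wedge m R M ws = N +>\<^bsub>FL\<^esub> free_gen R ws"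
  by (simp add: wedge_def presented_gen_def)

private lemma E_eq: "E = quotient_module FL N"
  by (simp add: ext_power_def presented_module_def)

private lemma rel_coset_eq:
  "f \<in> carrier FL \<Longrightarrow> g \<in> carrier FL \<Longrightarrow> f \<ominus>\<^bsub>FL\<^esub> g \<in> ext_rels m R M \<Longrightarrow> N +>\<^bsub>FL\<^esub> f = N +>\<^bsub>FL\<^esub> g"
  by (rule quotient_coset_eqI[OF q _ _ presented_rel_mem[OF is_cring ext_rels_carrier]])

lemma wedge_update_add:
  assumes "ws \<in> L" "i < m" "v \<in> carrier M" "w \<in> carrier M"
  shows "wedge m R M (ws[i := v \<oplus>\<^bsub>M\<^esub> w]) = wedge m R M (ws[i := v]) \<oplus>\<^bsub>E\<^esub> wedge m R M (ws[i := w])"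
proof -
  have c: "free_gen R (ws[i := u]) \<in> carrier FL" if "u \<in> carrier M" for u
    using assms that by (intro free_gen_closed ext_lists_update)
  have "N +>\<^bsub>FL\<^esub> free_gen R (ws[i := v \<oplus>\<^bsub>M\<^esub> w]) =
      N +>\<^bsub>FL\<^esub> (free_gen R (ws[i := v]) \<oplus>\<^bsub>FL\<^esub> free_gen R (ws[i := w]))"
  proof (rule rel_coset_eq)
    show "free_gen R (ws[i := v \<oplus>\<^bsub>M\<^esub> w]) \<ominus>\<^bsub>FL\<^esub> (free_gen R (ws[i := v]) \<oplus>\<^bsub>FL\<^esub> free_gen R (ws[i := w])) \<in> ext_rels m R M"
      unfolding ext_rels_def Let_def using assms by blast
  qed (use assms c in \<open>auto simp del: free_module_simps\<close>)
  then show ?thesis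
    unfolding wedge_eq E_eq using assms by (simp only: quotient_module_add[OF q c c])
qed

lemma wedge_update_smult:
  assumes "ws \<in> L" "i < m" "r \<in> carrier R" "v \<in> carrier M"
  shows "wedge m R M (ws[i := r \<odot>\<^bsub>M\<^esub> v]) = r \<odot>\<^bsub>E\<^esub> wedge m R M (ws[i := v])"
proof -
  have c: "free_gen R (ws[i := u]) \<in> carrier FL" if "u \<in> carrier M" for u
    using assms that by (intro free_gen_closed ext_lists_update)
  have "N +>\<^bsub>FL\<^esub> free_gen R (ws[i := r \<odot>\<^bsub>M\<^esub> v]) = N +>\<^bsub>FL\<^esub> (r \<odot>\<^bsub>FL\<^esub> free_gen R (ws[i := v]))"
  proof (rule rel_coset_eq)
    show "free_gen R (ws[i := r \<odot>\<^bsub>M\<^esub> v]) \<ominus>\<^bsub>FL\<^esub> r \<odot>\<^bsub>FL\<^esub> free_gen R (ws[i := v]) \<in> ext_rels m R M"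
      unfolding ext_rels_def Let_def using assms by blast
  qed (use assms c in \<open>auto simp del: free_module_simps\<close>)
  then show ?thesis
    unfolding wedge_eq E_eq using assms by (simp only: quotient_module_smult[OF q _ c])
qed

lemma wedge_not_distinct:
  assumes "ws \<in> L" "\<not> distinct ws" shows "wedge m R M ws = \<zero>\<^bsub>E\<^esub>"
proof -
  have c: "free_gen R ws \<in> carrier FL" using assms by (intro free_gen_closed)
  have "free_gen R ws \<in> ext_rels m R M"
    unfolding ext_rels_def Let_def using assms by blast
  moreover have "free_gen R ws \<ominus>\<^bsub>FL\<^esub> \<zero>\<^bsub>FL\<^esub> = free_gen R ws"
    using c unfolding free_module_minus[OF c F.M.zero_closed]
    by (simp add: free_module_carrier fun_eq_iff)
  ultimately have "N +>\<^bsub>FL\<^esub> free_gen R ws = N +>\<^bsub>FL\<^esub> \<zero>\<^bsub>FL\<^esub>"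
    using c by (intro rel_coset_eq) (simp_all del: free_module_simps)
  then show ?thesis unfolding wedge_eq E_eq quotient_module_zero[OF q] .
qed

end

context
  fixes pre post :: "'m list"
  assumes len: "length pre + length post + 1 = m" and sub: "set pre \<subseteq> carrier M" "set post \<subseteq> carrier M"
begin

lemma wedge_app_mem: "v \<in> carrier M \<Longrightarrow> pre @ v # post \<in> L"
  using len sub by (auto simp: ext_lists_def)

lemma wedge_app_closed: "v \<in> carrier M \<Longrightarrow> wedge m R M (pre @ v # post) \<in> carrier E"
  by (rule wedge_closed[OF wedge_app_mem])

lemma wedge_app_add:
  assumes "v \<in> carrier M" "w \<in> carrier M"
  shows "wedge m R M (pre @ (v \<oplus>\<^bsub>M\<^esub> w) # post) = wedge m R M (pre @ v # post) \<oplus>\<^bsub>E\<^esub> wedge m R M (pre @ w # post)"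
  using wedge_update_add[OF wedge_app_mem[OF assms(1)], of "length pre" v w] len assms by simp

lemma wedge_app_smult:
  assumes "r \<in> carrier R" "v \<in> carrier M"
  shows "wedge m R M (pre @ (r \<odot>\<^bsub>M\<^esub> v) # post) = r \<odot>\<^bsub>E\<^esub> wedge m R M (pre @ v # post)"
  using wedge_update_smult[OF wedge_app_mem[OF assms(2)], of "length pre" r v] len assms by simp

lemma wedge_app_zero: "wedge m R M (pre @ \<zero>\<^bsub>M\<^esub> # post) = \<zero>\<^bsub>E\<^esub>"
  using wedge_app_smult[of \<zero> "\<zero>\<^bsub>M\<^esub>"] wedge_app_closed[of "\<zero>\<^bsub>M\<^esub>"] by simp

end

text \<open>The relations only demand vanishing on repeated entries; antisymmetry comes from
  expanding the wedge with \<open>a + b\<close> in both slots.\<close>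

lemma wedge_swap:
  assumes "length pre + length post + 2 = m" "set pre \<subseteq> carrier M" "set post \<subseteq> carrier M"
    and a: "a \<in> carrier M" and b: "b \<in> carrier M"
  shows "wedge m R M (pre @ a # b # post) = \<ominus>\<^bsub>E\<^esub> wedge m R M (pre @ b # a # post)"
proof -
  have 1: "wedge m R M (pre @ (x \<oplus>\<^bsub>M\<^esub> y) # z # post) = wedge m R M (pre @ x # z # post) \<oplus>\<^bsub>E\<^esub> wedge m R M (pre @ y # z # post)"
    if "x \<in> carrier M" "y \<in> carrier M" "z \<in> carrier M" for x y z
    using assms that by (intro wedge_app_add) auto
  have 2: "wedge m R M (pre @ z # (x \<oplus>\<^bsub>M\<^esub> y) # post) = wedge m R M (pre @ z # x # post) \<oplus>\<^bsub>E\<^esub> wedge m R M (pre @ z # y # post)"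
    if "x \<in> carrier M" "y \<in> carrier M" "z \<in> carrier M" for x y z
    using wedge_app_add[of "pre @ [z]" post x y] assms that by simp
  have L: "pre @ x # y # post \<in> L" if "x \<in> carrier M" "y \<in> carrier M" for x y
    using that assms by (auto simp: ext_lists_def)
  have 0: "wedge m R M (pre @ x # x # post) = \<zero>\<^bsub>E\<^esub>" if "x \<in> carrier M" for x
    using that by (intro wedge_not_distinct L) auto
  note c = wedge_closed[OF L]
  have "\<zero>\<^bsub>E\<^esub> = wedge m R M (pre @ (a \<oplus>\<^bsub>M\<^esub> b) # (a \<oplus>\<^bsub>M\<^esub> b) # post)"
    using a b 0 by simp
  also have "\<dots> = wedge m R M (pre @ a # b # post) \<oplus>\<^bsub>E\<^esub> wedge m R M (pre @ b # a # post)"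
    using a b c by (simp add: 1 2 0[OF a] 0[OF b] E.M.a_comm)
  finally show ?thesis
    using E.M.minus_equality[of "wedge m R M (pre @ a # b # post)" "wedge m R M (pre @ b # a # post)"] a b c by simp
qed

context
  fixes T and r and I and g :: "'i::linorder \<Rightarrow> 'm"
  assumes T: "\<And>x. x \<in> T \<Longrightarrow> \<ominus>\<^bsub>E\<^esub> x \<in> T" and r: "r \<in> carrier R" and g: "\<And>i. i \<in> I \<Longrightarrow> g i \<in> carrier M"
begin

text \<open>Insertion is a sequence of adjacent transpositions, each changing only the sign, and
  \<open>T\<close> is closed under negation. The prefix grows as \<open>x\<close> passes smaller
  entries.\<close>

lemma wedge_insort:
  assumes "r \<odot>\<^bsub>E\<^esub> wedge m R M (map g (pre @ insort x xs)) \<in> T"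
    "length pre + length xs + 1 = m" "set pre \<subseteq> I" "set xs \<subseteq> I" "x \<in> I"
  shows "r \<odot>\<^bsub>E\<^esub> wedge m R M (map g (pre @ x # xs)) \<in> T"
  using assms
proof (induction xs arbitrary: pre)
  case (Cons y ys)
  show ?case
  proof (cases "x \<le> y")
    case False
    have L: "map g (pre @ y # x # ys) \<in> L"
      using Cons.prems g by (auto simp: ext_lists_def)
    have "r \<odot>\<^bsub>E\<^esub> wedge m R M (map g ((pre @ [y]) @ x # ys)) \<in> T"
      by (rule Cons.IH) (use Cons.prems False in auto)
    then have "\<ominus>\<^bsub>E\<^esub> (r \<odot>\<^bsub>E\<^esub> wedge m R M (map g pre @ g y # g x # map g ys)) \<in> T"
      using T by simp
    moreover have "wedge m R M (map g pre @ g x # g y # map g ys) = \<ominus>\<^bsub>E\<^esub> wedge m R M (map g pre @ g y # g x # map g ys)"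
      using Cons.prems g by (intro wedge_swap) auto
    ultimately show ?thesis
      using r wedge_closed[OF L] by (simp add: E.smult_r_minus)
  qed (use Cons.prems in simp)
qed simp

text \<open>Membership travels from the sorted list back to the given one: undoing one insertion
  brings the head to the front, where it joins \<open>pre\<close>.\<close>

lemma wedge_sort:
  assumes "r \<odot>\<^bsub>E\<^esub> wedge m R M (map g (pre @ sort xs)) \<in> T"
    "length pre + length xs = m" "set pre \<subseteq> I" "set xs \<subseteq> I"
  shows "r \<odot>\<^bsub>E\<^esub> wedge m R M (map g (pre @ xs)) \<in> T"
  using assms
proof (induction xs arbitrary: pre)
  case (Cons x xs)
  have "r \<odot>\<^bsub>E\<^esub> wedge m R M (map g (pre @ x # sort xs)) \<in> T"
    by (rule wedge_insort) (use Cons.prems in auto)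
  then have "r \<odot>\<^bsub>E\<^esub> wedge m R M (map g ((pre @ [x]) @ xs)) \<in> T"
    by (intro Cons.IH) (use Cons.prems in auto)
  then show ?case by simp
qed simp

end

end

section \<open>Differentials\<close>

lemma kaehler_rels_carrier:
  assumes "cring R" and "C \<subseteq> carrier R" shows "kaehler_rels C R \<subseteq> carrier (free_module R (carrier R))"
proof -
  interpret cring R by (rule assms)
  interpret F: Module.module R "free_module R (carrier R)" by (rule free_module_module)
  show ?thesis
    unfolding kaehler_rels_def Let_def using assms(2)
    by (auto simp del: free_module_simps intro!: F.M.minus_closed F.M.a_closed F.smult_closed free_gen_closed)
qed

lemma kaehler_module:
  assumes "cring R" and "C \<subseteq> carrier R" shows "Module.module R (kaehler C R)"
  unfolding kaehler_def by (rule presented_module_module[OF assms(1) kaehler_rels_carrier[OF assms]])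

lemma univ_deriv_closed:
  assumes "cring R" and "C \<subseteq> carrier R" and "a \<in> carrier R"
  shows "univ_deriv C R a \<in> carrier (kaehler C R)"
  unfolding kaehler_def univ_deriv_def
  by (rule presented_gen_closed[OF assms(1) kaehler_rels_carrier[OF assms(1,2)] assms(3)])

section \<open>The graded pieces of the exterior powers of the differentials\<close>

lemma scalar_restriction_coord:
  assumes "Module.module (coord_ring n I) M" and I: "ideal I (mpoly_ring n)"
  shows "scalar_restriction (coord_ring n I) M (coord_const n I)"
proof -
  interpret I: ideal I "mpoly_ring n" by (rule I)
  have hom: "coord_class n I \<in> Ring.ring_hom (mpoly_ring n) (coord_ring n I)"
    using I.rcos_ring_hom by (simp add: coord_class_def[abs_def])
  show ?thesis
  proof (rule scalar_restriction.intro[OF assms(1)], unfold_locales)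
    fix c d
    show "coord_const n I c \<in> carrier (coord_ring n I)"
      using ring_hom_closed[OF hom] by (simp add: coord_const_def)
    show "coord_const n I (c + d) = coord_const n I c \<oplus>\<^bsub>coord_ring n I\<^esub> coord_const n I d"
      using ring_hom_add[OF hom, of "mpoly_const c" "mpoly_const d"] by (simp add: coord_const_def mpoly_const_add)
    show "coord_const n I (c * d) = coord_const n I c \<otimes>\<^bsub>coord_ring n I\<^esub> coord_const n I d"
      using ring_hom_mult[OF hom, of "mpoly_const c" "mpoly_const d"] by (simp add: coord_const_def mpoly_const_mult)
    show "coord_const n I 1 = \<one>\<^bsub>coord_ring n I\<^esub>"
      using ring_hom_one[OF hom] by (simp add: coord_const_def)
  qed
qed

section \<open>Coordinate ring and differentials of a fat point scheme\<close>

context fat_points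
begin

abbreviation "R \<equiv> coord_ring n W"
abbreviation "cls \<equiv> coord_class n W"
abbreviation "\<kappa> \<equiv> coord_const n W"

lemma R_cring: "cring R"
proof -
  interpret W: ideal W "mpoly_ring n" by (rule ideal_W)
  show ?thesis by (rule W.quotient_is_cring[OF mpoly_cring])
qed

lemma cls_hom: "cls \<in> Ring.ring_hom (mpoly_ring n) R"
proof -
  interpret W: ideal W "mpoly_ring n" by (rule ideal_W)
  show ?thesis using W.rcos_ring_hom by (simp add: coord_class_def[abs_def])
qed

lemma cls_closed: "f \<in> carrier (mpoly_ring n) \<Longrightarrow> cls f \<in> carrier R"
  by (rule ring_hom_closed[OF cls_hom])

lemma cls_add: "f \<in> carrier (mpoly_ring n) \<Longrightarrow> g \<in> carrier (mpoly_ring n) \<Longrightarrow> cls (f + g) = cls f \<oplus>\<^bsub>R\<^esub> cls g"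
  using ring_hom_add[OF cls_hom] by simp

lemma cls_mult: "f \<in> carrier (mpoly_ring n) \<Longrightarrow> g \<in> carrier (mpoly_ring n) \<Longrightarrow> cls (f * g) = cls f \<otimes>\<^bsub>R\<^esub> cls g"
  using ring_hom_mult[OF cls_hom] by simp

lemma cls_one: "cls 1 = \<one>\<^bsub>R\<^esub>"
  using ring_hom_one[OF cls_hom] by simp

lemma cls_eqI:
  assumes "f \<in> carrier (mpoly_ring n)" "g \<in> carrier (mpoly_ring n)" "f - g \<in> W" shows "cls f = cls g"
proof -
  interpret W: ideal W "mpoly_ring n" by (rule ideal_W)
  interpret S: cring "mpoly_ring n :: 'k mpoly ring" by (rule mpoly_cring)
  have "f \<in> W +>\<^bsub>mpoly_ring n\<^esub> g"
    using assms by (intro W.a_rcos_module_rev) auto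
  then show ?thesis unfolding coord_class_def by (rule W.a_repr_independence'[symmetric, OF _ assms(2)])
qed

text \<open>A chosen polynomial in each residue class, determined only modulo \<open>W\<close>; it
  later plays the part of \<open>rep\<close> for values modulo \<open>V\<close>.\<close>

definition lift :: "'k mpoly set \<Rightarrow> 'k mpoly"
  where "lift r = (SOME f. f \<in> carrier (mpoly_ring n) \<and> cls f = r)"

lemma lift:
  assumes "r \<in> carrier R" shows "lift r \<in> carrier (mpoly_ring n)" and "cls (lift r) = r"
proof -
  have "\<exists>f. f \<in> carrier (mpoly_ring n) \<and> cls f = r"
    using assms by (auto simp: FactRing_def A_RCOSETS_def' coord_class_def)
  then have "lift r \<in> carrier (mpoly_ring n) \<and> cls (lift r) = r"
    unfolding lift_def by (rule someI_ex)
  then show "lift r \<in> carrier (mpoly_ring n)" and "cls (lift r) = r" by auto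
qed

lemma lift_cls:
  assumes f: "f \<in> carrier (mpoly_ring n)" shows "lift (cls f) - f \<in> W"
proof -
  interpret W: ideal W "mpoly_ring n" by (rule ideal_W)
  note l = lift[OF cls_closed[OF f]]
  have "lift (cls f) \<in> W +>\<^bsub>mpoly_ring n\<^esub> f"
    using W.a_rcos_self[OF l(1)] l(2) by (simp add: coord_class_def)
  then show ?thesis using W.a_rcos_module_imp[OF f] f by simp
qed

lemma range_const: "range \<kappa> \<subseteq> carrier R"
  using cls_closed by (auto simp: coord_const_def)

abbreviation "\<Omega>\<^sub>1 \<equiv> Omega1 n W"
abbreviation "dx \<equiv> dX n W"

lemma Omega1_module: "Module.module R \<Omega>\<^sub>1"
  unfolding Omega1_def by (rule kaehler_module[OF R_cring range_const])

lemma dx_closed: "i \<le> n \<Longrightarrow> dx i \<in> carrier \<Omega>\<^sub>1"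
  unfolding Omega1_def dX_def by (rule univ_deriv_closed[OF R_cring range_const cls_closed]) simp

lemma coord_part_closed: "r \<in> coord_part n W d \<Longrightarrow> r \<in> carrier R"
  using cls_closed homogeneous_carrier by (auto simp: coord_part_def)

lemma coord_part_mult:
  assumes "r \<in> coord_part n W d" "r' \<in> coord_part n W e" shows "r \<otimes>\<^bsub>R\<^esub> r' \<in> coord_part n W (d + e)"
proof -
  from assms obtain f g where "r = cls f" "f \<in> homogeneous_part n d" "r' = cls g" "g \<in> homogeneous_part n e"
    by (auto simp: coord_part_def)
  then show ?thesis
    by (auto simp: coord_part_def cls_mult[symmetric] homogeneous_carrier intro: homogeneous_mult)
qed

sublocale \<Omega>1: scalar_restriction R \<Omega>\<^sub>1 \<kappa>
  by (rule scalar_restriction_coord[OF Omega1_module ideal_W])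

lemma Omega1_gens: "{r \<odot>\<^bsub>\<Omega>\<^sub>1\<^esub> dx i | r d i. r \<in> coord_part n W d \<and> i \<le> n \<and> d + 1 = e} \<subseteq> carrier \<Omega>\<^sub>1"
  using coord_part_closed dx_closed \<Omega>1.smult_closed by blast

lemma Omega1_part_closed: "w \<in> Omega1_part n W e \<Longrightarrow> w \<in> carrier \<Omega>\<^sub>1"
  unfolding Omega1_part_def using \<Omega>1.span_over_closed[OF Omega1_gens] by blast

lemma dx_Omega1_part: assumes "i \<le> n" shows "dx i \<in> Omega1_part n W 1"
proof -
  have "\<one>\<^bsub>R\<^esub> \<in> coord_part n W 0"
    unfolding cls_one[symmetric] coord_part_def by (rule imageI) simp
  moreover have "dx i = \<one>\<^bsub>R\<^esub> \<odot>\<^bsub>\<Omega>\<^sub>1\<^esub> dx i" using dx_closed[OF assms] by simp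
  ultimately have "dx i \<in> {r \<odot>\<^bsub>\<Omega>\<^sub>1\<^esub> dx i | r d i. r \<in> coord_part n W d \<and> i \<le> n \<and> d + 1 = 1}"
    using assms by auto
  then show ?thesis unfolding Omega1_part_def by (rule \<Omega>1.span_over_superset[OF Omega1_gens])
qed

end

section \<open>Exterior powers of the differentials and the standard wedges\<close>

locale fat_point_forms = fat_points n s P \<mu> for n s and P :: "nat \<Rightarrow> nat \<Rightarrow> 'k::field" and \<mu> +
  fixes m :: nat
begin

abbreviation "\<Omega> \<equiv> Omega m n W"
abbreviation "wdg \<equiv> wedge m R \<Omega>\<^sub>1"

sublocale ext: exterior R \<Omega>\<^sub>1 m
  by (rule exterior.intro[OF Omega1_module])

lemma Omega_eq: "\<Omega> = ext.E"
  by (simp add: Omega_def)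

sublocale \<Omega>m: scalar_restriction R \<Omega> \<kappa>
  unfolding Omega_eq by (rule scalar_restriction_coord[OF ext.ext_power_module ideal_W])

lemma wdg_closed: "ws \<in> ext.L \<Longrightarrow> wdg ws \<in> carrier \<Omega>"
  unfolding Omega_eq by (rule ext.wedge_closed)

definition indices :: "nat set set"
  where "indices = {J. J \<subseteq> {..n} \<and> card J = m}"

lemma finite_indices [simp]: "finite indices"
  by (simp add: indices_def)

lemma card_indices: "card indices = (n + 1) choose m"
  by (simp add: indices_def n_subsets)

lemma index_list:
  assumes "J \<in> indices"
  shows "set (sorted_list_of_set J) = J" "length (sorted_list_of_set J) = m" "finite J"
  using assms finite_subset[of J "{..n}"] by (auto simp: indices_def)

text \<open>Sorting selects one ordering of \<open>J\<close> and thereby a sign; the determinants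
  that detect \<open>dxJ J\<close> use the same ordering.\<close>

definition dxJ :: "nat set \<Rightarrow> (('k mpoly set \<Rightarrow> 'k mpoly set) set list \<Rightarrow> 'k mpoly set) set"
  where "dxJ J = wdg (map dx (sorted_list_of_set J))"

lemma dxJ_closed: "J \<in> indices \<Longrightarrow> dxJ J \<in> carrier \<Omega>"
proof -
  assume J: "J \<in> indices"
  then have "dx ` J \<subseteq> carrier \<Omega>\<^sub>1" using dx_closed by (auto simp: indices_def)
  then have "map dx (sorted_list_of_set J) \<in> ext.L"
    using index_list[OF J] by (simp add: ext_lists_def)
  then show ?thesis unfolding dxJ_def by (rule wdg_closed)
qed

definition gens :: "nat \<Rightarrow> (('k mpoly set \<Rightarrow> 'k mpoly set) set list \<Rightarrow> 'k mpoly set) set set"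
  where "gens z = {r \<odot>\<^bsub>\<Omega>\<^esub> dxJ J | r d J. r \<in> coord_part n W d \<and> J \<in> indices \<and> d + m = z}"

lemma gens_closed: "gens z \<subseteq> carrier \<Omega>"
  using coord_part_closed dxJ_closed \<Omega>m.smult_closed unfolding gens_def by blast

text \<open>Sorting the indices changes the wedge at most by a sign and leads into
  \<open>gens\<close>; a repeated index makes the wedge zero.\<close>

lemma index_word_in_span:
  assumes r: "r \<in> coord_part n W d" and "set ks \<subseteq> {..n}" "length ks = m" "d + m = z"
  shows "r \<odot>\<^bsub>\<Omega>\<^esub> wdg (map dx ks) \<in> span_over \<kappa> \<Omega> (gens z)"
proof (cases "distinct ks")
  case True
  have "r \<odot>\<^bsub>ext.E\<^esub> wdg (map dx ([] @ ks)) \<in> span_over \<kappa> \<Omega> (gens z)"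
  proof (rule ext.wedge_sort[where I = "{..n}"])
    show "\<ominus>\<^bsub>ext.E\<^esub> x \<in> span_over \<kappa> \<Omega> (gens z)" if "x \<in> span_over \<kappa> \<Omega> (gens z)" for x
      using \<Omega>m.span_over_uminus[OF gens_closed that] by (simp add: Omega_eq)
    have "sort ks = sorted_list_of_set (set ks)"
      using True by (simp add: sorted_list_of_set_sort_remdups distinct_remdups_id)
    moreover have "set ks \<in> indices" using assms True by (simp add: indices_def distinct_card)
    ultimately have "r \<odot>\<^bsub>\<Omega>\<^esub> wdg (map dx (sort ks)) \<in> gens z"
      using assms by (auto simp: gens_def dxJ_def)
    then show "r \<odot>\<^bsub>ext.E\<^esub> wdg (map dx ([] @ sort ks)) \<in> span_over \<kappa> \<Omega> (gens z)"
      using \<Omega>m.span_over_superset[OF gens_closed] by (simp add: Omega_eq)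
  qed (use assms coord_part_closed dx_closed in auto)
  then show ?thesis by (simp add: Omega_eq)
next
  case False
  have "map dx ks \<in> ext.L" using assms dx_closed by (auto simp: ext_lists_def)
  then have "wdg (map dx ks) = \<zero>\<^bsub>\<Omega>\<^esub>"
    unfolding Omega_eq using False by (intro ext.wedge_not_distinct) (auto simp: distinct_map)
  then show ?thesis
    using coord_part_closed[OF r] \<Omega>m.span_over_zero[OF gens_closed] by (simp add: \<Omega>m.smult_r_null)
qed

text \<open>The word is half reduced: \<open>ws\<close> still holds arbitrary homogeneous one-forms,
  \<open>ks\<close> records slots already brought to \<open>dx\<close>. Expanding the last form of
  \<open>ws\<close> moves its coefficient into \<open>r\<close> and its index to the front of
  \<open>ks\<close>, with total degree unchanged.\<close>

lemma word_in_span: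
  assumes "list_all2 (\<lambda>w e. w \<in> Omega1_part n W e) ws ds" "r \<in> coord_part n W d" "set ks \<subseteq> {..n}"
    "length ws + length ks = m" "d + sum_list ds + length ks = z"
  shows "r \<odot>\<^bsub>\<Omega>\<^esub> wdg (ws @ map dx ks) \<in> span_over \<kappa> \<Omega> (gens z)"
  using assms
proof (induction ws arbitrary: ds r d ks rule: rev_induct)
  case Nil
  then show ?case using index_word_in_span by simp
next
  case (snoc w ws)
  let ?S = "span_over \<kappa> \<Omega> (gens z)"
  from snoc.prems(1) obtain ds' e where ds: "ds = ds' @ [e]" "list_all2 (\<lambda>w e. w \<in> Omega1_part n W e) ws ds'"
    and w: "w \<in> Omega1_part n W e"
    by (auto simp: list_all2_append1 list_all2_Cons1)
  have ws: "set ws \<subseteq> carrier \<Omega>\<^sub>1"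
    using ds(2) by (induction rule: list_all2_induct) (auto intro: Omega1_part_closed)
  have post: "set (map dx ks) \<subseteq> carrier \<Omega>\<^sub>1" using snoc.prems(3) dx_closed by auto
  have len: "length ws + length (map dx ks) + 1 = m" using snoc.prems(4) by simp
  have r: "r \<in> carrier R" using snoc.prems(2) coord_part_closed by blast
  note app = ext.wedge_app_add[OF len ws post, folded Omega_eq] ext.wedge_app_smult[OF len ws post, folded Omega_eq]
    ext.wedge_app_zero[OF len ws post, folded Omega_eq] ext.wedge_app_closed[OF len ws post, folded Omega_eq]
  \<comment> \<open>This set is closed under sums and scalars, so only the spanning products
    \<open>r' dx_i\<close> of the graded piece have to be treated.\<close>
  let ?T = "{v \<in> carrier \<Omega>\<^sub>1. r \<odot>\<^bsub>\<Omega>\<^esub> wdg (ws @ v # map dx ks) \<in> ?S}"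
  have "Omega1_part n W e \<subseteq> ?T"
    unfolding Omega1_part_def
  proof (rule \<Omega>1.span_over_minimal)
    show "{r \<odot>\<^bsub>\<Omega>\<^sub>1\<^esub> dx i | r d i. r \<in> coord_part n W d \<and> i \<le> n \<and> d + 1 = e} \<subseteq> ?T"
    proof safe
      fix r' d' i assume r': "r' \<in> coord_part n W d'" and i: "i \<le> n" and e: "e = d' + 1"
      have r'R: "r' \<in> carrier R" using r' coord_part_closed by blast
      show "r' \<odot>\<^bsub>\<Omega>\<^sub>1\<^esub> dx i \<in> carrier \<Omega>\<^sub>1" using r'R dx_closed[OF i] by simp
      have "(r \<otimes>\<^bsub>R\<^esub> r') \<odot>\<^bsub>\<Omega>\<^esub> wdg (ws @ map dx (i # ks)) \<in> ?S"
        by (rule snoc.IH[OF ds(2) coord_part_mult[OF snoc.prems(2) r']]) (use snoc.prems ds i e in auto)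
      then show "r \<odot>\<^bsub>\<Omega>\<^esub> wdg (ws @ (r' \<odot>\<^bsub>\<Omega>\<^sub>1\<^esub> dx i) # map dx ks) \<in> ?S"
        using app r'R r dx_closed[OF i] by (simp add: \<Omega>m.smult_assoc1)
    qed
    show "\<zero>\<^bsub>\<Omega>\<^sub>1\<^esub> \<in> ?T" using app r \<Omega>m.span_over_zero[OF gens_closed] by (simp add: \<Omega>m.smult_r_null)
    show "x \<oplus>\<^bsub>\<Omega>\<^sub>1\<^esub> y \<in> ?T" if "x \<in> ?T" "y \<in> ?T" for x y
      using that app r \<Omega>m.span_over_add[OF gens_closed] by (simp add: \<Omega>m.smult_r_distr)
    show "\<kappa> c \<odot>\<^bsub>\<Omega>\<^sub>1\<^esub> x \<in> ?T" if "x \<in> ?T" for c x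
    proof -
      have x: "x \<in> carrier \<Omega>\<^sub>1" "r \<odot>\<^bsub>\<Omega>\<^esub> wdg (ws @ x # map dx ks) \<in> ?S" using that by auto
      have "r \<odot>\<^bsub>\<Omega>\<^esub> (\<kappa> c \<odot>\<^bsub>\<Omega>\<^esub> wdg (ws @ x # map dx ks)) = \<kappa> c \<odot>\<^bsub>\<Omega>\<^esub> (r \<odot>\<^bsub>\<Omega>\<^esub> wdg (ws @ x # map dx ks))"
        using app(4)[OF x(1)] r by (simp add: \<Omega>m.smult_assoc1[symmetric] \<Omega>1.m_comm)
      then show ?thesis
        using x app r \<Omega>m.span_over_smult[OF gens_closed x(2), of c] by simp
    qed
  qed auto
  then show ?case using w by auto
qed

text \<open>The definition admits wedges of arbitrary homogeneous one-forms; expanding every slot in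
  the \<open>dx i\<close> leaves the standard wedges, each of degree \<open>m\<close>.\<close>

lemma Omega_part_eq: "Omega_part m n W z = span_over \<kappa> \<Omega> (gens z)"
proof -
  let ?G = "{r \<odot>\<^bsub>\<Omega>\<^esub> wdg ws | r d ws ds. r \<in> coord_part n W d \<and> length ws = m \<and>
       list_all2 (\<lambda>w e. w \<in> Omega1_part n W e) ws ds \<and> d + sum_list ds = z}"
  have 1: "?G \<subseteq> span_over \<kappa> \<Omega> (gens z)"
    using word_in_span[where ks = "[]"] by auto
  have 2: "gens z \<subseteq> ?G"
  proof
    fix x assume "x \<in> gens z"
    then obtain r d J where x: "x = r \<odot>\<^bsub>\<Omega>\<^esub> dxJ J" "r \<in> coord_part n W d" "J \<in> indices" "d + m = z"
      by (auto simp: gens_def)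
    have "w \<in> Omega1_part n W 1" if "w \<in> set (map dx (sorted_list_of_set J))" for w
      using that dx_Omega1_part index_list(1)[OF x(3)] x(3) by (auto simp: indices_def)
    then have "list_all2 (\<lambda>w e. w \<in> Omega1_part n W e) (map dx (sorted_list_of_set J)) (replicate m 1)"
      using index_list(2)[OF x(3)] by (auto simp: list_all2_conv_all_nth simp del: sorted_list_of_set.set_sorted_key_list_of_set)
    moreover have "d + sum_list (replicate m 1) = z" using x(4) by (simp add: sum_list_replicate)
    moreover have "length (map dx (sorted_list_of_set J)) = m" using index_list(2)[OF x(3)] by simp
    ultimately show "x \<in> ?G" unfolding x(1) dxJ_def using x(2) by blast
  qed
  have 3: "?G \<subseteq> carrier \<Omega>" using 1 \<Omega>m.span_over_closed[OF gens_closed] by blast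
  then have 4: "gens z \<subseteq> span_over \<kappa> \<Omega> ?G" using 2 \<Omega>m.span_over_superset[of ?G] by (meson subset_iff)
  show ?thesis
    unfolding Omega_part_def
    using \<Omega>m.span_over_subset[OF 1 gens_closed] \<Omega>m.span_over_subset[OF 4 3] by (rule antisym)
qed

end

section \<open>Upper bound and monotonicity\<close>

context fat_point_forms
begin

text \<open>One such family in degree \<open>d\<close> controls the forms of degree
  \<open>d + m\<close>, for the upper and for the lower bound.\<close>

definition interpolating :: "nat \<Rightarrow> (nat \<times> (nat \<Rightarrow>\<^sub>0 nat) \<Rightarrow> 'k mpoly) \<Rightarrow> bool"
  where "interpolating d F \<longleftrightarrow> (\<forall>x\<in>jet_index \<mu>. F x \<in> homogeneous_part n d) \<and>
    (\<forall>x\<in>jet_index \<mu>. \<forall>y\<in>jet_index \<mu>. jet (F x) y = (if x = y then 1 else 0))"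

definition interp_forms :: "(nat \<times> (nat \<Rightarrow>\<^sub>0 nat) \<Rightarrow> 'k mpoly) \<Rightarrow> (('k mpoly set \<Rightarrow> 'k mpoly set) set list \<Rightarrow> 'k mpoly set) set set"
  where "interp_forms F = (\<lambda>(x, J). cls (F x) \<odot>\<^bsub>\<Omega>\<^esub> dxJ J) ` (jet_index \<mu> \<times> indices)"

lemma gens_add: "gens (d + m) = {cls f \<odot>\<^bsub>\<Omega>\<^esub> dxJ J | f J. f \<in> homogeneous_part n d \<and> J \<in> indices}"
  by (auto simp: gens_def coord_part_def)

lemma interp_forms_gens: "interpolating d F \<Longrightarrow> interp_forms F \<subseteq> gens (d + m)"
  by (auto simp: interp_forms_def gens_add interpolating_def)

text \<open>Additivity of \<open>cls\<close> is available on the carrier, so carrier membership of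
  the partial sums is carried along in the induction.\<close>

lemma cls_smult_sum:
  assumes "\<And>a. a \<in> A \<Longrightarrow> G a \<in> carrier (mpoly_ring n)" and J: "J \<in> indices" and B: "B \<subseteq> carrier \<Omega>"
    and "\<And>a. a \<in> A \<Longrightarrow> cls (G a) \<odot>\<^bsub>\<Omega>\<^esub> dxJ J \<in> span_over \<kappa> \<Omega> B"
  shows "sum G A \<in> carrier (mpoly_ring n) \<and> cls (sum G A) \<odot>\<^bsub>\<Omega>\<^esub> dxJ J \<in> span_over \<kappa> \<Omega> B"
proof -
  have 0: "cls 0 = \<kappa> 0" by (simp add: coord_const_def)
  show ?thesis using assms(1,4)
  proof (induction A rule: infinite_finite_induct)
    case (insert a A)
    then show ?case
      using \<Omega>m.span_over_add[OF B] by (simp add: cls_add \<Omega>m.smult_l_distr cls_closed dxJ_closed[OF J])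
  qed (use \<Omega>m.span_over_zero[OF B] dxJ_closed[OF J] in \<open>auto simp: 0 \<Omega>m.scalar_zero\<close>)
qed

text \<open>Modulo \<open>W\<close> a form is the combination of the \<open>F x\<close> with its own
  jets as coefficients, so finitely many products span the piece.\<close>

lemma Omega_part_interp:
  assumes F: "interpolating d F"
  shows "Omega_part m n W (d + m) = span_over \<kappa> \<Omega> (interp_forms F)"
proof -
  let ?B = "interp_forms F"
  have B: "?B \<subseteq> carrier \<Omega>" using interp_forms_gens[OF F] gens_closed by blast
  have "cls f \<odot>\<^bsub>\<Omega>\<^esub> dxJ J \<in> span_over \<kappa> \<Omega> ?B" if f: "f \<in> homogeneous_part n d" and J: "J \<in> indices" for f J
  proof -
    let ?G = "\<lambda>x. mpoly_const (jet f x) * F x"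
    have FC: "F x \<in> carrier (mpoly_ring n)" if "x \<in> jet_index \<mu>" for x
      using F that homogeneous_carrier by (auto simp: interpolating_def)
    have "cls (?G x) \<odot>\<^bsub>\<Omega>\<^esub> dxJ J \<in> span_over \<kappa> \<Omega> ?B" if x: "x \<in> jet_index \<mu>" for x
    proof -
      have "cls (?G x) \<odot>\<^bsub>\<Omega>\<^esub> dxJ J = \<kappa> (jet f x) \<odot>\<^bsub>\<Omega>\<^esub> (cls (F x) \<odot>\<^bsub>\<Omega>\<^esub> dxJ J)"
        using FC[OF x] dxJ_closed[OF J] by (simp add: coord_const_def cls_mult \<Omega>m.smult_assoc1 cls_closed)
      moreover have "cls (F x) \<odot>\<^bsub>\<Omega>\<^esub> dxJ J \<in> ?B"
        using x J by (auto simp: interp_forms_def)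
      ultimately show ?thesis
        using \<Omega>m.span_over_smult[OF B \<Omega>m.span_over_superset[OF B]] by simp
    qed
    then have *: "sum ?G (jet_index \<mu>) \<in> carrier (mpoly_ring n) \<and> cls (sum ?G (jet_index \<mu>)) \<odot>\<^bsub>\<Omega>\<^esub> dxJ J \<in> span_over \<kappa> \<Omega> ?B"
      by (intro cls_smult_sum[OF _ J B]) (use FC in auto)
    have "f - sum ?G (jet_index \<mu>) \<in> W"
      using F f by (intro jet_expansion(1)[where d = d]) (auto simp: interpolating_def)
    then have "cls f = cls (sum ?G (jet_index \<mu>))"
      using * homogeneous_carrier[OF f] by (intro cls_eqI) auto
    then show ?thesis using * by simp
  qed
  then have gens_sub: "gens (d + m) \<subseteq> span_over \<kappa> \<Omega> ?B" by (auto simp: gens_add)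
  have "?B \<subseteq> span_over \<kappa> \<Omega> (gens (d + m))"
    using interp_forms_gens[OF F] \<Omega>m.span_over_superset[OF gens_closed] by blast
  then show ?thesis
    unfolding Omega_part_eq
    using \<Omega>m.span_over_subset[OF gens_sub B] \<Omega>m.span_over_subset[OF _ gens_closed] by blast
qed

lemma interp_forms_closed: "interpolating d F \<Longrightarrow> interp_forms F \<subseteq> carrier \<Omega>"
  using interp_forms_gens gens_closed by blast

lemma finite_interp_forms: "finite (interp_forms F)"
  by (simp add: interp_forms_def)

lemma HF_upper:
  assumes "interpolating d F" shows "HF_Omega m n W (d + m) \<le> card (jet_index \<mu>) * card indices"
proof -
  have "HF_Omega m n W (d + m) \<le> card (interp_forms F)"
    unfolding HF_Omega_def Omega_part_interp[OF assms]
    by (rule \<Omega>m.dim_over_span_le[OF interp_forms_closed[OF assms] finite_interp_forms])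
  also have "\<dots> \<le> card (jet_index \<mu> \<times> indices)"
    unfolding interp_forms_def by (rule card_image_le) simp
  finally show ?thesis by (simp add: card_cartesian_product)
qed

text \<open>Multiplication by \<open>x\<^sub>0\<close> maps each graded piece of large degree onto the next one.\<close>

lemma HF_decreasing:
  assumes F: "interpolating d F" shows "HF_Omega m n W (Suc d + m) \<le> HF_Omega m n W (d + m)"
proof -
  note B0 = interp_forms_closed[OF F]
  \<comment> \<open>A basis of the piece of degree \<open>d + m\<close>; its image under
    \<open>x_0\<close> will turn out to span the next piece.\<close>
  obtain B where B: "finite B" "B \<subseteq> Omega_part m n W (d + m)" "card B = HF_Omega m n W (d + m)"
    "span_over \<kappa> \<Omega> B = Omega_part m n W (d + m)"
    unfolding HF_Omega_def Omega_part_interp[OF F]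
    by (rule \<Omega>m.dim_over_basis[OF interp_forms_closed[OF F] finite_interp_forms])
  define X where "X v = cls (mpoly_var 0) \<odot>\<^bsub>\<Omega>\<^esub> v" for v
  have x0: "cls (mpoly_var 0) \<in> carrier R" by (simp add: cls_closed)
  have BC: "B \<subseteq> carrier \<Omega>"
    using B(2) \<Omega>m.span_over_closed[OF B0] unfolding Omega_part_interp[OF F] by blast
  have XB: "X ` B \<subseteq> carrier \<Omega>" using BC x0 by (auto simp: X_def)
  have X_add: "X (v \<oplus>\<^bsub>\<Omega>\<^esub> w) = X v \<oplus>\<^bsub>\<Omega>\<^esub> X w" if "v \<in> carrier \<Omega>" "w \<in> carrier \<Omega>" for v w
    using that x0 by (simp add: X_def \<Omega>m.smult_r_distr)
  have X_smult: "X (\<kappa> c \<odot>\<^bsub>\<Omega>\<^esub> v) = \<kappa> c \<odot>\<^bsub>\<Omega>\<^esub> X v" if "v \<in> carrier \<Omega>" for c v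
    using that x0 by (simp add: X_def \<Omega>m.smult_assoc1[symmetric] \<Omega>1.m_comm)
  have X_zero: "X \<zero>\<^bsub>\<Omega>\<^esub> = \<zero>\<^bsub>\<Omega>\<^esub>" using x0 by (simp add: X_def \<Omega>m.smult_r_null)
  have X_span: "X v \<in> span_over \<kappa> \<Omega> T" if "v \<in> span_over \<kappa> \<Omega> A" "A \<subseteq> carrier \<Omega>" "T \<subseteq> carrier \<Omega>" "X ` A \<subseteq> span_over \<kappa> \<Omega> T" for v A T
  proof -
    have "span_over \<kappa> \<Omega> A \<subseteq> {v \<in> carrier \<Omega>. X v \<in> span_over \<kappa> \<Omega> T}"
      by (rule \<Omega>m.span_over_minimal)
        (use that X_add X_smult X_zero \<Omega>m.span_over_zero \<Omega>m.span_over_add \<Omega>m.span_over_smult in auto)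
    then show ?thesis using that by blast
  qed
  have X_cls: "X (cls g \<odot>\<^bsub>\<Omega>\<^esub> dxJ J) = cls (mpoly_var 0 * g) \<odot>\<^bsub>\<Omega>\<^esub> dxJ J"
    if "g \<in> homogeneous_part n d" "J \<in> indices" for g J
    using that homogeneous_carrier[OF that(1)] dxJ_closed[OF that(2)]
    by (simp add: X_def cls_mult \<Omega>m.smult_assoc1 cls_closed)
  have "gens (Suc d + m) \<subseteq> span_over \<kappa> \<Omega> (X ` B)"
  proof
    fix v assume "v \<in> gens (Suc d + m)"
    then obtain f J where f: "f \<in> homogeneous_part n (Suc d)" and J: "J \<in> indices" and v: "v = cls f \<odot>\<^bsub>\<Omega>\<^esub> dxJ J"
      unfolding gens_add by blast
    \<comment> \<open>Since \<open>X_0 * g\<close> has the same jets as \<open>f\<close>, this form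
      yields a preimage of \<open>v\<close> under \<open>X\<close>.\<close>
    define g where "g = (\<Sum>x\<in>jet_index \<mu>. mpoly_const (jet f x) * F x)"
    have g: "g \<in> homogeneous_part n d"
      unfolding g_def using F by (intro homogeneous_sum homogeneous_const_mult) (auto simp: interpolating_def)
    have "f - mpoly_var 0 * g \<in> W"
      unfolding g_def using F f by (intro jet_expansion(2)[where d = d]) (auto simp: interpolating_def)
    then have "cls f = cls (mpoly_var 0 * g)"
      using homogeneous_carrier[OF f] homogeneous_carrier[OF g] by (intro cls_eqI) auto
    then have "v = X (cls g \<odot>\<^bsub>\<Omega>\<^esub> dxJ J)" by (simp add: v X_cls[OF g J])
    moreover have "cls g \<odot>\<^bsub>\<Omega>\<^esub> dxJ J \<in> gens (d + m)" using g J by (auto simp: gens_add)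
    then have "cls g \<odot>\<^bsub>\<Omega>\<^esub> dxJ J \<in> span_over \<kappa> \<Omega> B"
      unfolding B(4) Omega_part_eq by (rule \<Omega>m.span_over_superset[OF gens_closed])
    then have "X (cls g \<odot>\<^bsub>\<Omega>\<^esub> dxJ J) \<in> span_over \<kappa> \<Omega> (X ` B)"
      by (rule X_span[OF _ BC XB]) (use \<Omega>m.span_over_superset[OF XB] in blast)
    ultimately show "v \<in> span_over \<kappa> \<Omega> (X ` B)" by simp
  qed
  then have 1: "span_over \<kappa> \<Omega> (gens (Suc d + m)) \<subseteq> span_over \<kappa> \<Omega> (X ` B)"
    by (rule \<Omega>m.span_over_subset[OF _ XB])
  have "X ` gens (d + m) \<subseteq> gens (Suc d + m)"
    using X_cls homogeneous_mult[OF homogeneous_var[of 0 n]] unfolding gens_add by fastforce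
  then have "X ` gens (d + m) \<subseteq> span_over \<kappa> \<Omega> (gens (Suc d + m))"
    using \<Omega>m.span_over_superset[OF gens_closed] by blast
  then have "X ` B \<subseteq> span_over \<kappa> \<Omega> (gens (Suc d + m))"
    using X_span[OF _ gens_closed gens_closed] B(2) unfolding Omega_part_eq by blast
  then have 2: "span_over \<kappa> \<Omega> (X ` B) \<subseteq> span_over \<kappa> \<Omega> (gens (Suc d + m))"
    by (rule \<Omega>m.span_over_subset[OF _ gens_closed])
  have "HF_Omega m n W (Suc d + m) = dim_over \<kappa> \<Omega> (span_over \<kappa> \<Omega> (X ` B))"
    unfolding HF_Omega_def Omega_part_eq using antisym[OF 1 2] by simp
  also have "\<dots> \<le> card (X ` B)"
    by (rule \<Omega>m.dim_over_span_le[OF XB]) (use B(1) in simp)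
  also have "\<dots> \<le> card B" using B(1) by (rule card_image_le)
  finally show ?thesis using B(3) by simp
qed

end

section \<open>Lower bound\<close>

text \<open>The value on \<open>ws\<close> of the exterior product of the forms
  \<open>D 0, ..., D (m - 1)\<close>.\<close>

definition leibniz :: "nat \<Rightarrow> (nat \<Rightarrow> 'm \<Rightarrow> 'b::comm_ring_1) \<Rightarrow> 'm list \<Rightarrow> 'b"
  where "leibniz m D ws = det (mat m m (\<lambda>(b, a). D a (ws ! b)))"

text \<open>As a function of the entry in slot \<open>i\<close> the determinant is a combination of
  the \<open>D (p i)\<close> with coefficients independent of \<open>u\<close>. Thus linearity of
  the \<open>D a\<close>, even if valid only modulo an ideal, carries over to the
  determinant.\<close>

lemma leibniz_update:
  assumes "i < m" "length ws = m"
  obtains c where "\<And>u. leibniz m D (ws[i := u]) = (\<Sum>p | p permutes {0..<m}. c p * D (p i) u)"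
proof
  fix u
  \<comment> \<open>The permutation expansion with the factor of row \<open>i\<close> taken
    out.\<close>
  let ?C = "\<lambda>p. signof p * (\<Prod>b\<in>{0..<m} - {i}. D (p b) (ws ! b))"
  have "(\<Prod>b = 0..<m. mat m m (\<lambda>(b, a). D a (ws[i := u] ! b)) $$ (b, p b)) =
      D (p i) u * (\<Prod>b\<in>{0..<m} - {i}. D (p b) (ws ! b))" if p: "p permutes {0..<m}" for p
  proof -
    have "(\<Prod>b = 0..<m. mat m m (\<lambda>(b, a). D a (ws[i := u] ! b)) $$ (b, p b)) = (\<Prod>b = 0..<m. D (p b) (ws[i := u] ! b))"
      using permutes_in_image[OF p] by (intro prod.cong) auto
    also have "\<dots> = D (p i) (ws[i := u] ! i) * (\<Prod>b\<in>{0..<m} - {i}. D (p b) (ws[i := u] ! b))"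
      using assms by (intro prod.remove) auto
    also have "(\<Prod>b\<in>{0..<m} - {i}. D (p b) (ws[i := u] ! b)) = (\<Prod>b\<in>{0..<m} - {i}. D (p b) (ws ! b))"
      by (intro prod.cong) auto
    finally show ?thesis using assms by simp
  qed
  then show "leibniz m D (ws[i := u]) = (\<Sum>p | p permutes {0..<m}. ?C p * D (p i) u)"
    unfolding leibniz_def by (subst det_def'[where n = m]) (auto intro!: sum.cong simp: ac_simps)
qed

lemma leibniz_not_distinct:
  assumes "length ws = m" "\<not> distinct ws" shows "leibniz m D ws = 0"
proof -
  obtain i j where ij: "i < m" "j < m" "i \<noteq> j" "ws ! i = ws ! j"
    using assms by (auto simp: distinct_conv_nth)
  show ?thesis unfolding leibniz_def
    by (rule det_identical_rows[OF _ ij(3,1,2)]) (use ij in \<open>auto intro!: eq_vecI\<close>)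
qed

text \<open>For equal index sets the matrix is the identity. For different sets of the same size
  some element of \<open>J'\<close> is missing from \<open>J\<close>, and its row is zero.\<close>

lemma det_index_lists:
  assumes "finite J" "finite J'" "card J = m" "card J' = m"
  shows "det (mat m m (\<lambda>(b, a). if sorted_list_of_set J' ! b = sorted_list_of_set J ! a then 1 else 0))
    = (if J = J' then 1 else (0 :: 'b::comm_ring_1))" (is "det ?A = _")
proof -
  note fin = assms(1,2)
  have len: "length (sorted_list_of_set J) = m" "length (sorted_list_of_set J') = m" using assms by auto
  show ?thesis
  proof (cases "J = J'")
    case True
    have "?A = 1\<^sub>m m"
    proof (rule eq_matI)
      fix b a assume "b < dim_row (1\<^sub>m m :: 'b mat)" "a < dim_col (1\<^sub>m m :: 'b mat)"
      then have ba: "b < m" "a < m" by auto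
      then have "sorted_list_of_set J ! b = sorted_list_of_set J ! a \<longleftrightarrow> b = a"
        using len(1) by (intro nth_eq_iff_index_eq distinct_sorted_list_of_set) auto
      then show "?A $$ (b, a) = 1\<^sub>m m $$ (b, a)"
        using ba True by simp
    qed simp_all
    then show ?thesis using True by simp
  next
    case False
    then have "\<not> J' \<subseteq> J" using assms fin card_subset_eq by metis
    then obtain x where x: "x \<in> J'" "x \<notin> J" by blast
    then obtain b where b: "b < m" "sorted_list_of_set J' ! b = x"
      using len fin by (metis in_set_conv_nth set_sorted_list_of_set)
    have "(\<Prod>i = 0..<m. ?A $$ (i, p i)) = 0" if p: "p permutes {0..<m}" for p
    proof (rule prod_zero[OF finite_atLeastLessThan], rule bexI[of _ b])
      have pb: "p b < m" using permutes_in_image[OF p, of b] b by simp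
      then have "sorted_list_of_set J ! p b \<in> J" using len fin by (metis nth_mem set_sorted_list_of_set)
      then show "?A $$ (b, p b) = 0" using pb b x by auto
    qed (use b in simp)
    then show ?thesis using False by (subst det_def'[where n = m]) auto
  qed
qed

section \<open>Contractions modulo the ideal of the smaller scheme\<close>

context fat_points
begin

text \<open>The vanishing conditions of the smaller scheme in the chart \<open>X_0 = 1\<close>,
  imposed on all polynomials so that \<open>V\<close> is an ideal of the type-class ring. A point
  with \<open>\<mu> i = 1\<close> imposes no condition.\<close>

definition V :: "'k mpoly set"
  where "V = {f. \<forall>i\<in>{1..s}. shift (loc i) f \<in> order_ge (\<mu> i - 1)}"

lemma W_V: "f \<in> W \<Longrightarrow> f \<in> V"
  using W_vanish_order(1) order_ge_mono[OF _ diff_le_self] by (fastforce simp: V_def vanish_order_def)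

lemma pderiv_W_V: "f \<in> W \<Longrightarrow> pderiv_var j f \<in> V"
  using W_vanish_order(2) by (auto simp: V_def vanish_order_def)

lemma jet_V: "f \<in> V \<Longrightarrow> x \<in> jet_index (\<lambda>i. \<mu> i - 1) \<Longrightarrow> jet f x = 0"
  by (auto simp: V_def jet_def jet_index_def exponents_def order_ge_def)

sublocale ideal_congruence V
  by unfold_locales (auto simp: V_def shift_add shift_mult intro: order_ge_add order_ge_mult_left)

notation cong_mod (infix "\<approx>" 50)

text \<open>The choice made by \<open>lift\<close> is ambiguous up to \<open>W\<close>; elements of
  \<open>W\<close> and their derivatives lie in \<open>V\<close>, so modulo \<open>V\<close> the
  choice is invisible.\<close>

lemma lift_cls_cong: "f \<in> carrier (mpoly_ring n) \<Longrightarrow> lift (cls f) \<approx> f"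
  and pderiv_lift_cls_cong: "f \<in> carrier (mpoly_ring n) \<Longrightarrow> pderiv_var j (lift (cls f)) \<approx> pderiv_var j f"
  using W_V[OF lift_cls] pderiv_W_V[OF lift_cls] by (simp_all add: cong_mod_def pderiv_var_minus)

lemma cls_lift_add: "a \<in> carrier R \<Longrightarrow> b \<in> carrier R \<Longrightarrow> a \<oplus>\<^bsub>R\<^esub> b = cls (lift a + lift b)"
  and cls_lift_mult: "a \<in> carrier R \<Longrightarrow> b \<in> carrier R \<Longrightarrow> a \<otimes>\<^bsub>R\<^esub> b = cls (lift a * lift b)"
  by (simp_all add: cls_add cls_mult lift)

sublocale ring_rep R V lift
proof (rule ring_rep.intro[OF R_cring ideal_congruence_axioms], unfold_locales)
  fix a b assume ab: "a \<in> carrier R" "b \<in> carrier R"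
  show "lift (a \<oplus>\<^bsub>R\<^esub> b) \<approx> lift a + lift b"
    using ab lift_cls_cong[of "lift a + lift b"] by (simp add: cls_lift_add lift)
  show "lift (a \<otimes>\<^bsub>R\<^esub> b) \<approx> lift a * lift b"
    using ab lift_cls_cong[of "lift a * lift b"] by (simp add: cls_lift_mult lift)
next
  show "lift \<one>\<^bsub>R\<^esub> \<approx> 1" using lift_cls_cong[of 1] by (simp add: cls_one)
qed

text \<open>Sending \<open>da\<close> to \<open>pderiv_var j (lift a)\<close> respects additivity,
  the Leibniz rule and constants modulo \<open>V\<close>, hence extends to all differentials. For
  \<open>j \<le> n\<close> this is the linear form dual to \<open>dx j\<close>.\<close>

lemma ex_contraction:
  "\<exists>D. (\<forall>i\<le>n. D (dx i) \<approx> (if i = j then 1 else 0)) \<and>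
    (\<forall>v\<in>carrier \<Omega>\<^sub>1. \<forall>w\<in>carrier \<Omega>\<^sub>1. D (v \<oplus>\<^bsub>\<Omega>\<^sub>1\<^esub> w) \<approx> D v + D w) \<and>
    (\<forall>r\<in>carrier R. \<forall>v\<in>carrier \<Omega>\<^sub>1. D (r \<odot>\<^bsub>\<Omega>\<^sub>1\<^esub> v) \<approx> lift r * D v)"
proof -
  let ?C = "range \<kappa>" and ?F = "free_module R (carrier R)"
  interpret F: Module.module R ?F by (rule cring.free_module_module[OF R_cring])
  define \<theta> where "\<theta> a = pderiv_var j (lift a)" for a
  note Rel = kaehler_rels_carrier[OF R_cring range_const]
  note gen = cring.free_gen_closed[OF R_cring]
  have kills: "lin_val \<theta> g \<approx> 0" if g: "g \<in> kaehler_rels ?C R" for g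
  proof -
    consider (add) a b where "a \<in> carrier R" "b \<in> carrier R"
        "g = free_gen R (a \<oplus>\<^bsub>R\<^esub> b) \<ominus>\<^bsub>?F\<^esub> (free_gen R a \<oplus>\<^bsub>?F\<^esub> free_gen R b)"
      | (mult) a b where "a \<in> carrier R" "b \<in> carrier R"
        "g = free_gen R (a \<otimes>\<^bsub>R\<^esub> b) \<ominus>\<^bsub>?F\<^esub> (a \<odot>\<^bsub>?F\<^esub> free_gen R b \<oplus>\<^bsub>?F\<^esub> b \<odot>\<^bsub>?F\<^esub> free_gen R a)"
      | (const) c where "g = free_gen R (\<kappa> c)"
      using g unfolding kaehler_rels_def Let_def by blast
    then show ?thesis
    proof cases
      case add
      have "lin_val \<theta> g \<approx> lin_val \<theta> (free_gen R (a \<oplus>\<^bsub>R\<^esub> b)) - lin_val \<theta> (free_gen R a \<oplus>\<^bsub>?F\<^esub> free_gen R b)"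
        unfolding add(3) using add(1,2) by (intro lin_val_minus gen F.M.a_closed) auto
      also have "\<dots> \<approx> lin_val \<theta> (free_gen R (a \<oplus>\<^bsub>R\<^esub> b)) - (lin_val \<theta> (free_gen R a) + lin_val \<theta> (free_gen R b))"
        unfolding free_module_simps using add(1,2) by (intro cong_diff cong_refl lin_val_add gen)
      also have "\<dots> \<approx> \<theta> (a \<oplus>\<^bsub>R\<^esub> b) - (\<theta> a + \<theta> b)"
        by (intro cong_diff cong_add lin_val_gen)
      \<comment> \<open>The sum of \<open>a\<close> and \<open>b\<close> is the class of
        \<open>lift a + lift b\<close>, so the derivative of its own lift is known modulo
        \<open>V\<close>.\<close>
      also have "\<dots> \<approx> pderiv_var j (lift a + lift b) - (\<theta> a + \<theta> b)"
        unfolding \<theta>_def cls_lift_add[OF add(1,2)]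
        using add(1,2) by (intro cong_diff cong_refl pderiv_lift_cls_cong) (simp add: lift)
      finally show ?thesis by (simp add: \<theta>_def pderiv_var_add)
    next
      case mult
      have "lin_val \<theta> g \<approx> lin_val \<theta> (free_gen R (a \<otimes>\<^bsub>R\<^esub> b)) - lin_val \<theta> (a \<odot>\<^bsub>?F\<^esub> free_gen R b \<oplus>\<^bsub>?F\<^esub> b \<odot>\<^bsub>?F\<^esub> free_gen R a)"
        unfolding mult(3) using mult(1,2) by (intro lin_val_minus gen F.M.a_closed F.smult_closed) auto
      also have "\<dots> \<approx> lin_val \<theta> (free_gen R (a \<otimes>\<^bsub>R\<^esub> b)) -
          (lin_val \<theta> (a \<odot>\<^bsub>?F\<^esub> free_gen R b) + lin_val \<theta> (b \<odot>\<^bsub>?F\<^esub> free_gen R a))"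
        unfolding free_module_simps(2)
        using mult(1,2) by (intro cong_diff cong_refl lin_val_add[where X = "carrier R"] F.smult_closed gen)
      also have "\<dots> \<approx> \<theta> (a \<otimes>\<^bsub>R\<^esub> b) - (lift a * lin_val \<theta> (free_gen R b) + lift b * lin_val \<theta> (free_gen R a))"
        unfolding free_module_simps(3)
        using mult(1,2) by (intro cong_diff cong_add lin_val_gen lin_val_smult gen)
      also have "\<dots> \<approx> \<theta> (a \<otimes>\<^bsub>R\<^esub> b) - (lift a * \<theta> b + lift b * \<theta> a)"
        by (intro cong_diff cong_add cong_mult cong_refl lin_val_gen)
      also have "\<dots> \<approx> pderiv_var j (lift a * lift b) - (lift a * \<theta> b + lift b * \<theta> a)"
        unfolding \<theta>_def cls_lift_mult[OF mult(1,2)]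
        using mult(1,2) by (intro cong_diff cong_refl pderiv_lift_cls_cong) (simp add: lift)
      finally show ?thesis by (simp add: \<theta>_def pderiv_var_mult)
    next
      case const
      have "lin_val \<theta> g \<approx> \<theta> (cls (mpoly_const c))"
        unfolding const coord_const_def by (rule lin_val_gen)
      also have "\<dots> \<approx> pderiv_var j (mpoly_const c)"
        unfolding \<theta>_def by (rule pderiv_lift_cls_cong) simp
      finally show ?thesis by simp
    qed
  qed
  obtain D where D: "\<And>x. x \<in> carrier R \<Longrightarrow> D (presented_gen R (carrier R) (kaehler_rels ?C R) x) \<approx> \<theta> x"
    "\<And>A B. A \<in> carrier \<Omega>\<^sub>1 \<Longrightarrow> B \<in> carrier \<Omega>\<^sub>1 \<Longrightarrow> D (A \<oplus>\<^bsub>\<Omega>\<^sub>1\<^esub> B) \<approx> D A + D B"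
    "\<And>r A. r \<in> carrier R \<Longrightarrow> A \<in> carrier \<Omega>\<^sub>1 \<Longrightarrow> D (r \<odot>\<^bsub>\<Omega>\<^sub>1\<^esub> A) \<approx> lift r * D A"
    using presented_module_lift[OF Rel kills] unfolding Omega1_def kaehler_def by blast
  have "D (dx i) \<approx> (if i = j then 1 else 0)" if "i \<le> n" for i
  proof -
    have "D (dx i) \<approx> \<theta> (cls (mpoly_var i))"
      unfolding dX_def univ_deriv_def by (rule D(1)[OF cls_closed]) (use that in simp)
    also have "\<dots> \<approx> pderiv_var j (mpoly_var i)"
      unfolding \<theta>_def by (rule pderiv_lift_cls_cong) (use that in simp)
    finally show ?thesis by (simp add: pderiv_var_var)
  qed
  then show ?thesis using D(2,3) by (intro exI[of _ D]) blast
qed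

definition contraction :: "nat \<Rightarrow> ('k mpoly set \<Rightarrow> 'k mpoly set) set \<Rightarrow> 'k mpoly"
  where "contraction j = (SOME D. (\<forall>i\<le>n. D (dx i) \<approx> (if i = j then 1 else 0)) \<and>
    (\<forall>v\<in>carrier \<Omega>\<^sub>1. \<forall>w\<in>carrier \<Omega>\<^sub>1. D (v \<oplus>\<^bsub>\<Omega>\<^sub>1\<^esub> w) \<approx> D v + D w) \<and>
    (\<forall>r\<in>carrier R. \<forall>v\<in>carrier \<Omega>\<^sub>1. D (r \<odot>\<^bsub>\<Omega>\<^sub>1\<^esub> v) \<approx> lift r * D v))"

lemma contraction:
  shows contraction_dx: "i \<le> n \<Longrightarrow> contraction j (dx i) \<approx> (if i = j then 1 else 0)"
    and contraction_add: "v \<in> carrier \<Omega>\<^sub>1 \<Longrightarrow> w \<in> carrier \<Omega>\<^sub>1 \<Longrightarrow>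
      contraction j (v \<oplus>\<^bsub>\<Omega>\<^sub>1\<^esub> w) \<approx> contraction j v + contraction j w"
    and contraction_smult: "r \<in> carrier R \<Longrightarrow> v \<in> carrier \<Omega>\<^sub>1 \<Longrightarrow>
      contraction j (r \<odot>\<^bsub>\<Omega>\<^sub>1\<^esub> v) \<approx> lift r * contraction j v"
  using someI_ex[OF ex_contraction[of j]] unfolding contraction_def by blast+

end

context fat_point_forms
begin

text \<open>The determinant of the contractions indexed by \<open>J\<close> is alternating, and
  multilinear modulo \<open>V\<close>, so it descends to the exterior power. Its values on the
  standard wedges make it the coefficient of \<open>dxJ J\<close>, read modulo
  \<open>V\<close>.\<close>

lemma ex_coefficient:
  assumes J: "J \<in> indices"
  shows "\<exists>val. (\<forall>J'\<in>indices. val (dxJ J') \<approx> (if J = J' then 1 else 0)) \<and>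
    (\<forall>v\<in>carrier \<Omega>. \<forall>w\<in>carrier \<Omega>. val (v \<oplus>\<^bsub>\<Omega>\<^esub> w) \<approx> val v + val w) \<and>
    (\<forall>r\<in>carrier R. \<forall>v\<in>carrier \<Omega>. val (r \<odot>\<^bsub>\<Omega>\<^esub> v) \<approx> lift r * val v)"
proof -
  let ?F = "free_module R ext.L" and ?M = "\<Omega>\<^sub>1"
  interpret F: Module.module R ?F by (rule cring.free_module_module[OF R_cring])
  define D where "D a = contraction (sorted_list_of_set J ! a)" for a
  define \<theta> where "\<theta> = leibniz m D"
  note gen = cring.free_gen_closed[OF R_cring]
  have D_add: "D a (v \<oplus>\<^bsub>?M\<^esub> w) \<approx> D a v + D a w" if "v \<in> carrier ?M" "w \<in> carrier ?M" for a v w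
    unfolding D_def using that by (rule contraction_add)
  have D_smult: "D a (r \<odot>\<^bsub>?M\<^esub> v) \<approx> lift r * D a v" if "r \<in> carrier R" "v \<in> carrier ?M" for a r v
    unfolding D_def using that by (rule contraction_smult)
  have kills: "lin_val \<theta> g \<approx> 0" if g: "g \<in> ext_rels m R ?M" for g
  proof -
    consider (add) ws i v w where "ws \<in> ext.L" "i < m" "v \<in> carrier ?M" "w \<in> carrier ?M"
        "g = free_gen R (ws[i := v \<oplus>\<^bsub>?M\<^esub> w]) \<ominus>\<^bsub>?F\<^esub> (free_gen R (ws[i := v]) \<oplus>\<^bsub>?F\<^esub> free_gen R (ws[i := w]))"
      | (smult) ws i r v where "ws \<in> ext.L" "i < m" "r \<in> carrier R" "v \<in> carrier ?M"
        "g = free_gen R (ws[i := r \<odot>\<^bsub>?M\<^esub> v]) \<ominus>\<^bsub>?F\<^esub> r \<odot>\<^bsub>?F\<^esub> free_gen R (ws[i := v])"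
      | (alt) ws where "ws \<in> ext.L" "\<not> distinct ws" "g = free_gen R ws"
      using g unfolding ext_rels_def Let_def by blast
    then show ?thesis
    proof cases
      case add
      have c: "free_gen R (ws[i := u]) \<in> carrier ?F" if "u \<in> carrier ?M" for u
        using add that by (intro gen ext.ext_lists_update)
      have vw: "v \<oplus>\<^bsub>?M\<^esub> w \<in> carrier ?M" using add by simp
      obtain c' where c': "\<And>u. \<theta> (ws[i := u]) = (\<Sum>p | p permutes {0..<m}. c' p * D (p i) u)"
        unfolding \<theta>_def by (rule leibniz_update[of i m ws D]) (use add in \<open>auto simp: ext_lists_def\<close>)
      have "lin_val \<theta> g \<approx> lin_val \<theta> (free_gen R (ws[i := v \<oplus>\<^bsub>?M\<^esub> w])) -
          lin_val \<theta> (free_gen R (ws[i := v]) \<oplus>\<^bsub>?F\<^esub> free_gen R (ws[i := w]))"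
        unfolding add(5) by (intro lin_val_minus F.M.a_closed c vw add)
      also have "\<dots> \<approx> lin_val \<theta> (free_gen R (ws[i := v \<oplus>\<^bsub>?M\<^esub> w])) -
          (lin_val \<theta> (free_gen R (ws[i := v])) + lin_val \<theta> (free_gen R (ws[i := w])))"
        unfolding free_module_simps by (intro cong_diff cong_refl lin_val_add[OF c[OF add(3)] c[OF add(4)]])
      also have "\<dots> \<approx> \<theta> (ws[i := v \<oplus>\<^bsub>?M\<^esub> w]) - (\<theta> (ws[i := v]) + \<theta> (ws[i := w]))"
        by (intro cong_diff cong_add lin_val_gen)
      \<comment> \<open>Each contraction is additive modulo \<open>V\<close>, and this is applied
        termwise in the expansion along slot \<open>i\<close>.\<close>
      also have "\<dots> \<approx> (\<Sum>p | p permutes {0..<m}. c' p * (D (p i) v + D (p i) w)) - (\<theta> (ws[i := v]) + \<theta> (ws[i := w]))"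
        unfolding c' by (intro cong_diff cong_refl cong_sum cong_mult D_add add)
      also have "\<dots> = 0" by (simp add: c' distrib_left sum.distrib)
      finally show ?thesis .
    next
      case smult
      have c: "free_gen R (ws[i := u]) \<in> carrier ?F" if "u \<in> carrier ?M" for u
        using smult that by (intro gen ext.ext_lists_update)
      have rv: "r \<odot>\<^bsub>?M\<^esub> v \<in> carrier ?M" using smult by simp
      obtain c' where c': "\<And>u. \<theta> (ws[i := u]) = (\<Sum>p | p permutes {0..<m}. c' p * D (p i) u)"
        unfolding \<theta>_def by (rule leibniz_update[of i m ws D]) (use smult in \<open>auto simp: ext_lists_def\<close>)
      have "lin_val \<theta> g \<approx> lin_val \<theta> (free_gen R (ws[i := r \<odot>\<^bsub>?M\<^esub> v])) -
          lin_val \<theta> (r \<odot>\<^bsub>?F\<^esub> free_gen R (ws[i := v]))"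
        unfolding smult(5) by (intro lin_val_minus F.smult_closed c rv smult)
      also have "\<dots> \<approx> \<theta> (ws[i := r \<odot>\<^bsub>?M\<^esub> v]) - lift r * lin_val \<theta> (free_gen R (ws[i := v]))"
        unfolding free_module_simps by (intro cong_diff lin_val_gen lin_val_smult[OF smult(3) c[OF smult(4)]])
      also have "\<dots> \<approx> \<theta> (ws[i := r \<odot>\<^bsub>?M\<^esub> v]) - lift r * \<theta> (ws[i := v])"
        by (intro cong_diff cong_mult cong_refl lin_val_gen)
      also have "\<dots> \<approx> (\<Sum>p | p permutes {0..<m}. c' p * (lift r * D (p i) v)) - lift r * \<theta> (ws[i := v])"
        unfolding c' by (intro cong_diff cong_refl cong_sum cong_mult D_smult smult)
      also have "\<dots> = 0" by (simp add: c' sum_distrib_left ac_simps)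
      finally show ?thesis .
    next
      case alt
      have "lin_val \<theta> g \<approx> \<theta> ws" unfolding alt by (rule lin_val_gen)
      also have "\<theta> ws = 0" unfolding \<theta>_def using alt by (intro leibniz_not_distinct) (auto simp: ext_lists_def)
      finally show ?thesis .
    qed
  qed
  obtain val where val: "\<And>x. x \<in> ext.L \<Longrightarrow> val (wdg x) \<approx> \<theta> x"
    "\<And>A B. A \<in> carrier \<Omega> \<Longrightarrow> B \<in> carrier \<Omega> \<Longrightarrow> val (A \<oplus>\<^bsub>\<Omega>\<^esub> B) \<approx> val A + val B"
    "\<And>r A. r \<in> carrier R \<Longrightarrow> A \<in> carrier \<Omega> \<Longrightarrow> val (r \<odot>\<^bsub>\<Omega>\<^esub> A) \<approx> lift r * val A"
    using presented_module_lift[OF ext.ext_rels_carrier kills]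
    unfolding Omega_def ext_power_def wedge_def by blast
  have "val (dxJ J') \<approx> (if J = J' then 1 else 0)" if J': "J' \<in> indices" for J'
  proof -
    let ?js = "sorted_list_of_set J" and ?js' = "sorted_list_of_set J'"
    note len = index_list[OF J] index_list[OF J']
    have le: "?js' ! b \<le> n" if "b < m" for b
      using nth_mem[of b ?js'] that len J' by (auto simp: indices_def)
    have "map dx ?js' \<in> ext.L"
      using len J' dx_closed by (auto simp: ext_lists_def indices_def)
    then have "val (dxJ J') \<approx> leibniz m D (map dx ?js')"
      unfolding dxJ_def \<theta>_def[symmetric] by (rule val(1))
    also have "\<dots> \<approx> det (mat m m (\<lambda>(b, a). if ?js' ! b = ?js ! a then 1 else 0))"
      unfolding leibniz_def D_def
      using contraction_dx[OF le] len by (intro cong_det[where k = m]) auto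
    also have "\<dots> = (if J = J' then 1 else 0)"
      using J J' len by (intro det_index_lists) (auto simp: indices_def)
    finally show ?thesis .
  qed
  then show ?thesis using val(2,3) by (intro exI[of _ val]) blast
qed

text \<open>Jets of order below \<open>\<mu> i - 1\<close> vanish on \<open>V\<close>, so composing
  them with \<open>val J\<close>, which is linear modulo \<open>V\<close>, gives genuine
  \<open>K\<close>-linear functionals. They are dual to the products of the corresponding
  \<open>F x\<close> with the \<open>dxJ J\<close>.\<close>

lemma HF_lower:
  assumes F: "interpolating d F"
  shows "card (jet_index (\<lambda>i. \<mu> i - 1)) * card indices \<le> HF_Omega m n W (d + m)"
proof -
  let ?I = "jet_index (\<lambda>i. \<mu> i - 1) \<times> indices"
  have "\<forall>J\<in>indices. \<exists>val. (\<forall>J'\<in>indices. val (dxJ J') \<approx> (if J = J' then 1 else 0)) \<and>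
    (\<forall>v\<in>carrier \<Omega>. \<forall>w\<in>carrier \<Omega>. val (v \<oplus>\<^bsub>\<Omega>\<^esub> w) \<approx> val v + val w) \<and>
    (\<forall>r\<in>carrier R. \<forall>v\<in>carrier \<Omega>. val (r \<odot>\<^bsub>\<Omega>\<^esub> v) \<approx> lift r * val v)"
    using ex_coefficient by blast
  from bchoice[OF this] obtain val where val: "\<And>J J'. J \<in> indices \<Longrightarrow> J' \<in> indices \<Longrightarrow> val J (dxJ J') \<approx> (if J = J' then 1 else 0)"
    "\<And>J v w. J \<in> indices \<Longrightarrow> v \<in> carrier \<Omega> \<Longrightarrow> w \<in> carrier \<Omega> \<Longrightarrow> val J (v \<oplus>\<^bsub>\<Omega>\<^esub> w) \<approx> val J v + val J w"
    "\<And>J r v. J \<in> indices \<Longrightarrow> r \<in> carrier R \<Longrightarrow> v \<in> carrier \<Omega> \<Longrightarrow> val J (r \<odot>\<^bsub>\<Omega>\<^esub> v) \<approx> lift r * val J v"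
    by blast
  have jet_cong: "jet f x = jet g x" if "f \<approx> g" "x \<in> jet_index (\<lambda>i. \<mu> i - 1)" for f g x
    using jet_V[of "f - g" x] that by (simp add: cong_mod_def jet_minus)
  \<comment> \<open>The smaller jets are among the larger ones, so the family interpolating for
    \<open>\<mu>\<close> is dual for them as well.\<close>
  have index: "x \<in> jet_index \<mu>" if "x \<in> jet_index (\<lambda>i. \<mu> i - 1)" for x
    using that by (auto simp: jet_index_def exponents_def)
  have FC: "F x \<in> carrier (mpoly_ring n)" if "x \<in> jet_index \<mu>" for x
    using F that homogeneous_carrier by (auto simp: interpolating_def)
  have "card ?I \<le> dim_over \<kappa> \<Omega> (span_over \<kappa> \<Omega> (interp_forms F))"
  proof (rule \<Omega>m.dim_over_ge[OF interp_forms_closed[OF F] finite_interp_forms,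
        where x = "\<lambda>(x, J). cls (F x) \<odot>\<^bsub>\<Omega>\<^esub> dxJ J" and \<Lambda> = "\<lambda>(x, J) v. jet (val J v) x"])
    show "finite ?I" by simp
    show "(case y of (x, J) \<Rightarrow> cls (F x) \<odot>\<^bsub>\<Omega>\<^esub> dxJ J) \<in> span_over \<kappa> \<Omega> (interp_forms F)" if "y \<in> ?I" for y
      by (rule \<Omega>m.span_over_superset[OF interp_forms_closed[OF F]])
        (use that index in \<open>auto simp: interp_forms_def\<close>)
  next
    fix y v w assume "y \<in> ?I" and vw: "v \<in> carrier \<Omega>" "w \<in> carrier \<Omega>"
    then obtain x J where y: "y = (x, J)" "x \<in> jet_index (\<lambda>i. \<mu> i - 1)" "J \<in> indices" by auto
    show "(case y of (x, J) \<Rightarrow> \<lambda>v. jet (val J v) x) (v \<oplus>\<^bsub>\<Omega>\<^esub> w) =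
        (case y of (x, J) \<Rightarrow> \<lambda>v. jet (val J v) x) v + (case y of (x, J) \<Rightarrow> \<lambda>v. jet (val J v) x) w"
      using jet_cong[OF val(2)[OF y(3) vw] y(2)] by (simp add: y(1) jet_add)
  next
    fix y c v assume "y \<in> ?I" and v: "v \<in> carrier \<Omega>"
    then obtain x J where y: "y = (x, J)" "x \<in> jet_index (\<lambda>i. \<mu> i - 1)" "J \<in> indices" by auto
    have "val J (\<kappa> c \<odot>\<^bsub>\<Omega>\<^esub> v) \<approx> lift (\<kappa> c) * val J v"
      by (rule val(3)[OF y(3) _ v]) simp
    also have "\<dots> \<approx> mpoly_const c * val J v"
      unfolding coord_const_def by (intro cong_mult cong_refl lift_cls_cong) simp
    finally have "jet (val J (\<kappa> c \<odot>\<^bsub>\<Omega>\<^esub> v)) x = c * jet (val J v) x"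
      using jet_cong[OF _ y(2)] by (simp add: jet_const_mult[symmetric])
    then show "(case y of (x, J) \<Rightarrow> \<lambda>v. jet (val J v) x) (\<kappa> c \<odot>\<^bsub>\<Omega>\<^esub> v) =
        c * (case y of (x, J) \<Rightarrow> \<lambda>v. jet (val J v) x) v"
      by (simp add: y(1))
  next
    fix y y' assume "y \<in> ?I" "y' \<in> ?I"
    then obtain x J x' J' where y: "y = (x, J)" "x \<in> jet_index (\<lambda>i. \<mu> i - 1)" "J \<in> indices"
      and y': "y' = (x', J')" "x' \<in> jet_index (\<lambda>i. \<mu> i - 1)" "J' \<in> indices" by auto
    have "val J (cls (F x') \<odot>\<^bsub>\<Omega>\<^esub> dxJ J') \<approx> lift (cls (F x')) * val J (dxJ J')"
      using FC[OF index[OF y'(2)]] by (intro val(3) y cls_closed dxJ_closed y')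
    also have "\<dots> \<approx> F x' * (if J = J' then 1 else 0)"
      using FC[OF index[OF y'(2)]] by (intro cong_mult lift_cls_cong val(1) y y')
    finally have "jet (val J (cls (F x') \<odot>\<^bsub>\<Omega>\<^esub> dxJ J')) x = jet (F x' * (if J = J' then 1 else 0)) x"
      by (rule jet_cong[OF _ y(2)])
    \<comment> \<open>For \<open>J \<noteq> J'\<close> the jet of 0 is required;
      \<open>jet_minus\<close> applied to \<open>0 - 0\<close> shows that it is 0.\<close>
    also have "\<dots> = (if y = y' then 1 else 0)"
      using F index[OF y(2)] index[OF y'(2)] jet_minus[of 0 0 x]
      by (auto simp: y(1) y'(1) interpolating_def)
    finally show "(case y of (x, J) \<Rightarrow> \<lambda>v. jet (val J v) x) (case y' of (x, J) \<Rightarrow> cls (F x) \<odot>\<^bsub>\<Omega>\<^esub> dxJ J) = (if y = y' then 1 else 0)"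
      by (simp add: y(1) y'(1))
  qed
  then show ?thesis
    unfolding HF_Omega_def Omega_part_interp[OF F] by (simp add: card_cartesian_product)
qed

end

section \<open>Eventual constancy and the two bounds\<close>

lemma (in fat_point_forms) HF_eventually_constant:
  obtains c where "\<forall>\<^sub>F z in sequentially. HF_Omega m n W z = c"
    and "card (jet_index (\<lambda>i. \<mu> i - 1)) * card indices \<le> c" and "c \<le> card (jet_index \<mu>) * card indices"
proof -
  obtain D where "\<And>d. d \<ge> D \<Longrightarrow> \<exists>F. interpolating d F"
    using jet_interpolation unfolding interpolating_def by blast
  then have D: "HF_Omega m n W (d + m) \<le> card (jet_index \<mu>) * card indices"
    "card (jet_index (\<lambda>i. \<mu> i - 1)) * card indices \<le> HF_Omega m n W (d + m)"
    "HF_Omega m n W (Suc d + m) \<le> HF_Omega m n W (d + m)" if "d \<ge> D" for d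
    using that HF_upper HF_lower HF_decreasing by blast+
  define h where "h k = HF_Omega m n W (k + D + m)" for k
  have dec: "h (Suc k) \<le> h k" for k using D(3)[of "k + D"] by (simp add: h_def)
  then have "decseq h" by (rule decseq_SucI)
  \<comment> \<open>A decreasing sequence of natural numbers attains its minimum and stays
    there.\<close>
  define c where "c = (LEAST v. v \<in> range h)"
  have "c \<in> range h" unfolding c_def by (rule LeastI[of _ "h 0"]) simp
  then obtain k0 where k0: "h k0 = c" by auto
  have "h k = c" if "k \<ge> k0" for k
  proof (rule antisym)
    show "h k \<le> c" using decseqD[OF \<open>decseq h\<close> that] k0 by simp
    show "c \<le> h k" unfolding c_def by (rule Least_le) simp
  qed
  then have "HF_Omega m n W z = c" if "z \<ge> k0 + D + m" for z
    using that \<open>\<And>k. k \<ge> k0 \<Longrightarrow> h k = c\<close>[of "z - D - m"] by (simp add: h_def)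
  then have "\<forall>\<^sub>F z in sequentially. HF_Omega m n W z = c"
    unfolding eventually_sequentially by blast
  moreover have "HF_Omega m n W (k0 + D + m) = c" using k0 by (simp add: h_def)
  ultimately show thesis using that[of c] D(1,2)[of "k0 + D"] by simp
qed

theorem proposition7p4:
  fixes n s m :: nat
    and P :: "nat \<Rightarrow> nat \<Rightarrow> 'k::field_char_0"
    and \<mu> :: "nat \<Rightarrow> nat"
  assumes "n \<ge> 1" and "s \<ge> 1"
    and points: "\<And>i. i \<in> {1..s} \<Longrightarrow> P i 0 \<noteq> 0"
    and distinct: "\<And>i j. i \<in> {1..s} \<Longrightarrow> j \<in> {1..s} \<Longrightarrow> i \<noteq> j \<Longrightarrow> \<not> same_proj_point n (P i) (P j)"
    and multiplicities: "\<And>i. i \<in> {1..s} \<Longrightarrow> \<mu> i \<ge> 1"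
    and fat: "\<exists>i\<in>{1..s}. \<mu> i \<ge> 2"
    and "1 \<le> m" and "m \<le> n + 1"
  defines "W \<equiv> fat_point_ideal n s P \<mu>"
  shows "is_hilbert_polynomial (HF_Omega m n W) (HP_Omega m n W)
    \<and> degree (HP_Omega m n W) = 0
    \<and> (\<forall>z. of_nat (\<Sum>i=1..s. ((n + 1) choose m) * ((\<mu> i + n - 2) choose n))
              \<le> poly (HP_Omega m n W) z
          \<and> poly (HP_Omega m n W) z
              \<le> of_nat (\<Sum>i=1..s. ((n + 1) choose m) * ((\<mu> i + n - 1) choose n)))"
proof -
  interpret fat_point_forms n s P \<mu> m
    by unfold_locales (use points distinct \<open>s \<ge> 1\<close> in auto)
  have lower: "card (jet_index (\<lambda>i. \<mu> i - 1)) * card indices = (\<Sum>i=1..s. ((n + 1) choose m) * ((\<mu> i + n - 2) choose n))"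
  proof -
    \<comment> \<open>With \<open>\<mu> i \<ge> 1\<close> the truncated subtractions combine to the
      binomial of the statement.\<close>
    have "\<mu> i - 1 + n - 1 = \<mu> i + n - 2" if "i \<in> {1..s}" for i
      using multiplicities[OF that] by simp
    then show ?thesis
      using \<open>n \<ge> 1\<close> by (simp add: card_jet_index card_indices sum_distrib_left mult.commute)
  qed
  have upper: "card (jet_index \<mu>) * card indices = (\<Sum>i=1..s. ((n + 1) choose m) * ((\<mu> i + n - 1) choose n))"
    using \<open>n \<ge> 1\<close> by (simp add: card_jet_index card_indices sum_distrib_left mult.commute)
  obtain c where c: "\<forall>\<^sub>F z in sequentially. HF_Omega m n W z = c"
    "card (jet_index (\<lambda>i. \<mu> i - 1)) * card indices \<le> c" "c \<le> card (jet_index \<mu>) * card indices"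
    unfolding W_def by (rule HF_eventually_constant)
  then have "is_hilbert_polynomial (HF_Omega m n W) [:of_nat c:]"
    by (auto simp: is_hilbert_polynomial_def eventually_sequentially)
  moreover from this have "HP_Omega m n W = [:of_nat c:]"
    unfolding HP_Omega_def by (rule hilbert_polynomial_eq)
  moreover have "(of_nat (\<Sum>i=1..s. ((n + 1) choose m) * ((\<mu> i + n - 2) choose n)) :: rat) \<le> of_nat c"
    "(of_nat c :: rat) \<le> of_nat (\<Sum>i=1..s. ((n + 1) choose m) * ((\<mu> i + n - 1) choose n))"
    using c(2,3) unfolding lower upper by (simp_all only: of_nat_le_iff)
  ultimately show ?thesis by simp
qed

end
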